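(* Let $k$ be a field and let $\mathcal H_\alpha=\mathcal H_{n,q,N,\nu,\alpha}$ be the Hopf algebra over $k$ defined in the context. Then $\mathcal H_\alpha$ is self dual (that is, $\mathcal H_\alpha\cong\mathcal H_\alpha^*$ as Hopf algebras) if and only if $\alpha=0$ and either $\mathcal H_0=k\mathbb Z_N$ or $\mathcal H_0=H_{(N,\nu,\omega)}$.
   Context: $(b,c)$ denotes the greatest common divisor of integers $b,c$. Let $n,\nu,N$ be positive integers with $n\mid N$, $1\le\nu<N$; let $q\in k$ be a primitive $n$th root of unity and $r=|q^\nu|$ the multiplicative order of $q^\nu$. For $\alpha=0$, $\mathcal H_0=\mathcal H_{n,q,N,\nu,0}=H_{n,q,N,\nu}$ is the Hopf algebra generated as an algebra by $a,x$ with relations $a^N=1$, $x^r=0$, $xa=qax$, and with $\Delta(a)=a\otimes a$, $\Delta(x)=x\otimes a^\nu+1\otimes x$, $\varepsilon(a)=1$, $\varepsilon(x)=0$, antipode $s(a)=a^{-1}$, $s(x)=-q^{-\nu}a^{-\nu}x$. For $0\ne\alpha\in k$ one further assumes $(n,\nu)=1$ (hence $r=n$), $n>1$ and $N\nmid\nu n$; then $\mathcal H_\alpha=\mathcal H_{n,q,N,\nu,\alpha}$ is generated as an algebra by $a,x$ with relations $a^N=1$, $x^n=\alpha(a^{\nu n}-1)$, $xa=qax$, with the same formulas for $\Delta,\varepsilon,s$ on $a,x$. $\mathcal H_0=k\mathbb Z_N$ (the group algebra of the cyclic group of order $N$) means $x=0$, i.e. $r=1$. If the field $k$ contains a primitive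 $N$th root of unity $\omega$ such that $q=\omega^\nu$ and $N\nmid\nu^2$, then $H_{n,q,N,\nu}$ is denoted by $H_{(N,\nu,\omega)}$; so $\mathcal H_0=H_{(N,\nu,\omega)}$ means that such an $\omega\in k$ exists and $N\nmid\nu^2$.
   Formalization: When r = 1 (that is, x = 0 and H_0 = kZ_N), k is additionally assumed to contain a primitive N-th root of unity; without it the claim is false, e.g. k = Q, n = 1, ν = 1, N = 3, α = 0, where Q[Z_3] is not self dual. *)

theory Defs
  imports
    Complex_Main
    "HOL-Algebra.QuotRing"
    "HOL-Algebra.Module"
    "HOL-Library.Poly_Mapping"
begin

text \<open>
  Associative algebras over the field \<^typ>\<open>'k\<close> are records of type \<^typ>\<open>('k, 'a) module\<close>: a ring
  record together with a scalar multiplication. They need not be commutative.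
\<close>

section \<open>Algebras\<close>

definition field_alg :: "('k::field, 'k) module" where
  "field_alg = \<lparr>carrier = UNIV, mult = (*), one = 1, zero = 0, add = (+), smult = (*)\<rparr>"

text \<open>The monoid algebra \<open>k[G]\<close>: finitely supported functions on \<open>G\<close>, under convolution.\<close>

definition monoid_alg :: "('g, 'm) monoid_scheme \<Rightarrow> ('k::field, 'g \<Rightarrow>\<^sub>0 'k) module" where
  "monoid_alg G =
    \<lparr>carrier = {f. Poly_Mapping.keys f \<subseteq> carrier G},
     mult = (\<lambda>f g. \<Sum>u\<in>Poly_Mapping.keys f. \<Sum>v\<in>Poly_Mapping.keys g.
       Poly_Mapping.single (u \<otimes>\<^bsub>G\<^esub> v) (Poly_Mapping.lookup f u * Poly_Mapping.lookup g v)),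
     one = Poly_Mapping.single \<one>\<^bsub>G\<^esub> 1,
     zero = 0,
     add = (+),
     smult = (\<lambda>c. Poly_Mapping.map ((*) c))\<rparr>"

definition quot_alg :: "('k::field, 'a, 'm) module_scheme \<Rightarrow> 'a set \<Rightarrow> ('k, 'a set) module" where
  "quot_alg A I = ring.extend (A Quot I)
    (module.fields (\<lambda>c X. \<Union>f\<in>X. I +>\<^bsub>A\<^esub> (c \<odot>\<^bsub>A\<^esub> f)))"

definition opp_alg :: "('k::field, 'a, 'm) module_scheme \<Rightarrow> ('k, 'a, 'm) module_scheme" where
  "opp_alg A = A\<lparr>mult := (\<lambda>x y. y \<otimes>\<^bsub>A\<^esub> x)\<rparr>"

definition alg_hom ::
  "('k::field, 'a, 'm) module_scheme \<Rightarrow> ('k, 'b, 'n) module_scheme \<Rightarrow> ('a \<Rightarrow> 'b) \<Rightarrow> bool" where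
  "alg_hom A B f \<longleftrightarrow> f \<in> ring_hom A B \<and>
    (\<forall>c. \<forall>x\<in>carrier A. f (c \<odot>\<^bsub>A\<^esub> x) = c \<odot>\<^bsub>B\<^esub> f x)"

section \<open>Tensor products\<close>

text \<open>
  The tensor product of \<open>U\<close> and \<open>V\<close> is the vector space with basis \<open>U \<times> V\<close> modulo the span of the
  bilinearity relators. The product is the one induced from the product monoid \<open>U \<times> V\<close>, so that
  \<open>(u \<otimes> v)(u' \<otimes> v') = uu' \<otimes> vv'\<close>. A tensor is thus a coset of formal linear combinations of pairs.
\<close>

definition bilin_relators ::
  "('k::field, 'a, 'm) module_scheme \<Rightarrow> ('k, 'b, 'n) module_scheme \<Rightarrow> ('a \<times> 'b \<Rightarrow>\<^sub>0 'k) set" where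
  "bilin_relators U V =
    {Poly_Mapping.single (u \<oplus>\<^bsub>U\<^esub> u', v) 1 - Poly_Mapping.single (u, v) 1 - Poly_Mapping.single (u', v) 1
       | u u' v. u \<in> carrier U \<and> u' \<in> carrier U \<and> v \<in> carrier V} \<union>
    {Poly_Mapping.single (u, v \<oplus>\<^bsub>V\<^esub> v') 1 - Poly_Mapping.single (u, v) 1 - Poly_Mapping.single (u, v') 1
       | u v v'. u \<in> carrier U \<and> v \<in> carrier V \<and> v' \<in> carrier V} \<union>
    {Poly_Mapping.single (c \<odot>\<^bsub>U\<^esub> u, v) 1 - Poly_Mapping.single (u, v) c
       | c u v. u \<in> carrier U \<and> v \<in> carrier V} \<union>
    {Poly_Mapping.single (u, c \<odot>\<^bsub>V\<^esub> v) 1 - Poly_Mapping.single (u, v) c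
       | c u v. u \<in> carrier U \<and> v \<in> carrier V}"

definition bilin_span ::
  "('k::field, 'a, 'm) module_scheme \<Rightarrow> ('k, 'b, 'n) module_scheme \<Rightarrow> ('a \<times> 'b \<Rightarrow>\<^sub>0 'k) set" where
  "bilin_span U V = Modules.module.span (\<lambda>c. Poly_Mapping.map ((*) c)) (bilin_relators U V)"

definition tensor_alg ::
  "('k::field, 'a, 'm) module_scheme \<Rightarrow> ('k, 'b, 'n) module_scheme
    \<Rightarrow> ('k, ('a \<times> 'b \<Rightarrow>\<^sub>0 'k) set) module" where
  "tensor_alg U V = quot_alg (monoid_alg (U \<times>\<times> V)) (bilin_span U V)"

text \<open>The tensor represented by a formal combination of pairs, and the pure tensor \<open>u \<otimes> v\<close>.\<close>

definition tensor_class ::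
  "('k::field, 'a, 'm) module_scheme \<Rightarrow> ('k, 'b, 'n) module_scheme
    \<Rightarrow> ('a \<times> 'b \<Rightarrow>\<^sub>0 'k) \<Rightarrow> ('a \<times> 'b \<Rightarrow>\<^sub>0 'k) set" where
  "tensor_class U V s = bilin_span U V +>\<^bsub>monoid_alg (U \<times>\<times> V)\<^esub> s"

definition pure_tensor ::
  "('k::field, 'a, 'm) module_scheme \<Rightarrow> ('k, 'b, 'n) module_scheme
    \<Rightarrow> 'a \<Rightarrow> 'b \<Rightarrow> ('a \<times> 'b \<Rightarrow>\<^sub>0 'k) set" where
  "pure_tensor U V u v = tensor_class U V (Poly_Mapping.single (u, v) 1)"

text \<open>The value at a tensor of the linear form induced by a bilinear form \<open>\<beta>\<close>: \<open>u \<otimes> v \<mapsto> \<beta> u v\<close>.\<close>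

definition tensor_eval ::
  "('a \<Rightarrow> 'b \<Rightarrow> 'k::field) \<Rightarrow> ('a \<times> 'b \<Rightarrow>\<^sub>0 'k) set \<Rightarrow> 'k" where
  "tensor_eval \<beta> t = (THE c. \<exists>s\<in>t. c =
     (\<Sum>p\<in>Poly_Mapping.keys s. Poly_Mapping.lookup s p * \<beta> (fst p) (snd p)))"

text \<open>The map \<open>f \<otimes> g\<close> between tensor products, with target the tensor product of \<open>U'\<close> and \<open>V'\<close>.\<close>

definition tensor_map ::
  "('k::field, 'c, 'm) module_scheme \<Rightarrow> ('k, 'd, 'n) module_scheme \<Rightarrow> ('a \<Rightarrow> 'c) \<Rightarrow> ('b \<Rightarrow> 'd)
    \<Rightarrow> ('a \<times> 'b \<Rightarrow>\<^sub>0 'k) set \<Rightarrow> ('c \<times> 'd \<Rightarrow>\<^sub>0 'k) set" where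
  "tensor_map U' V' f g t = (\<Union>s\<in>t. tensor_class U' V'
     (\<Sum>p\<in>Poly_Mapping.keys s. Poly_Mapping.single (f (fst p), g (snd p)) (Poly_Mapping.lookup s p)))"

section \<open>Hopf algebra structures, duals, isomorphisms\<close>

record (overloaded) ('k, 'a) hopf = "('k, 'a) module" +
  comult :: "'a \<Rightarrow> ('a \<times> 'a \<Rightarrow>\<^sub>0 'k) set"
  counit :: "'a \<Rightarrow> 'k"
  antipode :: "'a \<Rightarrow> 'a"

definition hopf_iso ::
  "('k::field, 'a) hopf \<Rightarrow> ('k, 'b) hopf \<Rightarrow> ('a \<Rightarrow> 'b) \<Rightarrow> bool" where
  "hopf_iso H K \<phi> \<longleftrightarrow>
    alg_hom H K \<phi> \<and> bij_betw \<phi> (carrier H) (carrier K) \<and>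
    (\<forall>h\<in>carrier H. comult K (\<phi> h) = tensor_map K K \<phi> \<phi> (comult H h)) \<and>
    (\<forall>h\<in>carrier H. counit K (\<phi> h) = counit H h) \<and>
    (\<forall>h\<in>carrier H. \<phi> (antipode H h) = antipode K (\<phi> h))"

definition hopf_isomorphic :: "('k::field, 'a) hopf \<Rightarrow> ('k, 'b) hopf \<Rightarrow> bool" where
  "hopf_isomorphic H K \<longleftrightarrow> (\<exists>\<phi>. hopf_iso H K \<phi>)"

text \<open>
  Linear forms on \<open>H\<close> are taken to be extensional (\<open>undefined\<close> off the carrier), so that forms
  agreeing on the carrier are equal. The product of the dual is convolution,
  \<open>(f g)(h) = (f \<otimes> g)(\<Delta> h)\<close>, and its unit is the counit of \<open>H\<close>.
\<close>

definition linear_forms :: "('k::field, 'a, 'm) module_scheme \<Rightarrow> ('a \<Rightarrow> 'k) set" where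
  "linear_forms H = {f \<in> extensional (carrier H).
     (\<forall>u\<in>carrier H. \<forall>v\<in>carrier H. f (u \<oplus>\<^bsub>H\<^esub> v) = f u + f v) \<and>
     (\<forall>c. \<forall>u\<in>carrier H. f (c \<odot>\<^bsub>H\<^esub> u) = c * f u)}"

definition dual_alg :: "('k::field, 'a) hopf \<Rightarrow> ('k, 'a \<Rightarrow> 'k) module" where
  "dual_alg H =
    \<lparr>carrier = linear_forms H,
     mult = (\<lambda>f g. \<lambda>h\<in>carrier H. tensor_eval (\<lambda>u v. f u * g v) (comult H h)),
     one = restrict (counit H) (carrier H),
     zero = (\<lambda>h\<in>carrier H. 0),
     add = (\<lambda>f g. \<lambda>h\<in>carrier H. f h + g h),
     smult = (\<lambda>c f. \<lambda>h\<in>carrier H. c * f h)\<rparr>"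

text \<open>
  For finite-dimensional \<open>H\<close> the comultiplication of the dual is the transpose of the multiplication,
  read in \<open>H\<^sup>* \<otimes> H\<^sup>* \<cong> (H \<otimes> H)\<^sup>*\<close>: it sends \<open>f\<close> to the unique tensor \<open>\<Sum> g \<otimes> g'\<close> with
  \<open>\<Sum> g(u) g'(v) = f(u v)\<close> for all \<open>u\<close>, \<open>v\<close>.
\<close>

definition dual_hopf :: "('k::field, 'a) hopf \<Rightarrow> ('k, 'a \<Rightarrow> 'k) hopf" where
  "dual_hopf H = module.extend (dual_alg H) (hopf.fields
     (\<lambda>f. THE t. t \<in> carrier (tensor_alg (dual_alg H) (dual_alg H)) \<and>
        (\<forall>u\<in>carrier H. \<forall>v\<in>carrier H. tensor_eval (\<lambda>g g'. g u * g' v) t = f (u \<otimes>\<^bsub>H\<^esub> v)))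
     (\<lambda>f. f \<one>\<^bsub>H\<^esub>)
     (\<lambda>f. \<lambda>h\<in>carrier H. f (antipode H h)))"

definition self_dual :: "('k::field, 'a) hopf \<Rightarrow> bool" where
  "self_dual H \<longleftrightarrow> hopf_isomorphic H (dual_hopf H)"

section \<open>The Hopf algebras \<open>\<H>\<^sub>\<alpha>\<close>\<close>

definition primitive_root_of_unity :: "nat \<Rightarrow> 'k::field \<Rightarrow> bool" where
  "primitive_root_of_unity m z \<longleftrightarrow> 0 < m \<and> z ^ m = 1 \<and> (\<forall>j. 0 < j \<and> j < m \<longrightarrow> z ^ j \<noteq> 1)"

definition mult_order :: "'k::field \<Rightarrow> nat" where
  "mult_order z = (LEAST m. 0 < m \<and> z ^ m = 1)"

datatype letter = Letter_a | Letter_x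

text \<open>The free algebra \<open>k\<langle>a, x\<rangle>\<close>, as the monoid algebra of the free monoid of words.\<close>

definition free_alg :: "('k::field, letter list \<Rightarrow>\<^sub>0 'k) module" where
  "free_alg = monoid_alg \<lparr>carrier = UNIV, mult = (@), one = []\<rparr>"

definition free_a :: "letter list \<Rightarrow>\<^sub>0 'k::field" where
  "free_a = Poly_Mapping.single [Letter_a] 1"

definition free_x :: "letter list \<Rightarrow>\<^sub>0 'k::field" where
  "free_x = Poly_Mapping.single [Letter_x] 1"

definition H_relators ::
  "nat \<Rightarrow> 'k::field \<Rightarrow> nat \<Rightarrow> nat \<Rightarrow> 'k \<Rightarrow> (letter list \<Rightarrow>\<^sub>0 'k) set" where
  "H_relators n q N \<nu> \<alpha> =
    {free_a [^]\<^bsub>free_alg\<^esub> N - \<one>\<^bsub>free_alg\<^esub>,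
     (if \<alpha> = 0 then free_x [^]\<^bsub>free_alg\<^esub> mult_order (q ^ \<nu>)
      else free_x [^]\<^bsub>free_alg\<^esub> n
        - \<alpha> \<odot>\<^bsub>free_alg\<^esub> (free_a [^]\<^bsub>free_alg\<^esub> (\<nu> * n) - \<one>\<^bsub>free_alg\<^esub>)),
     free_x \<otimes>\<^bsub>free_alg\<^esub> free_a - q \<odot>\<^bsub>free_alg\<^esub> (free_a \<otimes>\<^bsub>free_alg\<^esub> free_x)}"

definition H_alg ::
  "nat \<Rightarrow> 'k::field \<Rightarrow> nat \<Rightarrow> nat \<Rightarrow> 'k \<Rightarrow> ('k, (letter list \<Rightarrow>\<^sub>0 'k) set) module" where
  "H_alg n q N \<nu> \<alpha> = quot_alg free_alg (Idl\<^bsub>free_alg\<^esub> (H_relators n q N \<nu> \<alpha>))"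

definition H_a :: "nat \<Rightarrow> 'k::field \<Rightarrow> nat \<Rightarrow> nat \<Rightarrow> 'k \<Rightarrow> (letter list \<Rightarrow>\<^sub>0 'k) set" where
  "H_a n q N \<nu> \<alpha> = Idl\<^bsub>free_alg\<^esub> (H_relators n q N \<nu> \<alpha>) +>\<^bsub>free_alg\<^esub> free_a"

definition H_x :: "nat \<Rightarrow> 'k::field \<Rightarrow> nat \<Rightarrow> nat \<Rightarrow> 'k \<Rightarrow> (letter list \<Rightarrow>\<^sub>0 'k) set" where
  "H_x n q N \<nu> \<alpha> = Idl\<^bsub>free_alg\<^esub> (H_relators n q N \<nu> \<alpha>) +>\<^bsub>free_alg\<^esub> free_x"

text \<open>
  Comultiplication and counit are the algebra maps with the prescribed values on \<open>a\<close> and \<open>x\<close>, and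
  the antipode is the algebra antihomomorphism with the prescribed values. Each is unique because \<open>a\<close>
  and \<open>x\<close> generate the algebra; extensionality fixes the values off the carrier.
\<close>

definition H_comult ::
  "nat \<Rightarrow> 'k::field \<Rightarrow> nat \<Rightarrow> nat \<Rightarrow> 'k \<Rightarrow> (letter list \<Rightarrow>\<^sub>0 'k) set
    \<Rightarrow> ((letter list \<Rightarrow>\<^sub>0 'k) set \<times> (letter list \<Rightarrow>\<^sub>0 'k) set \<Rightarrow>\<^sub>0 'k) set" where
  "H_comult n q N \<nu> \<alpha> =
    (let A = H_alg n q N \<nu> \<alpha>; a = H_a n q N \<nu> \<alpha>; x = H_x n q N \<nu> \<alpha> in
     THE D. D \<in> extensional (carrier A) \<and> alg_hom A (tensor_alg A A) D \<and>
       D a = pure_tensor A A a a \<and>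
       D x = pure_tensor A A x (a [^]\<^bsub>A\<^esub> \<nu>) \<oplus>\<^bsub>tensor_alg A A\<^esub> pure_tensor A A \<one>\<^bsub>A\<^esub> x)"

definition H_counit ::
  "nat \<Rightarrow> 'k::field \<Rightarrow> nat \<Rightarrow> nat \<Rightarrow> 'k \<Rightarrow> (letter list \<Rightarrow>\<^sub>0 'k) set \<Rightarrow> 'k" where
  "H_counit n q N \<nu> \<alpha> =
    (let A = H_alg n q N \<nu> \<alpha>; a = H_a n q N \<nu> \<alpha>; x = H_x n q N \<nu> \<alpha> in
     THE e. e \<in> extensional (carrier A) \<and> alg_hom A field_alg e \<and> e a = 1 \<and> e x = 0)"

definition H_antipode ::
  "nat \<Rightarrow> 'k::field \<Rightarrow> nat \<Rightarrow> nat \<Rightarrow> 'k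
    \<Rightarrow> (letter list \<Rightarrow>\<^sub>0 'k) set \<Rightarrow> (letter list \<Rightarrow>\<^sub>0 'k) set" where
  "H_antipode n q N \<nu> \<alpha> =
    (let A = H_alg n q N \<nu> \<alpha>; a = H_a n q N \<nu> \<alpha>; x = H_x n q N \<nu> \<alpha> in
     THE s. s \<in> extensional (carrier A) \<and> alg_hom A (opp_alg A) s \<and>
       s a = inv\<^bsub>A\<^esub> a \<and>
       s x = (- inverse (q ^ \<nu>)) \<odot>\<^bsub>A\<^esub> (((inv\<^bsub>A\<^esub> a) [^]\<^bsub>A\<^esub> \<nu>) \<otimes>\<^bsub>A\<^esub> x))"

definition H_hopf ::
  "nat \<Rightarrow> 'k::field \<Rightarrow> nat \<Rightarrow> nat \<Rightarrow> 'k \<Rightarrow> ('k, (letter list \<Rightarrow>\<^sub>0 'k) set) hopf" where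
  "H_hopf n q N \<nu> \<alpha> = module.extend (H_alg n q N \<nu> \<alpha>) (hopf.fields
     (H_comult n q N \<nu> \<alpha>) (H_counit n q N \<nu> \<alpha>) (H_antipode n q N \<nu> \<alpha>))"

text \<open>\<open>\<H>\<^sub>0 = k\<int>\<^sub>N\<close> means that the generator \<open>x\<close> vanishes, i.e. that \<open>q\<^sup>\<nu> = 1\<close>.\<close>

definition H0_is_cyclic_group_alg :: "nat \<Rightarrow> 'k::field \<Rightarrow> nat \<Rightarrow> nat \<Rightarrow> bool" where
  "H0_is_cyclic_group_alg n q N \<nu> \<longleftrightarrow> H_x n q N \<nu> 0 = \<zero>\<^bsub>H_hopf n q N \<nu> 0\<^esub>"

text \<open>\<open>\<H>\<^sub>0 = H\<^bsub>(N,\<nu>,\<omega>)\<^esub>\<close> for some primitive \<open>N\<close>th root of unity \<open>\<omega>\<close> in the field.\<close>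

definition H0_is_H_omega :: "'k::field \<Rightarrow> nat \<Rightarrow> nat \<Rightarrow> bool" where
  "H0_is_H_omega q N \<nu> \<longleftrightarrow>
    (\<exists>\<omega>. primitive_root_of_unity N \<omega> \<and> q = \<omega> ^ \<nu>) \<and> \<not> N dvd \<nu>\<^sup>2"

end

theory Submission
  imports "HOL-Computational_Algebra.Polynomial" Defs
begin

text \<open>
  Let \<open>\<phi>\<close> be an isomorphism from \<open>\<H>\<^sub>\<alpha>\<close> to its dual. Then \<open>\<phi>(a)\<close> is group-like in the dual, that is, an
  algebra map to the field; it kills \<open>x\<close>, and \<open>\<omega> = \<phi>(a)(a)\<close> is a primitive \<open>N\<close>th root of unity because \<open>a\<close>
  has order \<open>N\<close>. If \<open>\<alpha> \<noteq> 0\<close>, applying \<open>\<phi>(a)\<close> to \<open>x\<^sup>n = \<alpha>(a\<^sup>\<nu>\<^sup>n - 1)\<close> gives \<open>N dvd \<nu>n\<close>, which is excluded.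
  If \<open>\<alpha> = 0\<close> and \<open>r > 1\<close>, the form \<open>\<phi>(x)\<close> satisfies \<open>\<phi>(x)(uv) = \<phi>(x)(u) \<phi>(a)\<^sup>\<nu>(v) + \<epsilon>(u) \<phi>(x)(v)\<close>; evaluated at
  \<open>xa = qax\<close> this forces \<open>q = \<omega>\<^sup>\<nu>\<close> unless \<open>\<phi>(x)(x) = 0\<close>, and in that case \<open>\<phi>(x)\<close> vanishes on the whole basis
  \<open>a\<^sup>i x\<^sup>j\<close> because it has to \<open>q\<close>-commute with \<open>\<phi>(a)\<close>.

  Conversely, \<open>\<langle>a\<^sup>i x\<^sup>j, a\<^sup>l x\<^sup>m\<rangle> = \<delta>\<^sub>j\<^sub>m \<omega>\<^sup>i\<^sup>l [j]!\<close>, with factorials in the base \<open>q\<^sup>\<nu>\<close>, is a symmetric Hopf pairing of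
  \<open>\<H>\<^sub>0\<close> with itself; Fourier inversion shows that it is perfect.
\<close>

section \<open>Linear maps and quotient algebras\<close>

text \<open>A presentation by generators and relations shows that the monomials
  \<open>a^i x^j\<close> with i < N and j < r span, but not that they are independent. Independence
  is obtained by letting the algebra act on functions of the exponents (i, j); the coordinate forms
  are read off from this action. Almost everything else rests on this basis: a has order exactly N,
  x is nonzero when r > 1, and the comultiplication of the dual, a definite description, denotes
  something because the dimension is finite. \<phi>(a) kills x for two different reasons: nilpotency
  of x when \<alpha> = 0, and q \<noteq> 1 (from n > 1) otherwise. The factorials in the pairing are
  dictated by the comultiplication: \<Delta>(x^m) has Gaussian binomials as coefficients. The
  pairing is perfect because these factorials are nonzero below r and because a primitive Nth root
  of unity in k forces N to be invertible in k. Finally, q = \<omega>^\<nu> gives q^\<nu> =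
  \<omega>^(\<nu>^2), so that r \<noteq> 1 is then the condition that N does not divide
  \<nu>^2.\<close>

locale kspace = abelian_group A for A :: "('k::field, 'a, 'm) module_scheme" (structure) +
  assumes smult_closed [simp, intro]: "x \<in> carrier A \<Longrightarrow> c \<odot> x \<in> carrier A"
    and smult_l_distr: "x \<in> carrier A \<Longrightarrow> (c + d) \<odot> x = c \<odot> x \<oplus> d \<odot> x"
    and smult_r_distr: "\<lbrakk>x \<in> carrier A; y \<in> carrier A\<rbrakk> \<Longrightarrow> c \<odot> (x \<oplus> y) = c \<odot> x \<oplus> c \<odot> y"
    and smult_assoc: "x \<in> carrier A \<Longrightarrow> (c * d) \<odot> x = c \<odot> (d \<odot> x)"
    and smult_one [simp]: "x \<in> carrier A \<Longrightarrow> 1 \<odot> x = x"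

locale kalgebra = kspace A + ring A for A :: "('k::field, 'a, 'm) module_scheme" (structure) +
  assumes smult_mult_l: "\<lbrakk>x \<in> carrier A; y \<in> carrier A\<rbrakk> \<Longrightarrow> (c \<odot> x) \<otimes> y = c \<odot> (x \<otimes> y)"
    and smult_mult_r: "\<lbrakk>x \<in> carrier A; y \<in> carrier A\<rbrakk> \<Longrightarrow> x \<otimes> (c \<odot> y) = c \<odot> (x \<otimes> y)"

context kspace
begin

lemma smult_zero_left [simp]: "x \<in> carrier A \<Longrightarrow> 0 \<odot> x = \<zero>"
proof -
  assume x: "x \<in> carrier A"
  have "0 \<odot> x \<oplus> 0 \<odot> x = 0 \<odot> x" using smult_l_distr[OF x, of 0 0] by simp
  then show ?thesis using x by (metis add.l_cancel_one' smult_closed)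
qed

lemma smult_zero_right [simp]: "c \<odot> \<zero> = \<zero>"
  using smult_assoc[of \<zero> c 0] by simp

lemma smult_minus_one: "x \<in> carrier A \<Longrightarrow> (- 1) \<odot> x = \<ominus> x"
proof -
  assume x: "x \<in> carrier A"
  have "(- 1) \<odot> x \<oplus> x = \<zero>" using smult_l_distr[OF x, of "-1" 1] x by simp
  then show ?thesis using x by (metis minus_equality smult_closed)
qed

lemma smult_minus: "x \<in> carrier A \<Longrightarrow> (- c) \<odot> x = \<ominus> (c \<odot> x)"
  using smult_assoc[of x "-1" c] smult_minus_one[of "c \<odot> x"] by simp

lemma smult_a_inv: "x \<in> carrier A \<Longrightarrow> c \<odot> (\<ominus> x) = \<ominus> (c \<odot> x)"
  using smult_assoc[of x c "- 1"] by (simp add: smult_minus_one smult_minus)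

lemma finsum_smult:
  assumes "finite S" "g \<in> S \<rightarrow> carrier A"
  shows "c \<odot> finsum A g S = finsum A (\<lambda>i. c \<odot> g i) S"
  using assms
proof (induction S rule: finite_induct)
  case (insert i S)
  then have "g \<in> S \<rightarrow> carrier A" "(\<lambda>i. c \<odot> g i) \<in> S \<rightarrow> carrier A" "g i \<in> carrier A" by auto
  with insert show ?case by (simp add: smult_r_distr)
qed simp

end

section \<open>Linear maps, algebra maps and the base field\<close>

definition klin ::
  "('k::field, 'a, 'm) module_scheme \<Rightarrow> ('k, 'b, 'n) module_scheme \<Rightarrow> ('a \<Rightarrow> 'b) \<Rightarrow> bool" where
  "klin A B f \<longleftrightarrow> (\<forall>u\<in>carrier A. f u \<in> carrier B) \<and>
    (\<forall>u\<in>carrier A. \<forall>v\<in>carrier A. f (u \<oplus>\<^bsub>A\<^esub> v) = f u \<oplus>\<^bsub>B\<^esub> f v) \<and>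
    (\<forall>c. \<forall>u\<in>carrier A. f (c \<odot>\<^bsub>A\<^esub> u) = c \<odot>\<^bsub>B\<^esub> f u)"

lemma klinI:
  assumes "\<And>u. u \<in> carrier A \<Longrightarrow> f u \<in> carrier B"
    and "\<And>u v. \<lbrakk>u \<in> carrier A; v \<in> carrier A\<rbrakk> \<Longrightarrow> f (u \<oplus>\<^bsub>A\<^esub> v) = f u \<oplus>\<^bsub>B\<^esub> f v"
    and "\<And>c u. u \<in> carrier A \<Longrightarrow> f (c \<odot>\<^bsub>A\<^esub> u) = c \<odot>\<^bsub>B\<^esub> f u"
  shows "klin A B f"
  using assms unfolding klin_def by blast

lemma klin_closed: "klin A B f \<Longrightarrow> u \<in> carrier A \<Longrightarrow> f u \<in> carrier B"
  and klin_add: "klin A B f \<Longrightarrow> u \<in> carrier A \<Longrightarrow> v \<in> carrier A \<Longrightarrow> f (u \<oplus>\<^bsub>A\<^esub> v) = f u \<oplus>\<^bsub>B\<^esub> f v"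
  and klin_smult: "klin A B f \<Longrightarrow> u \<in> carrier A \<Longrightarrow> f (c \<odot>\<^bsub>A\<^esub> u) = c \<odot>\<^bsub>B\<^esub> f u"
  unfolding klin_def by blast+

lemma klin_comp: "klin A B f \<Longrightarrow> klin B C g \<Longrightarrow> klin A C (\<lambda>u. g (f u))"
  unfolding klin_def by simp

lemma klin_zero: "kspace A \<Longrightarrow> kspace B \<Longrightarrow> klin A B f \<Longrightarrow> f \<zero>\<^bsub>A\<^esub> = \<zero>\<^bsub>B\<^esub>"
proof -
  assume A: "kspace A" and B: "kspace B" and f: "klin A B f"
  interpret A: kspace A by fact
  interpret B: kspace B by fact
  have "f (0 \<odot>\<^bsub>A\<^esub> \<zero>\<^bsub>A\<^esub>) = 0 \<odot>\<^bsub>B\<^esub> f \<zero>\<^bsub>A\<^esub>" using klin_smult[OF f] by blast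
  then show ?thesis using klin_closed[OF f] by simp
qed

lemma klin_finsum:
  assumes A: "kspace A" and B: "kspace B" and f: "klin A B f" and S: "finite S" "g \<in> S \<rightarrow> carrier A"
  shows "f (finsum A g S) = finsum B (\<lambda>i. f (g i)) S"
proof -
  interpret A: kspace A by fact
  interpret B: kspace B by fact
  show ?thesis using S
  proof (induction S rule: finite_induct)
    case empty show ?case using klin_zero[OF A B f] by simp
  next
    case (insert i S)
    then have "g \<in> S \<rightarrow> carrier A" "(\<lambda>i. f (g i)) \<in> S \<rightarrow> carrier B" "g i \<in> carrier A"
      using klin_closed[OF f] by auto
    with insert show ?case by (simp add: klin_add[OF f] klin_closed[OF f])
  qed
qed

lemma klin_minus:
  assumes A: "kspace A" and B: "kspace B" and f: "klin A B f" and "u \<in> carrier A" "v \<in> carrier A"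
  shows "f (u \<ominus>\<^bsub>A\<^esub> v) = f u \<ominus>\<^bsub>B\<^esub> f v"
proof -
  interpret A: kspace A by fact
  interpret B: kspace B by fact
  show ?thesis
    using assms klin_smult[OF f, of v "- 1"]
    by (simp add: A.minus_eq B.minus_eq klin_add[OF f] A.smult_minus_one B.smult_minus_one klin_closed[OF f])
qed

lemma alg_hom_klin: "alg_hom A B f \<Longrightarrow> klin A B f"
  unfolding alg_hom_def klin_def ring_hom_def by auto

lemma alg_hom_mult:
  "alg_hom A B f \<Longrightarrow> u \<in> carrier A \<Longrightarrow> v \<in> carrier A \<Longrightarrow> f (u \<otimes>\<^bsub>A\<^esub> v) = f u \<otimes>\<^bsub>B\<^esub> f v"
  and alg_hom_one: "alg_hom A B f \<Longrightarrow> f \<one>\<^bsub>A\<^esub> = \<one>\<^bsub>B\<^esub>"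
  unfolding alg_hom_def ring_hom_def by auto

lemma alg_homI:
  assumes "klin A B f" and "f \<one>\<^bsub>A\<^esub> = \<one>\<^bsub>B\<^esub>"
    and "\<And>u v. u \<in> carrier A \<Longrightarrow> v \<in> carrier A \<Longrightarrow> f (u \<otimes>\<^bsub>A\<^esub> v) = f u \<otimes>\<^bsub>B\<^esub> f v"
  shows "alg_hom A B f"
  using assms unfolding alg_hom_def klin_def ring_hom_def by auto

lemma alg_hom_nat_pow:
  assumes "kalgebra A" "kalgebra B" "alg_hom A B f" "u \<in> carrier A"
  shows "f (u [^]\<^bsub>A\<^esub> (m::nat)) = f u [^]\<^bsub>B\<^esub> m"
proof -
  interpret A: kalgebra A by fact
  interpret B: kalgebra B by fact
  show ?thesis by (induction m) (use assms in \<open>simp_all add: alg_hom_one alg_hom_mult\<close>)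
qed

lemma field_alg_simps [simp]:
  "carrier field_alg = UNIV" "mult field_alg = (*)" "one field_alg = 1"
  "zero field_alg = 0" "add field_alg = (+)" "smult field_alg = (*)"
  unfolding field_alg_def by simp_all

lemma kalgebra_field_alg: "kalgebra (field_alg :: ('k::field, 'k) module)"
proof -
  have "abelian_group (field_alg :: ('k::field, 'k) module)"
    by (rule abelian_groupI) (auto simp: ac_simps intro: exI[of _ "- x" for x])
  moreover have "ring (field_alg :: ('k::field, 'k) module)"
    by (rule ringI[OF calculation]) (auto intro!: monoidI simp: algebra_simps)
  ultimately show ?thesis
    by (auto intro!: kalgebra.intro kspace.intro kspace_axioms.intro kalgebra_axioms.intro simp: algebra_simps)
qed

lemmas kspace_field_alg = kalgebra.axioms(1)[OF kalgebra_field_alg]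

lemma finsum_field_alg [simp]: "finsum field_alg g S = sum g S"
proof -
  interpret F: kalgebra field_alg by (rule kalgebra_field_alg)
  show ?thesis
    by (induction S rule: infinite_finite_induct) simp_all
qed

lemma field_alg_nat_pow [simp]: "c [^]\<^bsub>field_alg\<^esub> (m::nat) = c ^ m"
  by (induction m) (simp_all add: nat_pow_def mult.commute)

lemma klin_form_add: "klin A field_alg f \<Longrightarrow> u \<in> carrier A \<Longrightarrow> v \<in> carrier A \<Longrightarrow> f (u \<oplus>\<^bsub>A\<^esub> v) = f u + f v"
  and klin_form_smult: "klin A field_alg f \<Longrightarrow> u \<in> carrier A \<Longrightarrow> f (c \<odot>\<^bsub>A\<^esub> u) = c * f u"
  using klin_add klin_smult by fastforce+

lemma klin_formI:
  assumes "\<And>u v. \<lbrakk>u \<in> carrier A; v \<in> carrier A\<rbrakk> \<Longrightarrow> f (u \<oplus>\<^bsub>A\<^esub> v) = f u + f v"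
    and "\<And>c u. u \<in> carrier A \<Longrightarrow> f (c \<odot>\<^bsub>A\<^esub> u) = c * f u"
  shows "klin A field_alg f"
  using assms by (auto intro: klinI)

lemma kalgebra_opp: assumes "kalgebra A" shows "kalgebra (opp_alg A)"
proof -
  interpret kalgebra A by fact
  have ab: "abelian_group (opp_alg A)"
    by (rule abelian_groupI) (auto simp: opp_alg_def a_ac intro: add.l_inv_ex)
  have "ring (opp_alg A)"
    by (rule ringI[OF ab]) (auto intro!: monoidI simp: opp_alg_def m_assoc l_distr r_distr)
  with ab show ?thesis
    by (auto intro!: kalgebra.intro kspace.intro kspace_axioms.intro kalgebra_axioms.intro
        simp: opp_alg_def smult_l_distr smult_r_distr smult_assoc smult_mult_l smult_mult_r)
qed

section \<open>Quotients by subspaces and ideals\<close>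

definition subspace :: "'a set \<Rightarrow> ('k::field, 'a, 'm) module_scheme \<Rightarrow> bool" where
  "subspace I A \<longleftrightarrow> I \<subseteq> carrier A \<and> \<zero>\<^bsub>A\<^esub> \<in> I \<and>
    (\<forall>x\<in>I. \<forall>y\<in>I. x \<oplus>\<^bsub>A\<^esub> y \<in> I) \<and> (\<forall>c. \<forall>x\<in>I. c \<odot>\<^bsub>A\<^esub> x \<in> I)"

lemma (in kspace) subspace_abelian_subgroup:
  assumes "subspace I A" shows "abelian_subgroup I A"
proof (rule abelian_subgroupI3)
  show "additive_subgroup I A"
  proof (rule additive_subgroupI, rule add.subgroupI)
    show "I \<subseteq> carrier A" "I \<noteq> {}" using assms by (auto simp: subspace_def)
    show "\<And>a. a \<in> I \<Longrightarrow> \<ominus> a \<in> I"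
      using assms smult_minus_one unfolding subspace_def by (metis subset_iff)
    show "\<And>a b. a \<in> I \<Longrightarrow> b \<in> I \<Longrightarrow> a \<oplus> b \<in> I" using assms by (auto simp: subspace_def)
  qed
qed (rule abelian_group_axioms)

lemma (in kalgebra) ideal_subspace:
  assumes "ideal I A" shows "subspace I A"
proof -
  interpret ideal I A by fact
  show ?thesis unfolding subspace_def
  proof (intro conjI ballI allI)
    fix c x assume x: "x \<in> I"
    then have "(c \<odot> \<one>) \<otimes> x \<in> I" by (intro I_l_closed) auto
    then show "c \<odot> x \<in> I" using x a_subset by (simp add: smult_mult_l subset_iff)
  qed (use a_subset in auto)
qed

lemma quot_alg_simps [simp]:
  "carrier (quot_alg A I) = a_rcosets\<^bsub>A\<^esub> I"
  "mult (quot_alg A I) = rcoset_mult A I"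
  "one (quot_alg A I) = I +>\<^bsub>A\<^esub> \<one>\<^bsub>A\<^esub>"
  "zero (quot_alg A I) = I"
  "add (quot_alg A I) = set_add A"
  "smult (quot_alg A I) = (\<lambda>c X. \<Union>f\<in>X. I +>\<^bsub>A\<^esub> (c \<odot>\<^bsub>A\<^esub> f))"
  unfolding quot_alg_def FactRing_def by (simp_all add: ring.defs module.defs)

context kspace
begin

lemma coset_eq_iff:
  assumes I: "subspace I A" and x: "x \<in> carrier A" and y: "y \<in> carrier A"
  shows "I +> x = I +> y \<longleftrightarrow> x \<ominus> y \<in> I"
proof -
  interpret I: abelian_subgroup I A by (rule subspace_abelian_subgroup[OF I])
  have "I +> x = I +> y \<longleftrightarrow> x \<in> I +> y"
    using I.a_rcos_self[OF x] I.a_repr_independence'[OF _ y] by auto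
  also have "\<dots> \<longleftrightarrow> x \<ominus> y \<in> I"
    using I.a_rcos_module[OF y x] by (simp add: minus_eq)
  finally show ?thesis .
qed

lemma coset_memD:
  assumes I: "subspace I A" and x: "x \<in> carrier A" and z: "z \<in> I +> x"
  shows "z \<in> carrier A" "I +> z = I +> x"
proof -
  interpret I: abelian_subgroup I A by (rule subspace_abelian_subgroup[OF I])
  show "z \<in> carrier A" using I.a_elemrcos_carrier[OF x z] .
  show "I +> z = I +> x" using I.a_repr_independence'[OF z x] by simp
qed

text \<open>Scaling in the quotient is a union over all representatives. The cosets in that union
  coincide because I is closed under scaling, so one representative suffices.\<close>

lemma coset_smult:
  assumes I: "subspace I A" and x: "x \<in> carrier A"
  shows "c \<odot>\<^bsub>quot_alg A I\<^esub> (I +> x) = I +> (c \<odot> x)"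
proof -
  interpret I: abelian_subgroup I A by (rule subspace_abelian_subgroup[OF I])
  have const: "I +> (c \<odot> z) = I +> (c \<odot> x)" if z: "z \<in> I +> x" for z
  proof -
    have zc: "z \<in> carrier A" "z \<ominus> x \<in> I" using coset_memD[OF I x z] coset_eq_iff[OF I _ x] by auto
    have "c \<odot> (z \<ominus> x) = c \<odot> z \<ominus> c \<odot> x"
      using zc x by (simp add: minus_eq smult_r_distr smult_a_inv)
    moreover have "c \<odot> (z \<ominus> x) \<in> I" using zc I by (auto simp: subspace_def)
    ultimately show ?thesis using coset_eq_iff[OF I] zc x by simp
  qed
  show ?thesis unfolding quot_alg_simps using const by (intro UN_constant_eq[OF I.a_rcos_self[OF x]] ballI)
qed

lemma klin_coset:
  assumes I: "subspace I A" shows "klin A (quot_alg A I) ((+>) I)"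
proof (rule klinI)
  interpret I: abelian_subgroup I A by (rule subspace_abelian_subgroup[OF I])
  show "\<And>u. u \<in> carrier A \<Longrightarrow> I +> u \<in> carrier (quot_alg A I)"
    using I.a_subset by (simp add: a_rcosetsI)
  show "\<And>u v. u \<in> carrier A \<Longrightarrow> v \<in> carrier A \<Longrightarrow> I +> (u \<oplus> v) = (I +> u) \<oplus>\<^bsub>quot_alg A I\<^esub> (I +> v)"
    by (simp add: I.a_rcos_sum)
qed (simp add: coset_smult[OF I] del: quot_alg_simps)

lemma quot_alg_cases:
  assumes "X \<in> carrier (quot_alg A I)" obtains x where "x \<in> carrier A" "X = I +> x"
  using assms by (auto simp: A_RCOSETS_def' a_r_coset_def')

lemma kspace_quot:
  assumes I: "subspace I A" shows "kspace (quot_alg A I)"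
proof -
  interpret I: abelian_subgroup I A by (rule subspace_abelian_subgroup[OF I])
  note lin = klin_coset[OF I]
  have cl: "I +> x \<in> carrier (quot_alg A I)" if "x \<in> carrier A" for x using klin_closed[OF lin that] .
  have z: "\<zero>\<^bsub>quot_alg A I\<^esub> = I +> \<zero>" using I.a_subset by simp
  have ab: "abelian_group (quot_alg A I)"
  proof (rule abelian_groupI)
    fix X assume "X \<in> carrier (quot_alg A I)"
    then obtain x where x: "x \<in> carrier A" "X = I +> x" by (rule quot_alg_cases)
    then show "\<exists>Y\<in>carrier (quot_alg A I). Y \<oplus>\<^bsub>quot_alg A I\<^esub> X = \<zero>\<^bsub>quot_alg A I\<^esub>"
      by (intro bexI[of _ "I +> (\<ominus> x)"]) (simp_all add: z cl klin_add[OF lin, symmetric] l_neg del: quot_alg_simps)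
  qed (auto elim!: quot_alg_cases simp: z cl klin_add[OF lin, symmetric] a_ac simp del: quot_alg_simps)
  show ?thesis
  proof (rule kspace.intro[OF ab], rule kspace_axioms.intro)
    fix X Y c d assume X: "X \<in> carrier (quot_alg A I)"
    then obtain x where x: "x \<in> carrier A" "X = I +> x" by (rule quot_alg_cases)
    show "c \<odot>\<^bsub>quot_alg A I\<^esub> X \<in> carrier (quot_alg A I)"
      unfolding x klin_smult[OF lin x(1), symmetric] using x klin_closed[OF lin] by blast
    show "(c + d) \<odot>\<^bsub>quot_alg A I\<^esub> X = c \<odot>\<^bsub>quot_alg A I\<^esub> X \<oplus>\<^bsub>quot_alg A I\<^esub> d \<odot>\<^bsub>quot_alg A I\<^esub> X"
      using x by (simp add: klin_smult[OF lin, symmetric] klin_add[OF lin, symmetric] smult_l_distr del: quot_alg_simps)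
    show "(c * d) \<odot>\<^bsub>quot_alg A I\<^esub> X = c \<odot>\<^bsub>quot_alg A I\<^esub> (d \<odot>\<^bsub>quot_alg A I\<^esub> X)"
      using x by (simp add: klin_smult[OF lin, symmetric] smult_assoc del: quot_alg_simps)
    show "1 \<odot>\<^bsub>quot_alg A I\<^esub> X = X"
      using x by (simp add: klin_smult[OF lin, symmetric] del: quot_alg_simps)
    assume Y: "Y \<in> carrier (quot_alg A I)"
    then obtain y where y: "y \<in> carrier A" "Y = I +> y" by (rule quot_alg_cases)
    show "c \<odot>\<^bsub>quot_alg A I\<^esub> (X \<oplus>\<^bsub>quot_alg A I\<^esub> Y) = c \<odot>\<^bsub>quot_alg A I\<^esub> X \<oplus>\<^bsub>quot_alg A I\<^esub> c \<odot>\<^bsub>quot_alg A I\<^esub> Y"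
      using x y by (simp add: klin_smult[OF lin, symmetric] klin_add[OF lin, symmetric] smult_r_distr del: quot_alg_simps)
  qed
qed

end

context kalgebra
begin

lemma alg_hom_coset:
  assumes I: "ideal I A" shows "alg_hom A (quot_alg A I) ((+>) I)"
  by (rule alg_homI[OF klin_coset[OF ideal_subspace[OF I]]]) (simp_all add: ideal.rcoset_mult_add[OF I])

lemma kalgebra_quot:
  assumes I: "ideal I A" shows "kalgebra (quot_alg A I)"
proof -
  interpret Q: kspace "quot_alg A I" by (rule kspace_quot[OF ideal_subspace[OF I]])
  note hom = alg_hom_coset[OF I]
  note lin = alg_hom_klin[OF hom]
  note rew = klin_smult[OF lin, symmetric] klin_add[OF lin, symmetric] alg_hom_mult[OF hom, symmetric]
    alg_hom_one[OF hom, symmetric]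
  have cl: "I +> x \<in> carrier (quot_alg A I)" if "x \<in> carrier A" for x using klin_closed[OF lin that] .
  have "ring (quot_alg A I)"
    by (rule ringI[OF Q.abelian_group_axioms], rule monoidI)
      (auto elim!: quot_alg_cases simp: rew cl m_assoc l_distr r_distr simp del: quot_alg_simps)
  then show ?thesis
    by (rule kalgebra.intro[OF Q.kspace_axioms], intro kalgebra_axioms.intro)
      (auto elim!: quot_alg_cases simp: rew smult_mult_l smult_mult_r simp del: quot_alg_simps)
qed

text \<open>The induced map evaluates f at a chosen representative; two representatives differ by an
  element of I, where f vanishes, so the choice does not matter.\<close>

lemma alg_hom_factor:
  assumes B: "kalgebra B" and f: "alg_hom A B f" and I: "ideal I A"
    and z: "\<And>x. x \<in> I \<Longrightarrow> f x = \<zero>\<^bsub>B\<^esub>"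
  obtains g where "alg_hom (quot_alg A I) B g" "\<And>x. x \<in> carrier A \<Longrightarrow> g (I +> x) = f x"
proof -
  interpret B: kalgebra B by fact
  note S = ideal_subspace[OF I]
  interpret I: abelian_subgroup I A by (rule subspace_abelian_subgroup[OF S])
  note lin = alg_hom_klin[OF f]
  define g where "g X = f (SOME x. x \<in> X)" for X
  have g: "g (I +> x) = f x" if x: "x \<in> carrier A" for x
  proof -
    define y where "y = (SOME y. y \<in> I +> x)"
    have "y \<in> I +> x" unfolding y_def using I.a_rcos_self[OF x] by (rule someI)
    then have y: "y \<in> carrier A" "y \<ominus> x \<in> I" using coset_memD[OF S x] coset_eq_iff[OF S _ x] by auto
    have "f y = f ((y \<ominus> x) \<oplus> x)" using x y by (simp add: minus_eq a_assoc l_neg)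
    also have "\<dots> = f (y \<ominus> x) \<oplus>\<^bsub>B\<^esub> f x" using x y by (simp add: klin_add[OF lin])
    finally show ?thesis using z y x klin_closed[OF lin] by (simp add: g_def y_def)
  qed
  note pi = alg_hom_coset[OF I]
  note lp = alg_hom_klin[OF pi]
  have "alg_hom (quot_alg A I) B g"
  proof (rule alg_homI, rule klinI)
    show "g \<one>\<^bsub>quot_alg A I\<^esub> = \<one>\<^bsub>B\<^esub>" by (simp add: g alg_hom_one[OF f])
  qed (auto elim!: quot_alg_cases simp: g klin_add[OF lp, symmetric] klin_smult[OF lp, symmetric]
     alg_hom_mult[OF pi, symmetric] klin_add[OF lin] klin_smult[OF lin] alg_hom_mult[OF f] klin_closed[OF lin]
     simp del: quot_alg_simps)
  with g show ?thesis using that by blast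
qed

end

section \<open>Monoid algebras and the free algebra\<close>

abbreviation "single \<equiv> Poly_Mapping.single"
abbreviation "keys \<equiv> Poly_Mapping.keys"
abbreviation "lookup \<equiv> Poly_Mapping.lookup"

lemma lookup_scale: "lookup (Poly_Mapping.map ((*) c) f) u = c * lookup f u"
  for c :: "'k::field"
  by transfer (auto simp: when_def)

lemma keys_scale: "keys (Poly_Mapping.map ((*) c) f) \<subseteq> keys f"
  for c :: "'k::field"
  by (auto simp: in_keys_iff lookup_scale)

lemma scale_single [simp]: "Poly_Mapping.map ((*) c) (single u d) = single u (c * d)"
  for c :: "'k::field"
  by simp

lemma monoid_alg_simps [simp]:
  "carrier (monoid_alg G) = {f. keys f \<subseteq> carrier G}"
  "one (monoid_alg G) = single \<one>\<^bsub>G\<^esub> 1"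
  "zero (monoid_alg G) = 0"
  "add (monoid_alg G) = (+)"
  "smult (monoid_alg G) = (\<lambda>c. Poly_Mapping.map ((*) c))"
  unfolding monoid_alg_def by simp_all

lemma kspace_monoid_alg: "kspace (monoid_alg G :: ('k::field, 'g \<Rightarrow>\<^sub>0 'k) module)"
proof -
  have "abelian_group (monoid_alg G :: ('k::field, 'g \<Rightarrow>\<^sub>0 'k) module)"
  proof (rule abelian_groupI)
    fix f :: "'g \<Rightarrow>\<^sub>0 'k" assume "f \<in> carrier (monoid_alg G)"
    then show "\<exists>g\<in>carrier (monoid_alg G). g \<oplus>\<^bsub>monoid_alg G\<^esub> f = \<zero>\<^bsub>monoid_alg G\<^esub>"
      by (intro bexI[of _ "- f"]) auto
  qed (auto simp: ac_simps dest: subsetD[OF keys_add])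
  then show ?thesis
    by (rule kspace.intro, intro kspace_axioms.intro)
      (auto intro!: poly_mapping_eqI simp: lookup_scale lookup_add algebra_simps dest: subsetD[OF keys_scale])
qed

text \<open>The relators are written with the subtraction of finitely supported functions, the ring
  facts with that of the record; this identifies the two.\<close>

lemma monoid_alg_minus:
  fixes f g :: "'g \<Rightarrow>\<^sub>0 'k::field"
  assumes "f \<in> carrier (monoid_alg G)" "g \<in> carrier (monoid_alg G)"
  shows "f \<ominus>\<^bsub>monoid_alg G\<^esub> g = f - g"
proof -
  interpret M: kspace "monoid_alg G :: ('k, 'g \<Rightarrow>\<^sub>0 'k) module" by (rule kspace_monoid_alg)
  have "\<ominus>\<^bsub>monoid_alg G\<^esub> g = - g"
    using M.smult_minus_one[OF assms(2), symmetric] by (auto intro!: poly_mapping_eqI simp: lookup_scale)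
  then show ?thesis by (simp add: M.minus_eq)
qed

lemma finsum_monoid_alg:
  assumes "g \<in> S \<rightarrow> carrier (monoid_alg G)"
  shows "finsum (monoid_alg G) g S = sum g S"
proof -
  interpret M: kspace "monoid_alg G" by (rule kspace_monoid_alg)
  show ?thesis using assms
  proof (induction S rule: infinite_finite_induct)
    case (insert x F)
    then have "g \<in> F \<rightarrow> carrier (monoid_alg G)" "g x \<in> carrier (monoid_alg G)" by auto
    with insert show ?case by (simp del: monoid_alg_simps(1))
  qed simp_all
qed

text \<open>A finitely supported function is the sum of its terms, and all partial sums keep their
  support inside X.\<close>

lemma pm_subset_induct [consumes 1, case_names zero add]:
  fixes f :: "'g \<Rightarrow>\<^sub>0 'k::field"
  assumes "keys f \<subseteq> X" and "P 0"
    and "\<And>u c f. u \<in> X \<Longrightarrow> keys f \<subseteq> X \<Longrightarrow> P f \<Longrightarrow> P (single u c + f)"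
  shows "P f"
proof -
  have *: "P (\<Sum>u\<in>S. single u (lookup f u)) \<and>
     keys (\<Sum>u\<in>S. single u (lookup f u)) \<subseteq> X"
    if "finite S" "S \<subseteq> X" for S
    using that
  proof (induction S rule: finite_induct)
    case (insert u S)
    let ?s = "\<Sum>u\<in>S. single u (lookup f u)"
    have "P ?s" "keys ?s \<subseteq> X" "u \<in> X" using insert by auto
    moreover from this have "keys (single u (lookup f u) + ?s) \<subseteq> X"
      using keys_add[of "single u (lookup f u)" ?s] by (auto split: if_splits)
    ultimately show ?case using insert(1,2) assms(3)[of u ?s] by simp
  qed (use assms in simp)
  have "f = (\<Sum>u\<in>keys f. single u (lookup f u))"
    by (rule poly_mapping_eqI) (simp add: lookup_sum lookup_single when_def in_keys_iff)
  then show ?thesis using *[OF finite_keys assms(1)] by simp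
qed

lemma klin_monoid_alg_eq:
  fixes A :: "('k::field, 'g \<Rightarrow>\<^sub>0 'k) module"
  assumes A: "A = monoid_alg G" and B: "kspace B" and f: "klin A B f" and g: "klin A B g"
    and eq: "\<And>u. u \<in> carrier G \<Longrightarrow> f (single u 1) = g (single u 1)"
    and s: "s \<in> carrier A"
  shows "f s = g s"
proof -
  have "keys s \<subseteq> carrier G" using s A by simp
  then show ?thesis
  proof (induction s rule: pm_subset_induct)
    case zero
    show ?case using klin_zero[OF _ B f] klin_zero[OF _ B g] kspace_monoid_alg A by force
  next
    case (add u c h)
    have 1: "single u c = c \<odot>\<^bsub>A\<^esub> single u 1" using A by simp
    have 2: "single u c + h = c \<odot>\<^bsub>A\<^esub> single u 1 \<oplus>\<^bsub>A\<^esub> h"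
      using A by simp
    have "single u 1 \<in> carrier A" "c \<odot>\<^bsub>A\<^esub> single u 1 \<in> carrier A" "h \<in> carrier A"
      using add A by (auto split: if_splits)
    then show ?case unfolding 2 using add eq by (simp only: klin_add[OF f] klin_add[OF g] klin_smult[OF f] klin_smult[OF g])
  qed
qed

section \<open>Linear extension from a basis, and monoid algebras as algebras\<close>

definition lin_ext :: "('k::field, 'b, 'n) module_scheme \<Rightarrow> ('g \<Rightarrow> 'b) \<Rightarrow> ('g \<Rightarrow>\<^sub>0 'k) \<Rightarrow> 'b" where
  "lin_ext B g f = finsum B (\<lambda>u. lookup f u \<odot>\<^bsub>B\<^esub> g u) (keys f)"

context kspace
begin

text \<open>Indices outside the support contribute zero. A common index set is what allows two
  functions with different supports to be added.\<close>

lemma lin_ext_superset: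
  assumes "finite S" "keys f \<subseteq> S" "g \<in> S \<rightarrow> carrier A"
  shows "lin_ext A g f = finsum A (\<lambda>u. lookup f u \<odot> g u) S"
  unfolding lin_ext_def
  using assms by (intro add.finprod_mono_neutral_cong_left) (auto simp: in_keys_iff Pi_iff)

lemma klin_lin_ext:
  fixes G :: "('g, 'x) monoid_scheme"
  assumes g: "g \<in> carrier G \<rightarrow> carrier A"
  shows "klin (monoid_alg G) A (lin_ext A g)"
proof (rule klinI)
  fix f h :: "'g \<Rightarrow>\<^sub>0 'k" assume f: "f \<in> carrier (monoid_alg G)" and h: "h \<in> carrier (monoid_alg G)"
  let ?S = "keys f \<union> keys h"
  have S: "g \<in> ?S \<rightarrow> carrier A" using f h g by auto
  have "lin_ext A g (f + h) = finsum A (\<lambda>u. lookup (f + h) u \<odot> g u) ?S"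
    using S keys_add[of f h] by (intro lin_ext_superset) auto
  also have "\<dots> = finsum A (\<lambda>u. lookup f u \<odot> g u \<oplus> lookup h u \<odot> g u) ?S"
    using S by (intro finsum_cong') (auto simp: lookup_add smult_l_distr Pi_iff)
  also have "\<dots> = finsum A (\<lambda>u. lookup f u \<odot> g u) ?S \<oplus> finsum A (\<lambda>u. lookup h u \<odot> g u) ?S"
    using S by (intro finsum_addf) auto
  also have "\<dots> = lin_ext A g f \<oplus> lin_ext A g h"
    using S lin_ext_superset[of ?S f g] lin_ext_superset[of ?S h g] by simp
  finally show "lin_ext A g (f \<oplus>\<^bsub>monoid_alg G\<^esub> h) = lin_ext A g f \<oplus> lin_ext A g h" by simp
next
  fix c :: 'k and f :: "'g \<Rightarrow>\<^sub>0 'k" assume f: "f \<in> carrier (monoid_alg G)"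
  let ?S = "keys f"
  have S: "g \<in> ?S \<rightarrow> carrier A" using f g by auto
  then show "lin_ext A g f \<in> carrier A" unfolding lin_ext_def by (intro finsum_closed) auto
  have "lin_ext A g (Poly_Mapping.map ((*) c) f) =
      finsum A (\<lambda>u. lookup (Poly_Mapping.map ((*) c) f) u \<odot> g u) ?S"
    using S keys_scale[of c f] by (intro lin_ext_superset) auto
  also have "\<dots> = finsum A (\<lambda>u. c \<odot> (lookup f u \<odot> g u)) ?S"
    using S by (intro finsum_cong') (auto simp: lookup_scale smult_assoc Pi_iff)
  also have "\<dots> = c \<odot> lin_ext A g f"
    unfolding lin_ext_def using S by (intro finsum_smult[symmetric]) auto
  finally show "lin_ext A g (c \<odot>\<^bsub>monoid_alg G\<^esub> f) = c \<odot> lin_ext A g f" by simp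
qed

lemma lin_ext_single [simp]: "g u \<in> carrier A \<Longrightarrow> lin_ext A g (single u c) = c \<odot> g u"
  by (cases "c = 0") (auto simp: lin_ext_def)

lemma klin_sum:
  assumes C: "kspace C" and S: "finite S" and h: "\<And>i. i \<in> S \<Longrightarrow> klin C A (h i)"
  shows "klin C A (\<lambda>x. finsum A (\<lambda>i. c i \<odot> h i x) S)"
proof (rule klinI)
  interpret C: kspace C by fact
  fix u v assume u: "u \<in> carrier C" and v: "v \<in> carrier C"
  have "finsum A (\<lambda>i. c i \<odot> h i (u \<oplus>\<^bsub>C\<^esub> v)) S = finsum A (\<lambda>i. c i \<odot> h i u \<oplus> c i \<odot> h i v) S"
    using u v h by (intro finsum_cong') (auto simp: klin_add[OF h] smult_r_distr klin_closed[OF h])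
  also have "\<dots> = finsum A (\<lambda>i. c i \<odot> h i u) S \<oplus> finsum A (\<lambda>i. c i \<odot> h i v) S"
    using u v by (intro finsum_addf) (auto simp: klin_closed[OF h])
  finally show "finsum A (\<lambda>i. c i \<odot> h i (u \<oplus>\<^bsub>C\<^esub> v)) S = \<dots>" .
next
  fix u d assume u: "u \<in> carrier C"
  then show "finsum A (\<lambda>i. c i \<odot> h i u) S \<in> carrier A"
    by (intro finsum_closed) (auto simp: klin_closed[OF h])
  have "finsum A (\<lambda>i. c i \<odot> h i (d \<odot>\<^bsub>C\<^esub> u)) S = finsum A (\<lambda>i. d \<odot> (c i \<odot> h i u)) S"
  proof (rule finsum_cong')
    fix i assume i: "i \<in> S"
    show "c i \<odot> h i (d \<odot>\<^bsub>C\<^esub> u) = d \<odot> (c i \<odot> h i u)"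
      using u i by (simp add: klin_smult[OF h] smult_assoc[symmetric] klin_closed[OF h] mult.commute)
  qed (use u in \<open>auto simp: klin_closed[OF h]\<close>)
  also have "\<dots> = d \<odot> finsum A (\<lambda>i. c i \<odot> h i u) S"
    using u S by (intro finsum_smult[symmetric]) (auto simp: klin_closed[OF h])
  finally show "finsum A (\<lambda>i. c i \<odot> h i (d \<odot>\<^bsub>C\<^esub> u)) S = \<dots>" .
qed

end

text \<open>Written as an iterated linear extension, convolution is visibly linear in each
  factor.\<close>

lemma monoid_alg_mult_eq:
  fixes G :: "('g, 'm) monoid_scheme" and f g :: "'g \<Rightarrow>\<^sub>0 'k::field"
  assumes G: "monoid G" and f: "f \<in> carrier (monoid_alg G)" and g: "g \<in> carrier (monoid_alg G)"
  shows "f \<otimes>\<^bsub>monoid_alg G\<^esub> g = lin_ext (monoid_alg G)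
    (\<lambda>u. lin_ext (monoid_alg G) (\<lambda>v. single (u \<otimes>\<^bsub>G\<^esub> v) 1) g) f"
proof -
  interpret G: monoid G by fact
  interpret M: kspace "monoid_alg G :: ('k, 'g \<Rightarrow>\<^sub>0 'k) module" by (rule kspace_monoid_alg)
  have 1: "lin_ext (monoid_alg G) (\<lambda>v. single (u \<otimes>\<^bsub>G\<^esub> v) 1) g
      = (\<Sum>v\<in>keys g. single (u \<otimes>\<^bsub>G\<^esub> v) (lookup g v))"
    if "u \<in> carrier G" for u
    unfolding lin_ext_def using that g
    by (subst finsum_monoid_alg) (auto split: if_splits)
  have 2: "keys (\<Sum>v\<in>keys g. single (u \<otimes>\<^bsub>G\<^esub> v) (c * lookup g v)) \<subseteq> carrier G"
    if "u \<in> carrier G" for u c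
    using that g keys_sum[of "\<lambda>v. single (u \<otimes>\<^bsub>G\<^esub> v) (c * lookup g v)" "keys g"]
    by (fastforce split: if_splits)
  have sc: "Poly_Mapping.map ((*) c) (\<Sum>v\<in>S. h v) = (\<Sum>v\<in>S. Poly_Mapping.map ((*) c) (h v))"
    for c and S and h :: "'g \<Rightarrow> 'g \<Rightarrow>\<^sub>0 'k"
    by (rule poly_mapping_eqI) (simp add: lookup_scale lookup_sum sum_distrib_left)
  have "lin_ext (monoid_alg G) (\<lambda>u. lin_ext (monoid_alg G) (\<lambda>v. single (u \<otimes>\<^bsub>G\<^esub> v) 1) g) f
    = finsum (monoid_alg G) (\<lambda>u. \<Sum>v\<in>keys g.
       single (u \<otimes>\<^bsub>G\<^esub> v) (lookup f u * lookup g v)) (keys f)"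
    unfolding lin_ext_def[of _ _ f]
    using f 2 by (intro M.finsum_cong') (auto simp: 1 sc)
  also have "\<dots> = (\<Sum>u\<in>keys f. \<Sum>v\<in>keys g.
       single (u \<otimes>\<^bsub>G\<^esub> v) (lookup f u * lookup g v))"
    using 2 f by (intro finsum_monoid_alg) auto
  also have "\<dots> = f \<otimes>\<^bsub>monoid_alg G\<^esub> g" by (simp add: monoid_alg_def)
  finally show ?thesis ..
qed

lemma klin_cong:
  assumes "kspace A" "klin A B f" "\<And>u. u \<in> carrier A \<Longrightarrow> g u = f u"
  shows "klin A B g"
proof -
  interpret kspace A by fact
  show ?thesis using assms(2,3) unfolding klin_def by simp
qed

text \<open>Every ring axiom here compares multilinear maps. \<open>klin_monoid_alg_eq\<close>
  therefore reduces it, one argument at a time, to single basis elements, where it is an axiom of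
  the monoid G.\<close>

lemma
  fixes G :: "('g, 'm) monoid_scheme"
  assumes G: "monoid G"
  defines "M \<equiv> monoid_alg G :: ('k::field, 'g \<Rightarrow>\<^sub>0 'k) module"
  shows klin_monoid_alg_mult_left: "g \<in> carrier M \<Longrightarrow> klin M M (\<lambda>f. f \<otimes>\<^bsub>M\<^esub> g)"
    and klin_monoid_alg_mult_right: "f \<in> carrier M \<Longrightarrow> klin M M (\<lambda>g. f \<otimes>\<^bsub>M\<^esub> g)"
    and monoid_alg_mult_single: "u \<in> carrier G \<Longrightarrow> v \<in> carrier G \<Longrightarrow>
      single u 1 \<otimes>\<^bsub>M\<^esub> single v 1 = single (u \<otimes>\<^bsub>G\<^esub> v) 1"
    and kalgebra_monoid_alg: "kalgebra M"
proof -
  interpret G: monoid G by fact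
  interpret M: kspace M unfolding M_def by (rule kspace_monoid_alg)
  have s: "single u c \<in> carrier M" if "u \<in> carrier G" for u c
    using that by (simp add: M_def)
  have L: "klin M M (lin_ext M (\<lambda>v. single (u \<otimes>\<^bsub>G\<^esub> v) 1))" if "u \<in> carrier G" for u
    using M.klin_lin_ext[of "\<lambda>v. single (u \<otimes>\<^bsub>G\<^esub> v) 1" G] that s by (auto simp: M_def[symmetric])
  note mult = monoid_alg_mult_eq[OF G, where 'k = 'k, folded M_def]
  show kl: "klin M M (\<lambda>f. f \<otimes>\<^bsub>M\<^esub> g)" if g: "g \<in> carrier M" for g
  proof -
    have "(\<lambda>u. lin_ext M (\<lambda>v. single (u \<otimes>\<^bsub>G\<^esub> v) 1) g) \<in> carrier G \<rightarrow> carrier M"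
      using klin_closed[OF L g] by auto
    from M.klin_lin_ext[OF this] show ?thesis
      using mult[OF _ g] by (intro klin_cong[OF M.kspace_axioms _ mult[OF _ g]]) (auto simp: M_def[symmetric])
  qed
  show kr: "klin M M (\<lambda>g. f \<otimes>\<^bsub>M\<^esub> g)" if f: "f \<in> carrier M" for f
  proof (rule klin_cong[OF M.kspace_axioms _ mult[OF f]])
    have "u \<in> carrier G" if "u \<in> keys f" for u using that f by (auto simp: M_def)
    then show "klin M M (\<lambda>g. lin_ext M (\<lambda>u. lin_ext M (\<lambda>v. single (u \<otimes>\<^bsub>G\<^esub> v) 1) g) f)"
      unfolding lin_ext_def[of _ _ f] by (intro M.klin_sum M.kspace_axioms L) auto
  qed
  show ms: "single u 1 \<otimes>\<^bsub>M\<^esub> single v 1 = single (u \<otimes>\<^bsub>G\<^esub> v) 1"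
    if "u \<in> carrier G" "v \<in> carrier G" for u v
    by (simp add: M_def monoid_alg_def)
  have one: "\<one>\<^bsub>M\<^esub> = single \<one>\<^bsub>G\<^esub> 1" by (simp add: M_def)
  have mc: "f \<otimes>\<^bsub>M\<^esub> g \<in> carrier M" if "f \<in> carrier M" "g \<in> carrier M" for f g
    using klin_closed[OF kl] that by blast
  note uniq = klin_monoid_alg_eq[OF meta_eq_to_obj_eq[OF M_def] M.kspace_axioms]
  have assoc: "f \<otimes>\<^bsub>M\<^esub> g \<otimes>\<^bsub>M\<^esub> h = f \<otimes>\<^bsub>M\<^esub> (g \<otimes>\<^bsub>M\<^esub> h)"
    if f: "f \<in> carrier M" and g: "g \<in> carrier M" and h: "h \<in> carrier M" for f g h
  proof (rule uniq[OF klin_comp[OF kl[OF g] kl[OF h]] kl[OF mc[OF g h]] _ f])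
    fix u assume u: "u \<in> carrier G"
    let ?u = "single u 1"
    show "?u \<otimes>\<^bsub>M\<^esub> g \<otimes>\<^bsub>M\<^esub> h = ?u \<otimes>\<^bsub>M\<^esub> (g \<otimes>\<^bsub>M\<^esub> h)"
    proof (rule uniq[OF klin_comp[OF kr[OF s[OF u]] kl[OF h]] klin_comp[OF kl[OF h] kr[OF s[OF u]]] _ g])
      fix v assume v: "v \<in> carrier G"
      let ?v = "single v 1"
      show "?u \<otimes>\<^bsub>M\<^esub> ?v \<otimes>\<^bsub>M\<^esub> h = ?u \<otimes>\<^bsub>M\<^esub> (?v \<otimes>\<^bsub>M\<^esub> h)"
        by (rule uniq[OF kr[OF mc[OF s[OF u] s[OF v]]] klin_comp[OF kr[OF s[OF v]] kr[OF s[OF u]]] _ h])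
          (use u v in \<open>simp add: ms G.m_assoc\<close>)
    qed
  qed
  have id: "klin M M (\<lambda>f. f)" by (rule klinI) simp_all
  have l1: "\<one>\<^bsub>M\<^esub> \<otimes>\<^bsub>M\<^esub> f = f" if "f \<in> carrier M" for f
    by (rule uniq[OF kr id _ that]) (simp_all add: one s ms)
  have r1: "f \<otimes>\<^bsub>M\<^esub> \<one>\<^bsub>M\<^esub> = f" if "f \<in> carrier M" for f
    by (rule uniq[OF kl id _ that]) (simp_all add: one s ms)
  have oc: "\<one>\<^bsub>M\<^esub> \<in> carrier M" unfolding one by (rule s) simp
  have "ring M"
    by (intro ringI monoidI M.abelian_group_axioms mc assoc l1 r1 oc klin_add[OF kl] klin_add[OF kr])
  then show "kalgebra M"
    by (intro kalgebra.intro kalgebra_axioms.intro M.kspace_axioms klin_smult[OF kl] klin_smult[OF kr])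
qed

lemma alg_hom_lin_ext:
  fixes G :: "('g, 'm) monoid_scheme" and B :: "('k::field, 'b, 'n) module_scheme"
  assumes G: "monoid G" and B: "kalgebra B" and g: "g \<in> carrier G \<rightarrow> carrier B"
    and g1: "g \<one>\<^bsub>G\<^esub> = \<one>\<^bsub>B\<^esub>"
    and gm: "\<And>u v. u \<in> carrier G \<Longrightarrow> v \<in> carrier G \<Longrightarrow> g (u \<otimes>\<^bsub>G\<^esub> v) = g u \<otimes>\<^bsub>B\<^esub> g v"
  shows "alg_hom (monoid_alg G) B (lin_ext B g)"
proof -
  define M where "M = (monoid_alg G :: ('k::field, 'g \<Rightarrow>\<^sub>0 'k) module)"
  interpret G: monoid G by fact
  interpret B: kalgebra B by fact
  interpret M: kalgebra M unfolding M_def by (rule kalgebra_monoid_alg[OF G])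
  have lin: "klin M B (lin_ext B g)" unfolding M_def by (rule B.klin_lin_ext[OF g])
  have gc: "g u \<in> carrier B" if "u \<in> carrier G" for u using g that by auto
  have s: "single u c \<in> carrier M" if "u \<in> carrier G" for u c
    using that by (simp add: M_def)
  note kl = klin_monoid_alg_mult_left[OF G, where 'k = 'k, folded M_def]
  note kr = klin_monoid_alg_mult_right[OF G, where 'k = 'k, folded M_def]
  note ms = monoid_alg_mult_single[OF G, where 'k = 'k, folded M_def]
  note uniq = klin_monoid_alg_eq[OF M_def B.kspace_axioms]
  have bl: "klin M B (\<lambda>f. lin_ext B g f \<otimes>\<^bsub>B\<^esub> b)" if "b \<in> carrier B" for b
    using that by (intro klinI) (simp_all add: klin_closed[OF lin] klin_add[OF lin] klin_smult[OF lin] B.l_distr B.smult_mult_l)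
  have br: "klin M B (\<lambda>f. b \<otimes>\<^bsub>B\<^esub> lin_ext B g f)" if "b \<in> carrier B" for b
    using that by (intro klinI) (simp_all add: klin_closed[OF lin] klin_add[OF lin] klin_smult[OF lin] B.r_distr B.smult_mult_r)
  have "lin_ext B g (f \<otimes>\<^bsub>M\<^esub> h) = lin_ext B g f \<otimes>\<^bsub>B\<^esub> lin_ext B g h"
    if f: "f \<in> carrier M" and h: "h \<in> carrier M" for f h
  proof (rule uniq[OF klin_comp[OF kl[OF h] lin] bl[OF klin_closed[OF lin h]] _ f])
    fix u assume u: "u \<in> carrier G"
    show "lin_ext B g (single u 1 \<otimes>\<^bsub>M\<^esub> h) = lin_ext B g (single u 1) \<otimes>\<^bsub>B\<^esub> lin_ext B g h"
      by (rule uniq[OF klin_comp[OF kr[OF s[OF u]] lin] br[OF klin_closed[OF lin s[OF u]]] _ h])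
        (use u in \<open>simp add: ms gc gm\<close>)
  qed
  then show ?thesis
    unfolding M_def by (intro alg_homI lin[unfolded M_def]) (simp_all add: gc g1)
qed

section \<open>The free algebra on two letters\<close>

definition word_monoid :: "letter list monoid" where
  "word_monoid = \<lparr>carrier = UNIV, mult = (@), one = []\<rparr>"

lemma monoid_word_monoid: "monoid word_monoid"
  by (rule monoidI) (simp_all add: word_monoid_def)

lemma free_alg_eq: "free_alg = monoid_alg word_monoid"
  by (simp add: free_alg_def word_monoid_def)

lemma kalgebra_free_alg: "kalgebra free_alg"
  unfolding free_alg_eq by (rule kalgebra_monoid_alg[OF monoid_word_monoid])

lemma carrier_free_alg [simp]: "carrier free_alg = UNIV"
  by (simp add: free_alg_eq word_monoid_def)

lemma free_alg_minus [simp]: "f - g = f \<ominus>\<^bsub>free_alg\<^esub> g"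
  unfolding free_alg_eq by (rule monoid_alg_minus[symmetric]) (auto simp: word_monoid_def)

lemma free_alg_mult_word:
  "single u 1 \<otimes>\<^bsub>free_alg\<^esub> single v 1 = single (u @ v) 1"
  using monoid_alg_mult_single[OF monoid_word_monoid, of u v] by (simp add: free_alg_eq word_monoid_def)

text \<open>Words arise from the empty word by multiplying with letters on the left, and they
  span.\<close>

lemma free_alg_induct [consumes 1, case_names subspace one a x]:
  assumes f: "f \<in> carrier free_alg" and S: "subspace S free_alg" and one: "\<one>\<^bsub>free_alg\<^esub> \<in> S"
    and a: "\<And>f. f \<in> S \<Longrightarrow> free_a \<otimes>\<^bsub>free_alg\<^esub> f \<in> S" and x: "\<And>f. f \<in> S \<Longrightarrow> free_x \<otimes>\<^bsub>free_alg\<^esub> f \<in> S"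
  shows "f \<in> S"
proof -
  have w: "single w 1 \<in> S" for w
  proof (induction w)
    case Nil then show ?case using one by (simp add: free_alg_eq word_monoid_def)
  next
    case (Cons l w)
    then show ?case using a[OF Cons] x[OF Cons] free_alg_mult_word[of "[l]" w, where 'a='a]
      by (cases l) (simp_all add: free_a_def free_x_def)
  qed
  have "keys f \<subseteq> UNIV" by simp
  then show ?thesis
  proof (induction f rule: pm_subset_induct)
    case zero then show ?case using S by (simp add: subspace_def free_alg_eq)
  next
    case (add u c f)
    have "c \<odot>\<^bsub>free_alg\<^esub> single u 1 \<in> S" using S w unfolding subspace_def by blast
    then have "single u c \<in> S" by (simp add: free_alg_eq)
    then have "single u c \<oplus>\<^bsub>free_alg\<^esub> f \<in> S" using S add unfolding subspace_def by blast
    then show ?case by (simp add: free_alg_eq)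
  qed
qed

lemma free_alg_hom_exists:
  fixes B :: "('k::field, 'b, 'n) module_scheme"
  assumes B: "kalgebra B" and a: "a \<in> carrier B" and x: "x \<in> carrier B"
  obtains f where "alg_hom free_alg B f" "f free_a = a" "f free_x = x"
proof -
  interpret B: kalgebra B by fact
  define g where "g w = foldr (\<lambda>l b. (case l of Letter_a \<Rightarrow> a | Letter_x \<Rightarrow> x) \<otimes>\<^bsub>B\<^esub> b) w \<one>\<^bsub>B\<^esub>" for w
  have c: "(case l of Letter_a \<Rightarrow> a | Letter_x \<Rightarrow> x) \<in> carrier B" for l using a x by (cases l) auto
  have gc: "g w \<in> carrier B" for w by (induction w) (auto simp: g_def c)
  have gm: "g (u @ v) = g u \<otimes>\<^bsub>B\<^esub> g v" for u v
  proof (induction u)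
    case Nil then show ?case using gc by (simp add: g_def)
  next
    case (Cons l u)
    have "g ((l # u) @ v) = (case l of Letter_a \<Rightarrow> a | Letter_x \<Rightarrow> x) \<otimes>\<^bsub>B\<^esub> g (u @ v)" by (simp add: g_def)
    also have "\<dots> = (case l of Letter_a \<Rightarrow> a | Letter_x \<Rightarrow> x) \<otimes>\<^bsub>B\<^esub> g u \<otimes>\<^bsub>B\<^esub> g v"
      unfolding Cons by (rule B.m_assoc[symmetric, OF c gc gc])
    finally show ?case by (simp add: g_def)
  qed
  have "alg_hom free_alg B (lin_ext B g)"
    unfolding free_alg_eq
    by (rule alg_hom_lin_ext[OF monoid_word_monoid B]) (auto simp: word_monoid_def gc gm, simp add: g_def)
  moreover have "lin_ext B g free_a = a" "lin_ext B g free_x = x"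
    unfolding free_a_def free_x_def using gc by (simp_all, simp_all add: g_def a x)
  ultimately show ?thesis using that by blast
qed

section \<open>Tensor products\<close>

interpretation pm: Modules.module "\<lambda>c. Poly_Mapping.map ((*) (c::'k::field)) :: ('g \<Rightarrow>\<^sub>0 'k) \<Rightarrow> _"
  by unfold_locales (auto intro!: poly_mapping_eqI simp: lookup_scale lookup_add algebra_simps)

section \<open>Bilinear maps and the universal property\<close>

definition kbilin ::
  "('k::field, 'a, 'm) module_scheme \<Rightarrow> ('k, 'b, 'n) module_scheme \<Rightarrow> ('k, 'c, 'o) module_scheme
    \<Rightarrow> ('a \<Rightarrow> 'b \<Rightarrow> 'c) \<Rightarrow> bool" where
  "kbilin U V B b \<longleftrightarrow> (\<forall>v\<in>carrier V. klin U B (\<lambda>u. b u v)) \<and> (\<forall>u\<in>carrier U. klin V B (b u))"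

lemma kbilinD: "kbilin U V B b \<Longrightarrow> v \<in> carrier V \<Longrightarrow> klin U B (\<lambda>u. b u v)"
  "kbilin U V B b \<Longrightarrow> u \<in> carrier U \<Longrightarrow> klin V B (b u)"
  unfolding kbilin_def by auto

lemma kbilin_comp:
  assumes "kbilin U' V' B b" "klin U U' f" "klin V V' g"
  shows "kbilin U V B (\<lambda>u v. b (f u) (g v))"
  using assms unfolding kbilin_def klin_def by simp

lemma kbilin_form_mult:
  assumes "klin U field_alg f" "klin V field_alg g"
  shows "kbilin U V field_alg (\<lambda>u v. f u * g v)"
  using assms unfolding kbilin_def klin_def by (simp add: algebra_simps)

lemma bilin_relators_cases [consumes 1, case_names 1 2 3 4]:
  assumes "r \<in> bilin_relators U V"
  obtains u u' v where "u \<in> carrier U" "u' \<in> carrier U" "v \<in> carrier V"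
      "r = single (u \<oplus>\<^bsub>U\<^esub> u', v) 1 - single (u, v) 1 - single (u', v) 1"
    | u v v' where "u \<in> carrier U" "v \<in> carrier V" "v' \<in> carrier V"
      "r = single (u, v \<oplus>\<^bsub>V\<^esub> v') 1 - single (u, v) 1 - single (u, v') 1"
    | c u v where "u \<in> carrier U" "v \<in> carrier V"
      "r = single (c \<odot>\<^bsub>U\<^esub> u, v) 1 - single (u, v) c"
    | c u v where "u \<in> carrier U" "v \<in> carrier V"
      "r = single (u, c \<odot>\<^bsub>V\<^esub> v) 1 - single (u, v) c"
  using assms unfolding bilin_relators_def Un_iff mem_Collect_eq
  by (elim disjE exE conjE) (rule that; assumption)+

locale tensor_pair = U: kspace U + V: kspace V
  for U :: "('k::field, 'a, 'm) module_scheme" and V :: "('k, 'b, 'n) module_scheme"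
begin

abbreviation "F \<equiv> monoid_alg (U \<times>\<times> V) :: ('k, 'a \<times> 'b \<Rightarrow>\<^sub>0 'k) module"
abbreviation "I \<equiv> bilin_span U V"
abbreviation "T \<equiv> tensor_alg U V"
abbreviation "pt \<equiv> pure_tensor U V"

sublocale F: kspace F by (rule kspace_monoid_alg)

lemma single_closed [simp]: "u \<in> carrier U \<Longrightarrow> v \<in> carrier V \<Longrightarrow> single (u, v) c \<in> carrier F"
  by simp

lemma pm_subspace_carrier: "pm.subspace (carrier F)"
  by (rule pm.subspaceI) (auto dest: subsetD[OF keys_add] subsetD[OF keys_scale])

lemma bilin_relators_carrier: "bilin_relators U V \<subseteq> carrier F"
proof -
  note sub = pm.subspace_diff[OF pm_subspace_carrier]
  show ?thesis unfolding bilin_relators_def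
    by (auto simp del: monoid_alg_simps intro!: sub)
qed

lemma subspace_bilin_span: "subspace I F"
proof -
  have "I \<subseteq> carrier F" unfolding bilin_span_def
    by (rule pm.span_minimal[OF bilin_relators_carrier pm_subspace_carrier])
  then show ?thesis
    unfolding subspace_def
    by (simp add: bilin_span_def pm.span_zero pm.span_add pm.span_scale del: monoid_alg_simps(1))
qed

sublocale T: kspace T unfolding tensor_alg_def by (rule F.kspace_quot[OF subspace_bilin_span])

lemma klin_tensor_class: "klin F T (tensor_class U V)"
  using F.klin_coset[OF subspace_bilin_span] unfolding tensor_class_def[abs_def] tensor_alg_def .

lemma tensor_class_eqI:
  assumes "s \<in> carrier F" "s' \<in> carrier F" "s - s' \<in> I" shows "tensor_class U V s = tensor_class U V s'"
  using F.coset_eq_iff[OF subspace_bilin_span assms(1,2)] assms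
  unfolding tensor_class_def by (simp only: monoid_alg_minus)

lemma tensor_class_memD:
  assumes "s \<in> carrier F" "s' \<in> tensor_class U V s"
  shows "s' \<in> carrier F" "s' - s \<in> I"
  using F.coset_memD[OF subspace_bilin_span assms[unfolded tensor_class_def]]
    F.coset_eq_iff[OF subspace_bilin_span _ assms(1), of s'] assms(1)
  by (simp_all only: monoid_alg_minus)

lemma tensor_class_self: "s \<in> carrier F \<Longrightarrow> s \<in> tensor_class U V s"
  unfolding tensor_class_def
  by (rule abelian_subgroup.a_rcos_self[OF F.subspace_abelian_subgroup[OF subspace_bilin_span]])

lemma tensor_cases:
  assumes "t \<in> carrier T" obtains s where "s \<in> carrier F" "t = tensor_class U V s"
  using assms unfolding tensor_alg_def tensor_class_def by (rule F.quot_alg_cases)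

lemma pure_tensor_closed [simp]: "u \<in> carrier U \<Longrightarrow> v \<in> carrier V \<Longrightarrow> pt u v \<in> carrier T"
  unfolding pure_tensor_def by (rule klin_closed[OF klin_tensor_class single_closed])

lemma kbilin_pure_tensor: "kbilin U V T pt"
proof -
  note add = klin_add[OF klin_tensor_class, symmetric]
  note sc = klin_smult[OF klin_tensor_class, symmetric]
  have *: "tensor_class U V s = tensor_class U V s'"
    if "s - s' \<in> bilin_relators U V" "s \<in> carrier F" "s' \<in> carrier F" for s s'
    using that unfolding bilin_span_def by (intro tensor_class_eqI) (simp_all add: bilin_span_def pm.span_base)
  have 1: "pt (u \<oplus>\<^bsub>U\<^esub> u') v = pt u v \<oplus>\<^bsub>T\<^esub> pt u' v"
    if "u \<in> carrier U" "u' \<in> carrier U" "v \<in> carrier V" for u u' v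
    unfolding pure_tensor_def add[OF single_closed[OF that(1,3)] single_closed[OF that(2,3)]]
  proof (rule *)
    have "single (u \<oplus>\<^bsub>U\<^esub> u', v) 1 - single (u, v) 1 - single (u', v) 1
      \<in> bilin_relators U V" unfolding bilin_relators_def using that by blast
    then show "single (u \<oplus>\<^bsub>U\<^esub> u', v) 1
      - (single (u, v) 1 \<oplus>\<^bsub>F\<^esub> single (u', v) 1) \<in> bilin_relators U V"
      by (simp add: diff_diff_eq)
  qed (use that in \<open>simp_all del: monoid_alg_simps\<close>)
  have 2: "pt u (v \<oplus>\<^bsub>V\<^esub> v') = pt u v \<oplus>\<^bsub>T\<^esub> pt u v'"
    if "u \<in> carrier U" "v \<in> carrier V" "v' \<in> carrier V" for u v v'
    unfolding pure_tensor_def add[OF single_closed[OF that(1,2)] single_closed[OF that(1,3)]]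
  proof (rule *)
    have "single (u, v \<oplus>\<^bsub>V\<^esub> v') 1 - single (u, v) 1 - single (u, v') 1
      \<in> bilin_relators U V" unfolding bilin_relators_def using that by blast
    then show "single (u, v \<oplus>\<^bsub>V\<^esub> v') 1
      - (single (u, v) 1 \<oplus>\<^bsub>F\<^esub> single (u, v') 1) \<in> bilin_relators U V"
      by (simp add: diff_diff_eq)
  qed (use that in \<open>simp_all del: monoid_alg_simps\<close>)
  have sc1: "c \<odot>\<^bsub>F\<^esub> single (u, v) 1 = single (u, v) c" for u v c by simp
  have 3: "pt (c \<odot>\<^bsub>U\<^esub> u) v = c \<odot>\<^bsub>T\<^esub> pt u v"
    if "u \<in> carrier U" "v \<in> carrier V" for u v c
    unfolding pure_tensor_def sc[OF single_closed[OF that]] sc1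
  proof (rule *)
    show "single (c \<odot>\<^bsub>U\<^esub> u, v) 1 - single (u, v) c \<in> bilin_relators U V"
      unfolding bilin_relators_def using that by blast
  qed (use that in \<open>simp_all del: monoid_alg_simps\<close>)
  have 4: "pt u (c \<odot>\<^bsub>V\<^esub> v) = c \<odot>\<^bsub>T\<^esub> pt u v"
    if "u \<in> carrier U" "v \<in> carrier V" for u v c
    unfolding pure_tensor_def sc[OF single_closed[OF that]] sc1
  proof (rule *)
    show "single (u, c \<odot>\<^bsub>V\<^esub> v) 1 - single (u, v) c \<in> bilin_relators U V"
      unfolding bilin_relators_def using that by blast
  qed (use that in \<open>simp_all del: monoid_alg_simps\<close>)
  show ?thesis unfolding kbilin_def klin_def by (simp add: 1 2 3 4)
qed

lemma klin_tensor_eq: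
  assumes B: "kspace B" and f: "klin T B f" and g: "klin T B g"
    and eq: "\<And>u v. u \<in> carrier U \<Longrightarrow> v \<in> carrier V \<Longrightarrow> f (pt u v) = g (pt u v)"
    and t: "t \<in> carrier T"
  shows "f t = g t"
proof -
  obtain s where s: "s \<in> carrier F" "t = tensor_class U V s" using t by (rule tensor_cases)
  have "f (tensor_class U V s) = g (tensor_class U V s)"
    by (rule klin_monoid_alg_eq[OF refl B klin_comp[OF klin_tensor_class f] klin_comp[OF klin_tensor_class g] _ s(1)])
      (auto simp: pure_tensor_def[symmetric] eq)
  then show ?thesis using s by simp
qed

text \<open>This is the universal property: the linear extension of a bilinear map kills each
  relator, and its kernel is a subspace, so it kills their span.\<close>

lemma lin_ext_bilin_zero:
  assumes B: "kspace B" and b: "kbilin U V B b" and s: "s \<in> I"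
  shows "lin_ext B (\<lambda>p. b (fst p) (snd p)) s = \<zero>\<^bsub>B\<^esub>"
proof -
  interpret B: kspace B by fact
  let ?L = "lin_ext B (\<lambda>p. b (fst p) (snd p))"
  have bc: "b u v \<in> carrier B" if "u \<in> carrier U" "v \<in> carrier V" for u v
    using klin_closed[OF kbilinD(2)[OF b]] that by blast
  have L: "klin F B ?L" by (rule B.klin_lin_ext) (auto simp: bc)
  have Ls: "?L (single (u, v) c) = c \<odot>\<^bsub>B\<^esub> b u v" if "u \<in> carrier U" "v \<in> carrier V" for u v c
    using that bc by simp
  have Ld: "?L (f - g) = ?L f \<ominus>\<^bsub>B\<^esub> ?L g" if "f \<in> carrier F" "g \<in> carrier F" for f g
    using klin_minus[OF F.kspace_axioms B L that] by (simp only: monoid_alg_minus[OF that])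
  have canc: "(x \<oplus>\<^bsub>B\<^esub> y) \<ominus>\<^bsub>B\<^esub> x \<ominus>\<^bsub>B\<^esub> y = \<zero>\<^bsub>B\<^esub>" if "x \<in> carrier B" "y \<in> carrier B" for x y
    using that B.r_neg[of "x \<oplus>\<^bsub>B\<^esub> y"] by (simp add: B.minus_eq B.minus_add B.a_assoc)
  note cl = pm.subspace_diff[OF pm_subspace_carrier]
  have rel: "?L r = \<zero>\<^bsub>B\<^esub>" if "r \<in> bilin_relators U V" for r
    using that
  proof (cases rule: bilin_relators_cases)
    case 1
    then show ?thesis
      by (simp add: Ld Ls cl bc klin_add[OF kbilinD(1)[OF b]] canc del: monoid_alg_simps B.lin_ext_single)
  next
    case 2
    then show ?thesis
      by (simp add: Ld Ls cl bc klin_add[OF kbilinD(2)[OF b]] canc del: monoid_alg_simps B.lin_ext_single)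
  next
    case 3
    then show ?thesis
      by (simp add: Ld Ls cl bc klin_smult[OF kbilinD(1)[OF b]] B.minus_eq B.r_neg del: monoid_alg_simps B.lin_ext_single)
  next
    case 4
    then show ?thesis
      by (simp add: Ld Ls cl bc klin_smult[OF kbilinD(2)[OF b]] B.minus_eq B.r_neg del: monoid_alg_simps B.lin_ext_single)
  qed
  have "s \<in> carrier F \<and> ?L s = \<zero>\<^bsub>B\<^esub>"
    using s unfolding bilin_span_def
  proof (rule pm.span_induct)
    show "pm.subspace {s. s \<in> carrier F \<and> ?L s = \<zero>\<^bsub>B\<^esub>}"
    proof (rule pm.subspaceI)
      show "0 \<in> {s. s \<in> carrier F \<and> ?L s = \<zero>\<^bsub>B\<^esub>}" using klin_zero[OF F.kspace_axioms B L] by simp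
    next
      fix f g assume "f \<in> {s. s \<in> carrier F \<and> ?L s = \<zero>\<^bsub>B\<^esub>}" "g \<in> {s. s \<in> carrier F \<and> ?L s = \<zero>\<^bsub>B\<^esub>}"
      then show "f + g \<in> {s. s \<in> carrier F \<and> ?L s = \<zero>\<^bsub>B\<^esub>}"
        using klin_add[OF L, of f g] F.a_closed[of f g] by (simp del: monoid_alg_simps(1))
    next
      fix c f assume "f \<in> {s. s \<in> carrier F \<and> ?L s = \<zero>\<^bsub>B\<^esub>}"
      then show "Poly_Mapping.map ((*) c) f \<in> {s. s \<in> carrier F \<and> ?L s = \<zero>\<^bsub>B\<^esub>}"
        using klin_smult[OF L, of f c] F.smult_closed[of f c] by (simp del: monoid_alg_simps(1))
    qed
  qed (use rel bilin_relators_carrier in auto)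
  then show ?thesis by simp
qed

lemma lin_ext_bilin_class:
  assumes B: "kspace B" and b: "kbilin U V B b" and s: "s \<in> carrier F" and s': "s' \<in> tensor_class U V s"
  shows "lin_ext B (\<lambda>p. b (fst p) (snd p)) s' = lin_ext B (\<lambda>p. b (fst p) (snd p)) s"
proof -
  interpret B: kspace B by fact
  let ?L = "lin_ext B (\<lambda>p. b (fst p) (snd p))"
  have bc: "b u v \<in> carrier B" if "u \<in> carrier U" "v \<in> carrier V" for u v
    using klin_closed[OF kbilinD(2)[OF b]] that by blast
  have L: "klin F B ?L" by (rule B.klin_lin_ext) (auto simp: bc)
  note d = tensor_class_memD[OF s s']
  have dc: "s' - s \<in> carrier F" using d(2) subspace_bilin_span unfolding subspace_def by blast
  have "s' = (s' - s) \<oplus>\<^bsub>F\<^esub> s" by simp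
  then have "?L s' = ?L ((s' - s) \<oplus>\<^bsub>F\<^esub> s)" by simp
  also have "\<dots> = ?L (s' - s) \<oplus>\<^bsub>B\<^esub> ?L s" by (rule klin_add[OF L dc s])
  finally show ?thesis using lin_ext_bilin_zero[OF B b d(2)] klin_closed[OF L s] by simp
qed

text \<open>The description in \<open>tensor_eval\<close> is definite because all representatives of
  a tensor differ by elements of the span, hence give the same value of a bilinear form.\<close>

lemma tensor_eval_class:
  assumes b: "kbilin U V field_alg b" and s: "s \<in> carrier F"
  shows "tensor_eval b (tensor_class U V s) = lin_ext field_alg (\<lambda>p. b (fst p) (snd p)) s"
  unfolding tensor_eval_def
proof (rule the_equality)
  let ?L = "lin_ext field_alg (\<lambda>p. b (fst p) (snd p))"
  have e: "(\<Sum>p\<in>keys s. lookup s p * b (fst p) (snd p)) = ?L s" for s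
    by (simp add: lin_ext_def)
  show "\<exists>s'\<in>tensor_class U V s. ?L s = (\<Sum>p\<in>keys s'. lookup s' p * b (fst p) (snd p))"
    unfolding e using tensor_class_self[OF s] by blast
  show "c = ?L s" if "\<exists>s'\<in>tensor_class U V s. c = (\<Sum>p\<in>keys s'. lookup s' p * b (fst p) (snd p))" for c
    using that lin_ext_bilin_class[OF kspace_field_alg b s] unfolding e by auto
qed

lemma
  assumes b: "kbilin U V field_alg b"
  shows klin_tensor_eval: "klin T field_alg (tensor_eval b)"
    and tensor_eval_pure: "u \<in> carrier U \<Longrightarrow> v \<in> carrier V \<Longrightarrow> tensor_eval b (pt u v) = b u v"
proof -
  interpret K: kalgebra field_alg by (rule kalgebra_field_alg)
  let ?L = "lin_ext field_alg (\<lambda>p. b (fst p) (snd p))"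
  have L: "klin F field_alg ?L" by (rule K.klin_lin_ext) auto
  note tc = klin_tensor_class
  show "klin T field_alg (tensor_eval b)"
  proof (rule klinI)
    fix t t' assume "t \<in> carrier T" "t' \<in> carrier T"
    then obtain s s' where s: "s \<in> carrier F" "t = tensor_class U V s" "s' \<in> carrier F" "t' = tensor_class U V s'"
      by (metis tensor_cases)
    show "tensor_eval b (t \<oplus>\<^bsub>T\<^esub> t') = tensor_eval b t \<oplus>\<^bsub>field_alg\<^esub> tensor_eval b t'"
      using s by (simp only: klin_add[OF tc, symmetric] tensor_eval_class[OF b] F.a_closed klin_add[OF L])
  next
    fix t c assume "t \<in> carrier T"
    then obtain s where s: "s \<in> carrier F" "t = tensor_class U V s" by (rule tensor_cases)
    show "tensor_eval b (c \<odot>\<^bsub>T\<^esub> t) = c \<odot>\<^bsub>field_alg\<^esub> tensor_eval b t"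
      using s by (simp only: klin_smult[OF tc, symmetric] tensor_eval_class[OF b] F.smult_closed klin_smult[OF L])
  qed simp
  show "tensor_eval b (pt u v) = b u v" if "u \<in> carrier U" "v \<in> carrier V"
    unfolding pure_tensor_def tensor_eval_class[OF b single_closed[OF that]] by simp
qed

end

text \<open>As with scaling in a quotient, \<open>tensor_map\<close> is a union over representatives
  of cosets that all agree; they agree because (u, v) mapped to the pure tensor of f u and g v is
  bilinear.\<close>

lemma
  assumes "tensor_pair U V" "tensor_pair U' V'" and f: "klin U U' f" and g: "klin V V' g"
  shows klin_tensor_map: "klin (tensor_alg U V) (tensor_alg U' V') (tensor_map U' V' f g)"
    and tensor_map_pure: "u \<in> carrier U \<Longrightarrow> v \<in> carrier V \<Longrightarrow>
      tensor_map U' V' f g (pure_tensor U V u v) = pure_tensor U' V' (f u) (g v)"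
proof -
  interpret T: tensor_pair U V by fact
  interpret T': tensor_pair U' V' by fact
  let ?b = "\<lambda>u v. pure_tensor U' V' (f u) (g v)"
  let ?L = "lin_ext T'.T (\<lambda>p. ?b (fst p) (snd p))"
  have b: "kbilin U V T'.T ?b" by (rule kbilin_comp[OF T'.kbilin_pure_tensor f g])
  have L: "klin T.F T'.T ?L"
    by (rule T'.T.klin_lin_ext) (auto simp: klin_closed[OF f] klin_closed[OF g])
  let ?m = "\<lambda>s. \<Sum>p\<in>keys s. single (f (fst p), g (snd p)) (lookup s p)"
  have m: "tensor_class U' V' (?m s) = ?L s" if s: "s \<in> carrier T.F" for s
  proof -
    have k: "(\<lambda>p. single (f (fst p), g (snd p)) (lookup s p)) \<in> keys s \<rightarrow> carrier T'.F"
      using s by (auto simp: klin_closed[OF f] klin_closed[OF g] split: if_splits)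
    have "tensor_class U' V' (?m s) = tensor_class U' V' (finsum T'.F (\<lambda>p. single (f (fst p), g (snd p)) (lookup s p)) (keys s))"
      using finsum_monoid_alg[OF k] by simp
    also have "\<dots> = finsum T'.T (\<lambda>p. tensor_class U' V' (single (f (fst p), g (snd p)) (lookup s p))) (keys s)"
      by (rule klin_finsum[OF T'.F.kspace_axioms T'.T.kspace_axioms T'.klin_tensor_class finite_keys k])
    also have "\<dots> = ?L s" unfolding lin_ext_def
    proof (rule T'.T.finsum_cong')
      fix p assume "p \<in> keys s"
      then have p: "f (fst p) \<in> carrier U'" "g (snd p) \<in> carrier V'"
        using s by (auto simp: klin_closed[OF f] klin_closed[OF g])
      then show "tensor_class U' V' (single (f (fst p), g (snd p)) (lookup s p))
          = lookup s p \<odot>\<^bsub>T'.T\<^esub> ?b (fst p) (snd p)"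
        unfolding pure_tensor_def klin_smult[OF T'.klin_tensor_class T'.single_closed[OF p], symmetric] by simp
    qed (use s in \<open>auto simp: klin_closed[OF f] klin_closed[OF g]\<close>)
    finally show ?thesis .
  qed
  have c: "tensor_map U' V' f g (tensor_class U V s) = ?L s" if s: "s \<in> carrier T.F" for s
    unfolding tensor_map_def
    by (rule UN_constant_eq[OF T.tensor_class_self[OF s]])
      (use T.lin_ext_bilin_class[OF T'.T.kspace_axioms b s] T.tensor_class_memD(1)[OF s] m in \<open>simp del: monoid_alg_simps(1)\<close>)
  note tc = T.klin_tensor_class
  show "klin (tensor_alg U V) (tensor_alg U' V') (tensor_map U' V' f g)"
  proof (rule klinI)
    fix t t' assume "t \<in> carrier T.T" "t' \<in> carrier T.T"
    then obtain s s' where s: "s \<in> carrier T.F" "t = tensor_class U V s" "s' \<in> carrier T.F" "t' = tensor_class U V s'"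
      by (metis T.tensor_cases)
    show "tensor_map U' V' f g (t \<oplus>\<^bsub>T.T\<^esub> t') = tensor_map U' V' f g t \<oplus>\<^bsub>T'.T\<^esub> tensor_map U' V' f g t'"
      using s by (simp only: klin_add[OF tc, symmetric] c T.F.a_closed klin_add[OF L])
  next
    fix t k assume "t \<in> carrier T.T"
    then obtain s where s: "s \<in> carrier T.F" "t = tensor_class U V s" by (rule T.tensor_cases)
    show "tensor_map U' V' f g (k \<odot>\<^bsub>T.T\<^esub> t) = k \<odot>\<^bsub>T'.T\<^esub> tensor_map U' V' f g t"
      using s by (simp only: klin_smult[OF tc, symmetric] c T.F.smult_closed klin_smult[OF L])
    show "tensor_map U' V' f g t \<in> carrier T'.T"
      using s by (simp only: c klin_closed[OF L])
  qed
  show "tensor_map U' V' f g (pure_tensor U V u v) = pure_tensor U' V' (f u) (g v)"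
    if "u \<in> carrier U" "v \<in> carrier V"
    unfolding pure_tensor_def[of U V] c[OF T.single_closed[OF that]]
    using that by (simp add: klin_closed[OF f] klin_closed[OF g])
qed

text \<open>This moves an evaluation on the tensor square of the dual back to the tensor square of
  the Hopf algebra; both directions of the theorem use it to unfold compatibility with the
  comultiplications.\<close>

lemma tensor_eval_map:
  assumes "tensor_pair U V" "tensor_pair U' V'" and f: "klin U U' f" and g: "klin V V' g"
    and b: "kbilin U' V' field_alg b" and t: "t \<in> carrier (tensor_alg U V)"
  shows "tensor_eval b (tensor_map U' V' f g t) = tensor_eval (\<lambda>u v. b (f u) (g v)) t"
proof -
  interpret T: tensor_pair U V by fact
  interpret T': tensor_pair U' V' by fact
  note b' = kbilin_comp[OF b f g]
  show ?thesis
    by (rule T.klin_tensor_eq[OF kspace_field_alg klin_comp[OF klin_tensor_map T'.klin_tensor_eval[OF b]] T.klin_tensor_eval[OF b'] _ t])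
      (use assms in \<open>simp_all add: tensor_map_pure T.tensor_eval_pure[OF b'] T'.tensor_eval_pure[OF b] klin_closed[OF f] klin_closed[OF g]\<close>)
qed

section \<open>The product on a tensor product of algebras\<close>

locale tensor_pair_alg = tensor_pair U V + U: kalgebra U + V: kalgebra V
  for U :: "('k::field, 'a, 'm) module_scheme" and V :: "('k, 'b, 'n) module_scheme"
begin

lemma monoid_DirProd': "monoid (U \<times>\<times> V)"
  by (rule DirProd_monoid[OF U.monoid_axioms V.monoid_axioms])

sublocale F: kalgebra F by (rule kalgebra_monoid_alg[OF monoid_DirProd'])

lemma single_mult_single:
  assumes "u \<in> carrier U" "v \<in> carrier V" "u' \<in> carrier U" "v' \<in> carrier V"
  shows "single (u, v) c \<otimes>\<^bsub>F\<^esub> single (u', v') c'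
    = single (u \<otimes>\<^bsub>U\<^esub> u', v \<otimes>\<^bsub>V\<^esub> v') (c * c')"
  by (simp add: monoid_alg_def)

text \<open>Multiplication by a single pair acts on the two entries through linear maps, so it sends
  relators to relators. Linearity extends this from relators to their span and from single pairs to
  arbitrary factors.\<close>

lemma ideal_bilin_span: "ideal I F"
proof -
  note S = subspace_bilin_span
  have IF: "I \<subseteq> carrier F" using S unfolding subspace_def by blast
  note kl = klin_monoid_alg_mult_left[OF monoid_DirProd', where 'k = 'k]
  note kr = klin_monoid_alg_mult_right[OF monoid_DirProd', where 'k = 'k]
  have diff: "h (f - g) = h f - h g" if h: "klin F F h" and f: "f \<in> carrier F" and g: "g \<in> carrier F"
    for f g h
    using klin_minus[OF F.kspace_axioms F.kspace_axioms h f g]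
    by (simp only: monoid_alg_minus[OF f g] monoid_alg_minus[OF klin_closed[OF h f] klin_closed[OF h g]])
  \<comment> \<open>Left and right multiplication by a pair are treated together: h acts through f
    on the first entries and through g on the second, and preserves the kind of each
    relator.\<close>
  have rel: "h r \<in> bilin_relators U V"
    if r: "r \<in> bilin_relators U V" and h: "klin F F h"
      and hs: "\<And>u v c. u \<in> carrier U \<Longrightarrow> v \<in> carrier V \<Longrightarrow> h (single (u, v) c) = single (f u, g v) c"
      and f: "klin U U f" and g: "klin V V g" for h r f g
  proof -
    note cl = single_closed pm.subspace_diff[OF pm_subspace_carrier] U.a_closed V.a_closed U.smult_closed V.smult_closed
    note fg = klin_closed[OF f] klin_closed[OF g]
    note lin = diff[OF h] hs klin_add[OF f] klin_add[OF g] klin_smult[OF f] klin_smult[OF g]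
    from r show ?thesis
    proof (cases rule: bilin_relators_cases)
      case (1 u u' v)
      then have "h r = single (f u \<oplus>\<^bsub>U\<^esub> f u', g v) 1 - single (f u, g v) 1 - single (f u', g v) 1"
        by (simp only: lin cl)
      then show ?thesis unfolding bilin_relators_def using 1 fg by blast
    next
      case (2 u v v')
      then have "h r = single (f u, g v \<oplus>\<^bsub>V\<^esub> g v') 1 - single (f u, g v) 1 - single (f u, g v') 1"
        by (simp only: lin cl)
      then show ?thesis unfolding bilin_relators_def using 2 fg by blast
    next
      case (3 c u v)
      then have "h r = single (c \<odot>\<^bsub>U\<^esub> f u, g v) 1 - single (f u, g v) c"
        by (simp only: lin cl)
      then show ?thesis unfolding bilin_relators_def using 3 fg by blast
    next
      case (4 c u v)
      then have "h r = single (f u, c \<odot>\<^bsub>V\<^esub> g v) 1 - single (f u, g v) c"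
        by (simp only: lin cl)
      then show ?thesis unfolding bilin_relators_def using 4 fg by blast
    qed
  qed
  have inI: "h s \<in> I"
    if s: "s \<in> I" and h: "klin F F h"
      and hs: "\<And>u v c. u \<in> carrier U \<Longrightarrow> v \<in> carrier V \<Longrightarrow> h (single (u, v) c) = single (f u, g v) c"
      and f: "klin U U f" and g: "klin V V g" for h s f g
  proof -
    have "s \<in> carrier F \<and> h s \<in> I" using s unfolding bilin_span_def[of U V]
    proof (rule pm.span_induct, fold bilin_span_def)
      show "pm.subspace {s. s \<in> carrier F \<and> h s \<in> I}"
      proof (rule pm.subspaceI)
        show "0 \<in> {s. s \<in> carrier F \<and> h s \<in> I}"
          using klin_zero[OF F.kspace_axioms F.kspace_axioms h] S by (simp add: subspace_def)
      next
        fix s s' assume "s \<in> {s. s \<in> carrier F \<and> h s \<in> I}" "s' \<in> {s. s \<in> carrier F \<and> h s \<in> I}"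
        then show "s + s' \<in> {s. s \<in> carrier F \<and> h s \<in> I}"
          using klin_add[OF h, of s s'] F.a_closed[of s s'] S by (simp add: subspace_def del: monoid_alg_simps(1))
      next
        fix c s assume "s \<in> {s. s \<in> carrier F \<and> h s \<in> I}"
        then show "Poly_Mapping.map ((*) c) s \<in> {s. s \<in> carrier F \<and> h s \<in> I}"
          using klin_smult[OF h, of s c] F.smult_closed[of s c] S by (simp add: subspace_def del: monoid_alg_simps(1))
      qed
      show "r \<in> carrier F \<and> h r \<in> I" if "r \<in> bilin_relators U V" for r
        using rel[OF that h hs f g] bilin_relators_carrier that
        unfolding bilin_span_def by (auto intro: pm.span_base simp del: monoid_alg_simps)
    qed
    then show ?thesis ..
  qed
  have Ul: "klin U U (\<lambda>x. u \<otimes>\<^bsub>U\<^esub> x)" "klin U U (\<lambda>x. x \<otimes>\<^bsub>U\<^esub> u)" if "u \<in> carrier U" for u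
    using that by (auto intro!: klinI simp: U.l_distr U.r_distr U.smult_mult_l U.smult_mult_r)
  have Vl: "klin V V (\<lambda>x. v \<otimes>\<^bsub>V\<^esub> x)" "klin V V (\<lambda>x. x \<otimes>\<^bsub>V\<^esub> v)" if "v \<in> carrier V" for v
    using that by (auto intro!: klinI simp: V.l_distr V.r_distr V.smult_mult_l V.smult_mult_r)
  have sub: "f \<in> carrier F \<Longrightarrow> (\<And>u v c. u \<in> carrier U \<Longrightarrow> v \<in> carrier V \<Longrightarrow> h (single (u, v) 1) \<in> I) \<Longrightarrow> h f \<in> I"
    if h: "klin F F h" for h f
  proof -
    assume f: "f \<in> carrier F" and hs: "\<And>u v c. u \<in> carrier U \<Longrightarrow> v \<in> carrier V \<Longrightarrow> h (single (u, v) 1) \<in> I"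
    have "keys f \<subseteq> carrier (U \<times>\<times> V)" using f by simp
    then show "h f \<in> I"
    proof (induction f rule: pm_subset_induct)
      case zero
      then show ?case using klin_zero[OF F.kspace_axioms F.kspace_axioms h] S by (simp add: subspace_def)
    next
      case (add p c f)
      obtain u v where p: "p = (u, v)" "u \<in> carrier U" "v \<in> carrier V" using add(1) by (auto simp: DirProd_def)
      have 1: "single p c + f = c \<odot>\<^bsub>F\<^esub> single (u, v) 1 \<oplus>\<^bsub>F\<^esub> f" by (simp add: p)
      have fc: "f \<in> carrier F" using add(2) by simp
      have "h (single p c + f) = c \<odot>\<^bsub>F\<^esub> h (single (u, v) 1) \<oplus>\<^bsub>F\<^esub> h f"
        unfolding 1 using fc single_closed[OF p(2,3)] by (simp only: klin_add[OF h] klin_smult[OF h] F.smult_closed)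
      then show ?case using S hs[OF p(2,3)] add(3) unfolding subspace_def by metis
    qed
  qed
  show ?thesis
  proof (rule idealI)
    show "ring F" by (rule F.ring_axioms)
    show "subgroup I (add_monoid F)"
      using F.subspace_abelian_subgroup[OF S] by (simp add: abelian_subgroup_def additive_subgroup_def)
    fix s f assume s: "s \<in> I" and f: "f \<in> carrier F"
    have sF: "s \<in> carrier F" using s IF by blast
    show "f \<otimes>\<^bsub>F\<^esub> s \<in> I"
      by (rule sub[OF kl[OF sF] f], rule inI[OF s kr])
        (auto simp: single_mult_single intro: Ul Vl simp del: monoid_alg_simps)
    show "s \<otimes>\<^bsub>F\<^esub> f \<in> I"
      by (rule sub[OF kr[OF sF] f], rule inI[OF s kl])
        (auto simp: single_mult_single intro: Ul Vl simp del: monoid_alg_simps)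
  qed
qed

sublocale T: kalgebra T
  unfolding tensor_alg_def by (rule F.kalgebra_quot[OF ideal_bilin_span])

lemma alg_hom_tensor_class: "alg_hom F T (tensor_class U V)"
  using F.alg_hom_coset[OF ideal_bilin_span] unfolding tensor_class_def[abs_def] tensor_alg_def .

lemma pure_tensor_mult:
  assumes "u \<in> carrier U" "v \<in> carrier V" "u' \<in> carrier U" "v' \<in> carrier V"
  shows "pt u v \<otimes>\<^bsub>T\<^esub> pt u' v' = pt (u \<otimes>\<^bsub>U\<^esub> u') (v \<otimes>\<^bsub>V\<^esub> v')"
  unfolding pure_tensor_def
  using alg_hom_mult[OF alg_hom_tensor_class single_closed[OF assms(1,2)] single_closed[OF assms(3,4)], symmetric]
    single_mult_single[OF assms] by simp

lemma tensor_one: "\<one>\<^bsub>T\<^esub> = pt \<one>\<^bsub>U\<^esub> \<one>\<^bsub>V\<^esub>"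
  unfolding pure_tensor_def using alg_hom_one[OF alg_hom_tensor_class] by simp

lemma pure_tensor_nat_pow:
  assumes "u \<in> carrier U" "v \<in> carrier V"
  shows "pt u v [^]\<^bsub>T\<^esub> (m::nat) = pt (u [^]\<^bsub>U\<^esub> m) (v [^]\<^bsub>V\<^esub> m)"
  by (induction m) (use assms in \<open>simp_all add: tensor_one pure_tensor_mult\<close>)

end

section \<open>Finite bases and duals\<close>

lemma klin_form_scale:
  assumes "kspace A" "klin C field_alg h" "w \<in> carrier A"
  shows "klin C A (\<lambda>x. h x \<odot>\<^bsub>A\<^esub> w)"
proof -
  interpret A: kspace A by fact
  show ?thesis
    using assms(3) by (intro klinI)
      (simp_all add: klin_form_add[OF assms(2)] klin_form_smult[OF assms(2)] A.smult_l_distr A.smult_assoc)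
qed

lemma klin_finsum_fun:
  fixes A :: "('k::field, 'a, 'm) module_scheme" and C :: "('k, 'c, 'n) module_scheme"
  assumes A: "kspace A" and C: "kspace C" and S: "finite S" and h: "\<And>i. i \<in> S \<Longrightarrow> klin C A (h i)"
  shows "klin C A (\<lambda>x. finsum A (\<lambda>i. h i x) S)"
proof -
  interpret A: kspace A by fact
  show ?thesis
  proof (rule klin_cong[OF C A.klin_sum[OF C S h, where c = "\<lambda>_. 1"]])
    fix u assume "u \<in> carrier C"
    then show "finsum A (\<lambda>i. h i u) S = finsum A (\<lambda>i. 1 \<odot>\<^bsub>A\<^esub> h i u) S"
      by (intro A.finsum_cong') (auto simp: klin_closed[OF h])
  qed
qed

text \<open>A Hopf record extends an algebra record without changing its vector space operations;
  this and the facts that follow transfer properties between the two.\<close>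

lemma kspace_cong:
  fixes A :: "('k::field, 'a, 'm) module_scheme" and B :: "('k, 'a, 'n) module_scheme"
  assumes A: "kspace A" and eq: "carrier B = carrier A" "zero B = zero A" "add B = add A" "smult B = smult A"
  shows "kspace B"
proof -
  interpret A: kspace A by fact
  have "abelian_group B"
    by (rule abelian_groupI) (auto simp: eq A.a_ac intro: A.add.l_inv_ex)
  then show ?thesis
    by (rule kspace.intro, intro kspace_axioms.intro)
      (simp_all add: eq A.smult_l_distr A.smult_r_distr A.smult_assoc)
qed

lemma kalgebra_cong:
  fixes A :: "('k::field, 'a, 'm) module_scheme" and B :: "('k, 'a, 'n) module_scheme"
  assumes A: "kalgebra A" and eq: "carrier B = carrier A" "zero B = zero A" "add B = add A" "smult B = smult A"
    and eqm: "mult B = mult A" "one B = one A"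
  shows "kalgebra B"
proof -
  interpret A: kalgebra A by fact
  interpret B: kspace B by (rule kspace_cong[OF A.kspace_axioms eq])
  have "ring B"
    by (rule ringI[OF B.abelian_group_axioms], rule monoidI) (simp_all add: eq eqm A.m_assoc A.l_distr A.r_distr)
  then show ?thesis
    by (intro kalgebra.intro B.kspace_axioms kalgebra_axioms.intro) (simp_all add: eq eqm A.smult_mult_l A.smult_mult_r)
qed

lemma module_extend_simps [simp]:
  "carrier (module.extend A m) = carrier A" "mult (module.extend A m) = mult A"
  "one (module.extend A m) = one A" "zero (module.extend A m) = zero A"
  "add (module.extend A m) = add A" "smult (module.extend A m) = smult A"
  by (simp_all add: module.defs)

lemma hopf_extend_simps [simp]:
  "comult (module.extend A (hopf.fields c e s)) = c"
  "counit (module.extend A (hopf.fields c e s)) = e"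
  "antipode (module.extend A (hopf.fields c e s)) = s"
  by (simp_all add: module.defs hopf.defs)

lemma kspace_extend: "kspace A \<Longrightarrow> kspace (module.extend A m)"
  by (erule kspace_cong) simp_all

lemma kalgebra_extend: "kalgebra A \<Longrightarrow> kalgebra (module.extend A m)"
  by (erule kalgebra_cong) simp_all

lemma klin_extend [simp]:
  "klin (module.extend A m) B f = klin A B f" "klin B (module.extend A m) g = klin B A g"
  unfolding klin_def by simp_all

lemma DirProd_extend: "module.extend A m \<times>\<times> module.extend B m' = A \<times>\<times> B"
  unfolding DirProd_def by simp

lemma bilin_span_extend: "bilin_span (module.extend A m) (module.extend B m') = bilin_span A B"
  unfolding bilin_span_def bilin_relators_def by simp

lemma tensor_class_extend: "tensor_class (module.extend A m) (module.extend B m') = tensor_class A B"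
  unfolding tensor_class_def[abs_def] by (simp add: DirProd_extend bilin_span_extend)

lemma tensor_map_extend: "tensor_map (module.extend A m) (module.extend B m') = tensor_map A B"
  unfolding tensor_map_def[abs_def] by (simp add: tensor_class_extend)

text \<open>The coordinate forms are part of the data: \<open>coord_e\<close> makes the family
  independent and \<open>expand\<close> makes it spanning. This also provides the dual basis
  directly.\<close>

locale kbasis = kspace A for A :: "('k::field, 'a, 'm) module_scheme" (structure) +
  fixes e :: "'i \<Rightarrow> 'a" and coord :: "'i \<Rightarrow> 'a \<Rightarrow> 'k" and Ix :: "'i set"
  assumes finite_Ix: "finite Ix"
    and e_closed: "i \<in> Ix \<Longrightarrow> e i \<in> carrier A"
    and klin_coord: "i \<in> Ix \<Longrightarrow> klin A field_alg (coord i)"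
    and coord_e: "\<lbrakk>i \<in> Ix; j \<in> Ix\<rbrakk> \<Longrightarrow> coord i (e j) = (if i = j then 1 else 0)"
    and expand: "u \<in> carrier A \<Longrightarrow> u = (\<Oplus>i\<in>Ix. coord i u \<odot> e i)"
begin

lemma klin_expand:
  assumes B: "kspace B" and f: "klin A B f" and u: "u \<in> carrier A"
  shows "f u = finsum B (\<lambda>i. coord i u \<odot>\<^bsub>B\<^esub> f (e i)) Ix"
proof -
  interpret B: kspace B by fact
  have c: "(\<lambda>i. coord i u \<odot> e i) \<in> Ix \<rightarrow> carrier A" using e_closed by auto
  have "f u = f (\<Oplus>i\<in>Ix. coord i u \<odot> e i)" using expand[OF u] by simp
  also have "\<dots> = finsum B (\<lambda>i. f (coord i u \<odot> e i)) Ix"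
    by (rule klin_finsum[OF kspace_axioms B f finite_Ix c])
  also have "\<dots> = finsum B (\<lambda>i. coord i u \<odot>\<^bsub>B\<^esub> f (e i)) Ix"
    by (rule B.finsum_cong') (auto simp: klin_smult[OF f] e_closed klin_closed[OF f])
  finally show ?thesis .
qed

lemma klin_eq_on_basis:
  assumes B: "kspace B" and f: "klin A B f" and g: "klin A B g"
    and eq: "\<And>i. i \<in> Ix \<Longrightarrow> f (e i) = g (e i)" and u: "u \<in> carrier A"
  shows "f u = g u"
proof -
  interpret B: kspace B by fact
  show ?thesis
    unfolding klin_expand[OF B f u] klin_expand[OF B g u]
    by (rule B.finsum_cong') (auto simp: eq e_closed klin_closed[OF g])
qed

end

text \<open>Both sides are linear in t, so pure tensors suffice; for those, both sides are bilinear,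
  so pairs of basis vectors suffice, and there a single coefficient survives.\<close>

lemma tensor_expand:
  assumes U: "kbasis U e c I" and V: "kbasis V e' c' J" and t: "t \<in> carrier (tensor_alg U V)"
  shows "t = finsum (tensor_alg U V)
    (\<lambda>(i, j). tensor_eval (\<lambda>u v. c i u * c' j v) t \<odot>\<^bsub>tensor_alg U V\<^esub> pure_tensor U V (e i) (e' j)) (I \<times> J)"
    (is "t = ?R t")
proof -
  interpret U: kbasis U e c I by fact
  interpret V: kbasis V e' c' J by fact
  interpret tensor_pair U V ..
  have b: "kbilin U V field_alg (\<lambda>u v. c i u * c' j v)" if "i \<in> I" "j \<in> J" for i j
    by (rule kbilin_form_mult[OF U.klin_coord[OF that(1)] V.klin_coord[OF that(2)]])
  have lin: "klin T T ?R"
    by (rule klin_finsum_fun[OF T.kspace_axioms T.kspace_axioms])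
      (auto simp: U.finite_Ix V.finite_Ix U.e_closed V.e_closed intro!: klin_form_scale T.kspace_axioms klin_tensor_eval b)
  have id: "klin T T (\<lambda>t. t)" by (rule klinI) simp_all
  have pure: "?R (pt u v) = finsum T (\<lambda>(i, j). (c i u * c' j v) \<odot>\<^bsub>T\<^esub> pt (e i) (e' j)) (I \<times> J)"
    if "u \<in> carrier U" "v \<in> carrier V" for u v
    by (rule T.finsum_cong') (use that in \<open>auto simp: tensor_eval_pure[OF b] U.e_closed V.e_closed\<close>)
  have delta: "finsum T (\<lambda>(i, j). (c i (e k) * c' j (e' l)) \<odot>\<^bsub>T\<^esub> pt (e i) (e' j)) (I \<times> J) = pt (e k) (e' l)"
    if k: "k \<in> I" "l \<in> J" for k l
  proof -
    have "finsum T (\<lambda>(i, j). (c i (e k) * c' j (e' l)) \<odot>\<^bsub>T\<^esub> pt (e i) (e' j)) (I \<times> J)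
        = finsum T (\<lambda>p. if (k, l) = p then pt (e (fst p)) (e' (snd p)) else \<zero>\<^bsub>T\<^esub>) (I \<times> J)"
    proof (rule T.finsum_cong')
      fix p assume "p \<in> I \<times> J"
      then obtain i j where p: "p = (i, j)" "i \<in> I" "j \<in> J" by blast
      then show "(case p of (i, j) \<Rightarrow> (c i (e k) * c' j (e' l)) \<odot>\<^bsub>T\<^esub> pt (e i) (e' j))
          = (if (k, l) = p then pt (e (fst p)) (e' (snd p)) else \<zero>\<^bsub>T\<^esub>)"
        using k by (cases "i = k"; cases "j = l") (simp_all add: U.coord_e V.coord_e U.e_closed V.e_closed)
    qed (auto simp: U.e_closed V.e_closed)
    also have "\<dots> = pt (e (fst (k, l))) (e' (snd (k, l)))"
      by (rule T.finsum_singleton) (use k in \<open>auto simp: U.finite_Ix V.finite_Ix U.e_closed V.e_closed\<close>)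
    finally show ?thesis by simp
  qed
  show ?thesis
  proof (rule klin_tensor_eq[OF T.kspace_axioms id lin _ t])
    fix u v assume u: "u \<in> carrier U" and v: "v \<in> carrier V"
    let ?S = "\<lambda>u v. finsum T (\<lambda>(i, j). (c i u * c' j v) \<odot>\<^bsub>T\<^esub> pt (e i) (e' j)) (I \<times> J)"
    have l1: "klin U T (\<lambda>u. ?S u v)" if "v \<in> carrier V" for v
      by (rule klin_finsum_fun[OF T.kspace_axioms U.kspace_axioms])
        (auto simp: U.finite_Ix V.finite_Ix U.e_closed V.e_closed that intro!: klin_form_scale T.kspace_axioms
          kbilinD(1)[OF b])
    have l2: "klin V T (\<lambda>v. ?S u v)" if "u \<in> carrier U" for u
      by (rule klin_finsum_fun[OF T.kspace_axioms V.kspace_axioms])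
        (auto simp: U.finite_Ix V.finite_Ix U.e_closed V.e_closed that intro!: klin_form_scale T.kspace_axioms
          kbilinD(2)[OF b])
    have "pt u v = ?S u v"
    proof (rule U.klin_eq_on_basis[OF T.kspace_axioms kbilinD(1)[OF kbilin_pure_tensor v] l1[OF v] _ u])
      fix k assume k: "k \<in> I"
      show "pt (e k) v = ?S (e k) v"
        by (rule V.klin_eq_on_basis[OF T.kspace_axioms kbilinD(2)[OF kbilin_pure_tensor U.e_closed[OF k]] l2[OF U.e_closed[OF k]] _ v])
          (simp add: delta[OF k])
    qed
    then show "pt u v = ?R (pt u v)" unfolding pure[OF u v] .
  qed
qed

text \<open>Products of coordinate forms separate tensors; the uniqueness of the dual
  comultiplication comes from here.\<close>

lemma tensor_eqI:
  assumes U: "kbasis U e c I" and V: "kbasis V e' c' J"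
    and t: "t \<in> carrier (tensor_alg U V)" and t': "t' \<in> carrier (tensor_alg U V)"
    and eq: "\<And>i j. i \<in> I \<Longrightarrow> j \<in> J \<Longrightarrow> tensor_eval (\<lambda>u v. c i u * c' j v) t = tensor_eval (\<lambda>u v. c i u * c' j v) t'"
  shows "t = t'"
proof -
  interpret U: kbasis U e c I by fact
  interpret V: kbasis V e' c' J by fact
  interpret tensor_pair U V ..
  have "t = finsum T (\<lambda>(i, j). tensor_eval (\<lambda>u v. c i u * c' j v) t \<odot>\<^bsub>T\<^esub> pt (e i) (e' j)) (I \<times> J)"
    by (rule tensor_expand[OF U V t])
  also have "\<dots> = finsum T (\<lambda>(i, j). tensor_eval (\<lambda>u v. c i u * c' j v) t' \<odot>\<^bsub>T\<^esub> pt (e i) (e' j)) (I \<times> J)"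
    by (rule T.finsum_cong') (auto simp: eq U.e_closed V.e_closed)
  also have "\<dots> = t'" by (rule tensor_expand[OF U V t', symmetric])
  finally show ?thesis .
qed

section \<open>Linear forms and the dual Hopf algebra\<close>

lemma linear_forms_iff: "f \<in> linear_forms H \<longleftrightarrow> f \<in> extensional (carrier H) \<and> klin H field_alg f"
  unfolding linear_forms_def klin_def by auto

lemma dual_alg_simps [simp]:
  "carrier (dual_alg H) = linear_forms H"
  "mult (dual_alg H) = (\<lambda>f g. \<lambda>h\<in>carrier H. tensor_eval (\<lambda>u v. f u * g v) (comult H h))"
  "one (dual_alg H) = restrict (counit H) (carrier H)"
  "zero (dual_alg H) = (\<lambda>h\<in>carrier H. 0)"
  "add (dual_alg H) = (\<lambda>f g. \<lambda>h\<in>carrier H. f h + g h)"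
  "smult (dual_alg H) = (\<lambda>c f. \<lambda>h\<in>carrier H. c * f h)"
  unfolding dual_alg_def by simp_all

lemma linear_forms_eqI:
  "f \<in> linear_forms H \<Longrightarrow> g \<in> linear_forms H \<Longrightarrow> (\<And>u. u \<in> carrier H \<Longrightarrow> f u = g u) \<Longrightarrow> f = g"
  by (rule extensionalityI[of _ "carrier H"]) (auto simp: linear_forms_def)

lemma restrict_linear_forms:
  assumes "kspace H" "klin H field_alg f" shows "restrict f (carrier H) \<in> linear_forms H"
proof -
  interpret kspace H by fact
  show ?thesis unfolding linear_forms_iff
    by (auto intro: klin_cong[OF assms])
qed

lemma kspace_dual_alg:
  fixes H :: "('k::field, 'a) hopf"
  assumes H: "kspace H" shows "kspace (dual_alg H)"
proof -
  interpret H: kspace H by fact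
  have cl: "(\<lambda>h\<in>carrier H. f h + g h) \<in> linear_forms H" "(\<lambda>h\<in>carrier H. c * f h) \<in> linear_forms H"
    if "f \<in> linear_forms H" "g \<in> linear_forms H" for f g c
    using that by (auto intro!: restrict_linear_forms[OF H] klin_formI simp: linear_forms_iff
      klin_form_add klin_form_smult algebra_simps)
  have z: "(\<lambda>h\<in>carrier H. 0) \<in> linear_forms H"
    by (intro restrict_linear_forms[OF H] klin_formI) simp_all
  have e: "f u = undefined" if "f \<in> linear_forms H" "u \<notin> carrier H" for f u
    using that by (auto simp: linear_forms_def extensional_def)
  have "abelian_group (dual_alg H)"
  proof (rule abelian_groupI)
    fix f assume f: "f \<in> carrier (dual_alg H)"
    then show "\<exists>g\<in>carrier (dual_alg H). g \<oplus>\<^bsub>dual_alg H\<^esub> f = \<zero>\<^bsub>dual_alg H\<^esub>"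
      using cl(2)[of f f "- 1"] by (intro bexI[of _ "\<lambda>h\<in>carrier H. - f h"]) auto
  qed (auto simp: cl z e fun_eq_iff)
  then show ?thesis
    by (rule kspace.intro, intro kspace_axioms.intro)
      (auto simp: cl e fun_eq_iff algebra_simps)
qed

lemma klin_dual_eval: "u \<in> carrier H \<Longrightarrow> klin (dual_alg H) field_alg (\<lambda>f. f u)"
  by (rule klin_formI) simp_all

locale hopf_basis = kbasis H e coord Ix + kalgebra H
  for H :: "('k::field, 'a) hopf" (structure) and e :: "'i \<Rightarrow> 'a" and coord Ix
begin

abbreviation "D \<equiv> dual_alg H"
abbreviation "edual i \<equiv> restrict (coord i) (carrier H)"

text \<open>The coefficient of a form f at the dual basis vector with index i is its value at
  \<open>e i\<close>, so evaluations serve as coordinates.\<close>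

lemma kbasis_dual: "kbasis D edual (\<lambda>i f. f (e i)) Ix"
proof -
  interpret D: kspace D by (rule kspace_dual_alg[OF kspace_axioms])
  have ed: "edual i \<in> linear_forms H" if "i \<in> Ix" for i
    by (rule restrict_linear_forms[OF kspace_axioms klin_coord[OF that]])
  have expand: "f = finsum D (\<lambda>i. f (e i) \<odot>\<^bsub>D\<^esub> edual i) Ix" if f: "f \<in> carrier D" for f
  proof (rule linear_forms_eqI[of _ H])
    have c: "(\<lambda>i. f (e i) \<odot>\<^bsub>D\<^esub> edual i) \<in> Ix \<rightarrow> carrier D"
      using ed by (intro Pi_I D.smult_closed) simp
    show "f \<in> linear_forms H" "finsum D (\<lambda>i. f (e i) \<odot>\<^bsub>D\<^esub> edual i) Ix \<in> linear_forms H"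
      using f D.finsum_closed[OF c] by simp_all
    fix u assume u: "u \<in> carrier H"
    have "finsum D (\<lambda>i. f (e i) \<odot>\<^bsub>D\<^esub> edual i) Ix u = (\<Sum>i\<in>Ix. (f (e i) \<odot>\<^bsub>D\<^esub> edual i) u)"
      using klin_finsum[OF D.kspace_axioms kspace_field_alg klin_dual_eval[OF u] finite_Ix c] by simp
    also have "\<dots> = (\<Sum>i\<in>Ix. coord i u * f (e i))" using u by (intro sum.cong) auto
    also have "\<dots> = f u" using klin_expand[OF kspace_field_alg _ u, of f] f by (simp add: linear_forms_iff)
    finally show "f u = finsum D (\<lambda>i. f (e i) \<odot>\<^bsub>D\<^esub> edual i) Ix u" ..
  qed
  show ?thesis
    by (intro kbasis.intro D.kspace_axioms kbasis_axioms.intro)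
      (use ed expand in \<open>auto simp: finite_Ix klin_dual_eval e_closed coord_e\<close>)
qed

sublocale D: kbasis D edual "\<lambda>i f. f (e i)" Ix by (rule kbasis_dual)
sublocale DD: tensor_pair D D ..

lemma kbilin_eval2: "u \<in> carrier H \<Longrightarrow> v \<in> carrier H \<Longrightarrow> kbilin D D field_alg (\<lambda>g g'. g u * g' v)"
  by (intro kbilin_form_mult klin_dual_eval)

text \<open>In finite dimension the tensor square of the dual is the dual of the tensor square, so
  the form (u, v) mapped to f(uv) comes from exactly one tensor.\<close>

lemma dual_comult_ex1:
  assumes f: "f \<in> linear_forms H"
  shows "\<exists>!t. t \<in> carrier (tensor_alg D D) \<and>
    (\<forall>u\<in>carrier H. \<forall>v\<in>carrier H. tensor_eval (\<lambda>g g'. g u * g' v) t = f (u \<otimes> v))"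
proof (rule ex_ex1I)
  \<comment> \<open>The coefficients are those of the bilinear form f(uv) on pairs of basis
    vectors.\<close>
  let ?t = "finsum DD.T (\<lambda>(i, j). f (e i \<otimes> e j) \<odot>\<^bsub>DD.T\<^esub> DD.pt (edual i) (edual j)) (Ix \<times> Ix)"
  have c: "(\<lambda>(i, j). f (e i \<otimes> e j) \<odot>\<^bsub>DD.T\<^esub> DD.pt (edual i) (edual j)) \<in> Ix \<times> Ix \<rightarrow> carrier DD.T"
    by (auto intro!: DD.T.smult_closed DD.pure_tensor_closed D.e_closed simp del: dual_alg_simps)
  have fl: "klin H field_alg f" using f by (simp add: linear_forms_iff)
  have "tensor_eval (\<lambda>g g'. g u * g' v) ?t = f (u \<otimes> v)" if u: "u \<in> carrier H" and v: "v \<in> carrier H" for u v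
  proof -
    note b = kbilin_eval2[OF u v]
    have "tensor_eval (\<lambda>g g'. g u * g' v) ?t =
      (\<Sum>p\<in>Ix \<times> Ix. tensor_eval (\<lambda>g g'. g u * g' v) (case p of (i, j) \<Rightarrow> f (e i \<otimes> e j) \<odot>\<^bsub>DD.T\<^esub> DD.pt (edual i) (edual j)))"
      using klin_finsum[OF DD.T.kspace_axioms kspace_field_alg DD.klin_tensor_eval[OF b] _ c] finite_Ix by simp
    also have "\<dots> = (\<Sum>p\<in>Ix \<times> Ix. case p of (i, j) \<Rightarrow> f (e i \<otimes> e j) * (coord i u * coord j v))"
    proof (rule sum.cong[OF refl], clarify)
      fix i j assume "i \<in> Ix" "j \<in> Ix"
      then have "edual i \<in> carrier D" "edual j \<in> carrier D" by (auto intro: D.e_closed simp del: dual_alg_simps)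
      then show "tensor_eval (\<lambda>g g'. g u * g' v) (f (e i \<otimes> e j) \<odot>\<^bsub>DD.T\<^esub> DD.pt (edual i) (edual j))
        = f (e i \<otimes> e j) * (coord i u * coord j v)"
        by (subst klin_form_smult[OF DD.klin_tensor_eval[OF b]])
          (use u v in \<open>simp_all add: DD.tensor_eval_pure[OF b] del: dual_alg_simps\<close>)
    qed
    \<comment> \<open>The double sum is folded up one argument at a time: first v is recovered from
      its coordinates, then u.\<close>
    also have "\<dots> = (\<Sum>i\<in>Ix. coord i u * (\<Sum>j\<in>Ix. coord j v * f (e i \<otimes> e j)))"
      by (simp add: sum.cartesian_product[symmetric] sum_distrib_left mult.assoc mult.left_commute mult.commute)
    also have "\<dots> = (\<Sum>i\<in>Ix. coord i u * f (e i \<otimes> v))"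
    proof (rule sum.cong[OF refl])
      fix i assume i: "i \<in> Ix"
      have "klin H field_alg (\<lambda>v. f (e i \<otimes> v))"
        using e_closed[OF i] by (intro klin_formI) (simp_all add: r_distr smult_mult_r klin_form_add[OF fl] klin_form_smult[OF fl])
      from klin_expand[OF kspace_field_alg this v]
      show "coord i u * (\<Sum>j\<in>Ix. coord j v * f (e i \<otimes> e j)) = coord i u * f (e i \<otimes> v)" by simp
    qed
    also have "\<dots> = f (u \<otimes> v)"
    proof -
      have "klin H field_alg (\<lambda>u. f (u \<otimes> v))"
        using v by (intro klin_formI) (simp_all add: l_distr smult_mult_l klin_form_add[OF fl] klin_form_smult[OF fl])
      from klin_expand[OF kspace_field_alg this u] show ?thesis by simp
    qed
    finally show ?thesis .
  qed
  then show "\<exists>t. t \<in> carrier DD.T \<and>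
      (\<forall>u\<in>carrier H. \<forall>v\<in>carrier H. tensor_eval (\<lambda>g g'. g u * g' v) t = f (u \<otimes> v))"
    using DD.T.finsum_closed[OF c] by blast
next
  fix t t'
  assume "t \<in> carrier DD.T \<and> (\<forall>u\<in>carrier H. \<forall>v\<in>carrier H. tensor_eval (\<lambda>g g'. g u * g' v) t = f (u \<otimes> v))"
    and "t' \<in> carrier DD.T \<and> (\<forall>u\<in>carrier H. \<forall>v\<in>carrier H. tensor_eval (\<lambda>g g'. g u * g' v) t' = f (u \<otimes> v))"
  then show "t = t'"
    by (intro tensor_eqI[OF kbasis_dual kbasis_dual, of t t']) (auto simp: e_closed)
qed

lemma dual_hopf_simps [simp]:
  "carrier (dual_hopf H) = carrier D" "mult (dual_hopf H) = mult D" "one (dual_hopf H) = one D"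
  "zero (dual_hopf H) = zero D" "add (dual_hopf H) = add D" "smult (dual_hopf H) = smult D"
  "counit (dual_hopf H) = (\<lambda>f. f \<one>)"
  "antipode (dual_hopf H) = (\<lambda>f. \<lambda>h\<in>carrier H. f (antipode H h))"
  unfolding dual_hopf_def by simp_all

lemma klin_dual_hopf: "klin A (dual_hopf H) f = klin A D f"
  unfolding klin_def by simp

lemma tensor_map_dual_hopf: "tensor_map (dual_hopf H) (dual_hopf H) = tensor_map D D"
  unfolding dual_hopf_def by (rule tensor_map_extend)

text \<open>It trades the definite description for an identity of values, in a form usable both to
  extract and to verify compatibility with the comultiplication.\<close>

lemma comult_dual_eq_iff:
  assumes f: "f \<in> linear_forms H" and t: "t \<in> carrier (tensor_alg D D)"
  shows "comult (dual_hopf H) f = t \<longleftrightarrow>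
    (\<forall>u\<in>carrier H. \<forall>v\<in>carrier H. tensor_eval (\<lambda>g g'. g u * g' v) t = f (u \<otimes> v))"
proof -
  note ex = dual_comult_ex1[OF f]
  have c: "comult (dual_hopf H) f = (THE t. t \<in> carrier DD.T \<and>
    (\<forall>u\<in>carrier H. \<forall>v\<in>carrier H. tensor_eval (\<lambda>g g'. g u * g' v) t = f (u \<otimes> v)))"
    unfolding dual_hopf_def by simp
  show ?thesis
  proof
    assume "comult (dual_hopf H) f = t"
    then show "\<forall>u\<in>carrier H. \<forall>v\<in>carrier H. tensor_eval (\<lambda>g g'. g u * g' v) t = f (u \<otimes> v)"
      using theI'[OF ex] unfolding c by blast
  next
    assume "\<forall>u\<in>carrier H. \<forall>v\<in>carrier H. tensor_eval (\<lambda>g g'. g u * g' v) t = f (u \<otimes> v)"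
    then show "comult (dual_hopf H) f = t" unfolding c using t by (intro the1_equality[OF ex] conjI)
  qed
qed

end

section \<open>Gaussian binomials and roots of unity\<close>

text \<open>The q-integer 1 + z + ... + z^(j-1), in Horner form.\<close>

primrec qint :: "'k::field \<Rightarrow> nat \<Rightarrow> 'k" where
  "qint z 0 = 0"
| "qint z (Suc j) = 1 + z * qint z j"

primrec qfact :: "'k::field \<Rightarrow> nat \<Rightarrow> 'k" where
  "qfact z 0 = 1"
| "qfact z (Suc j) = qint z (Suc j) * qfact z j"

text \<open>The Gaussian binomial coefficient, given by the Pascal rule that the expansion of (P +
  Q)^m produces when Q P = z P Q. A quotient of factorials would not do at roots of unity, where
  factorials vanish.\<close>

fun gauss :: "'k::field \<Rightarrow> nat \<Rightarrow> nat \<Rightarrow> 'k" where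
  "gauss z m 0 = 1"
| "gauss z 0 (Suc j) = 0"
| "gauss z (Suc m) (Suc j) = gauss z m j + z ^ Suc j * gauss z m (Suc j)"

lemma gauss_eq_0: "m < j \<Longrightarrow> gauss z m j = 0"
  by (induction z m j rule: gauss.induct) auto

lemma gauss_self [simp]: "gauss z m m = 1"
  by (induction m) (auto simp: gauss_eq_0)

text \<open>The absorption identity for binomials; it replaces the factorial formula without
  dividing. The induction uses the hypothesis at j and at j - 1 and then recombines the Pascal
  rule.\<close>

lemma gauss_qint: "gauss z (Suc m) (Suc j) * qint z (Suc j) = qint z (Suc m) * gauss z m j"
proof (induction m arbitrary: j)
  case 0
  then show ?case by (cases j) auto
next
  case (Suc m)
  show ?case
  proof (cases j)
    case 0
    then show ?thesis using Suc[of 0] by (simp add: algebra_simps)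
  next
    case j: (Suc i)
    let ?G = "gauss z (Suc m) (Suc i)"
    have G: "?G = gauss z m i + z ^ Suc i * gauss z m (Suc i)" by simp
    have "gauss z (Suc (Suc m)) (Suc j) * qint z (Suc j)
        = ?G * (1 + z * qint z (Suc i)) + z ^ Suc j * (gauss z (Suc m) (Suc j) * qint z (Suc j))"
      unfolding j gauss.simps(3)[of z "Suc m" "Suc i"] qint.simps(2)[of z "Suc i"] by (simp only: distrib_right mult.assoc)
    also have "\<dots> = ?G + z * (?G * qint z (Suc i)) + z ^ Suc j * (qint z (Suc m) * gauss z m j)"
      unfolding Suc.IH[of j] by (simp only: distrib_left mult_1_right mult.left_commute)
    also have "\<dots> = ?G + z * qint z (Suc m) * (gauss z m i + z ^ Suc i * gauss z m (Suc i))"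
      unfolding j by (simp only: Suc.IH[of i] distrib_left power_Suc mult.assoc mult.left_commute add.assoc)
    also have "\<dots> = qint z (Suc (Suc m)) * gauss z (Suc m) j"
      unfolding G[symmetric] j by (simp only: qint.simps(2)[of z "Suc m"] distrib_right mult_1_left)
    finally show ?thesis .
  qed
qed

text \<open>Iterated absorption. This is exactly what makes the factorial weights of the pairing
  compatible with products.\<close>

lemma qfact_add: "qfact z (i + j) = gauss z (i + j) i * qfact z i * qfact z j"
proof (induction i)
  case (Suc i)
  have "qfact z (Suc i + j) = (qint z (Suc (i + j)) * gauss z (i + j) i) * qfact z i * qfact z j"
    using Suc by simp
  also have "\<dots> = gauss z (Suc (i + j)) (Suc i) * qint z (Suc i) * qfact z i * qfact z j"
    by (simp only: gauss_qint)
  finally show ?case by (simp add: mult.assoc)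
qed simp

lemma qint_geometric: "(1 - z) * qint z j = 1 - z ^ j"
proof (induction j)
  case (Suc j)
  have "(1 - z) * qint z (Suc j) = (1 - z) + z * ((1 - z) * qint z j)" by (simp add: algebra_simps)
  then show ?case unfolding Suc by (simp add: algebra_simps)
qed simp

lemma qint_nonzero: "z ^ j \<noteq> 1 \<Longrightarrow> qint z j \<noteq> 0"
  using qint_geometric[of z j] by auto

text \<open>The q-integers with index strictly between 0 and r are nonzero while the one with index
  r vanishes; absorption passes that zero on to the inner binomials.\<close>

lemma
  assumes "primitive_root_of_unity r z"
  shows qfact_nonzero: "j < r \<Longrightarrow> qfact z j \<noteq> 0"
    and gauss_root_of_unity: "0 < j \<Longrightarrow> j < r \<Longrightarrow> gauss z r j = 0"
proof -
  have r: "0 < r" "z ^ r = 1" "\<And>j. 0 < j \<Longrightarrow> j < r \<Longrightarrow> z ^ j \<noteq> 1"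
    using assms by (auto simp: primitive_root_of_unity_def)
  show "j < r \<Longrightarrow> qfact z j \<noteq> 0"
  proof (induction j)
    case (Suc j)
    then show ?case using qint_nonzero[OF r(3)[of "Suc j"]] by simp
  qed simp
  assume j: "0 < j" "j < r"
  have "z \<noteq> 1" using r(3)[of 1] j by auto
  then have "qint z r = 0" using qint_geometric[of z r] r by simp
  moreover obtain i m where "j = Suc i" "r = Suc m" using j by (metis Suc_pred gr_implies_not0 neq0_conv)
  ultimately have "gauss z r j * qint z j = 0" using gauss_qint[of z m i] by simp
  then show "gauss z r j = 0" using qint_nonzero[OF r(3)[OF j]] by simp
qed

section \<open>Powers of a sum of two skew-commuting elements\<close>

lemma (in kalgebra) nat_pow_smult:
  "u \<in> carrier A \<Longrightarrow> (c \<odot> u) [^] (m::nat) = c ^ m \<odot> (u [^] m)"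
  by (induction m) (simp_all add: smult_mult_l smult_mult_r smult_assoc[symmetric] mult.commute)

lemma (in kalgebra) nat_pow_skew_commute:
  assumes P: "P \<in> carrier A" and Q: "Q \<in> carrier A" and QP: "Q \<otimes> P = z \<odot> (P \<otimes> Q)"
  shows "Q [^] (m::nat) \<otimes> P [^] (j::nat) = z ^ (m * j) \<odot> (P [^] j \<otimes> Q [^] m)"
proof -
  have 1: "Q \<otimes> P [^] j = z ^ j \<odot> (P [^] j \<otimes> Q)" for j :: nat
  proof (induction j)
    case (Suc j)
    have "Q \<otimes> P [^] Suc j = z ^ j \<odot> (P [^] j \<otimes> Q) \<otimes> P"
      using P Q by (simp add: m_assoc[symmetric] Suc)
    also have "\<dots> = z ^ j \<odot> (P [^] j \<otimes> (z \<odot> (P \<otimes> Q)))"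
      using P Q by (simp add: smult_mult_l m_assoc QP)
    also have "\<dots> = z ^ Suc j \<odot> (P [^] Suc j \<otimes> Q)"
      using P Q by (simp add: smult_mult_r smult_assoc[symmetric] m_assoc mult.commute)
    finally show ?case .
  qed (use P Q in simp)
  show ?thesis
  proof (induction m)
    case (Suc m)
    have "Q [^] Suc m \<otimes> P [^] j = Q [^] m \<otimes> (Q \<otimes> P [^] j)" using P Q by (simp add: m_assoc)
    also have "\<dots> = z ^ j \<odot> (Q [^] m \<otimes> P [^] j \<otimes> Q)"
      using P Q by (simp add: 1 smult_mult_r m_assoc)
    also have "\<dots> = z ^ (Suc m * j) \<odot> (P [^] j \<otimes> Q [^] Suc m)"
      using P Q by (simp add: Suc smult_mult_l smult_assoc[symmetric] m_assoc power_add)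
    finally show ?case .
  qed (use P Q in simp)
qed

text \<open>One more factor P + Q is multiplied on from the left. Moving Q through P^j costs z^j,
  which is the weight in the Pascal rule of \<open>gauss\<close>.\<close>

lemma (in kalgebra) skew_binomial:
  assumes P: "P \<in> carrier A" and Q: "Q \<in> carrier A" and QP: "Q \<otimes> P = z \<odot> (P \<otimes> Q)"
  shows "(P \<oplus> Q) [^] (m::nat) = (\<Oplus>j\<in>{..m}. gauss z m j \<odot> (P [^] j \<otimes> Q [^] (m - j)))"
proof (induction m)
  case 0
  then show ?case using P Q by simp
next
  case (Suc m)
  let ?t = "\<lambda>j. gauss z m j \<odot> (P [^] j \<otimes> Q [^] (m - j))"
  let ?p = "\<lambda>j. gauss z m j \<odot> (P [^] Suc j \<otimes> Q [^] (m - j))"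
  let ?q = "\<lambda>j. (z ^ j * gauss z m j) \<odot> (P [^] j \<otimes> Q [^] (Suc m - j))"
  have "(P \<oplus> Q) [^] Suc m = (P \<oplus> Q) \<otimes> (\<Oplus>j\<in>{..m}. ?t j)"
    using nat_pow_Suc2[of "P \<oplus> Q" m] P Q by (simp only: Suc[symmetric] a_closed)
  also have "\<dots> = (\<Oplus>j\<in>{..m}. P \<otimes> ?t j) \<oplus> (\<Oplus>j\<in>{..m}. Q \<otimes> ?t j)"
    using P Q by (simp add: l_distr finsum_rdistr)
  also have "(\<Oplus>j\<in>{..m}. P \<otimes> ?t j) = (\<Oplus>j\<in>{..m}. ?p j)"
  proof (rule finsum_cong')
    fix j show "P \<otimes> ?t j = ?p j"
      using P Q nat_pow_Suc2[OF P, of j] by (simp add: smult_mult_r m_assoc[symmetric] del: nat_pow_Suc)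
  qed (use P Q in auto)
  also have "(\<Oplus>j\<in>{..m}. Q \<otimes> ?t j) = (\<Oplus>j\<in>{..m}. ?q j)"
  proof (rule finsum_cong')
    fix j assume j: "j \<in> {..m}"
    have "Q \<otimes> ?t j = gauss z m j \<odot> (Q \<otimes> P [^] j \<otimes> Q [^] (m - j))"
      using P Q by (simp add: smult_mult_r m_assoc)
    also have "\<dots> = gauss z m j \<odot> (z ^ j \<odot> (P [^] j \<otimes> (Q \<otimes> Q [^] (m - j))))"
      using nat_pow_skew_commute[OF P Q QP, of 1 j] P Q by (simp add: smult_mult_l m_assoc)
    also have "Q \<otimes> Q [^] (m - j) = Q [^] (Suc m - j)"
      using nat_pow_Suc2[OF Q, of "m - j"] j by (simp add: Suc_diff_le)
    finally show "Q \<otimes> ?t j = ?q j" using P Q by (simp add: smult_assoc[symmetric] mult.commute)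
  qed (use P Q in auto)
  \<comment> \<open>The added top term is zero; with it the sum can be split at index 0 and shifted
    by one to align with the sum of the \<open>?p j\<close>.\<close>
  also have "(\<Oplus>j\<in>{..m}. ?q j) = (\<Oplus>j\<in>{..Suc m}. ?q j)"
    using P Q by (simp add: gauss_eq_0)
  also have "\<dots> = (\<Oplus>j\<in>{..m}. ?q (Suc j)) \<oplus> ?q 0"
    using P Q by (intro finsum_Suc2) auto
  also have "(\<Oplus>j\<in>{..m}. ?p j) \<oplus> ((\<Oplus>j\<in>{..m}. ?q (Suc j)) \<oplus> ?q 0)
      = (\<Oplus>j\<in>{..m}. ?p j \<oplus> ?q (Suc j)) \<oplus> ?q 0"
    using P Q by (simp add: finsum_addf a_assoc)
  also have "(\<Oplus>j\<in>{..m}. ?p j \<oplus> ?q (Suc j))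
      = (\<Oplus>j\<in>{..m}. gauss z (Suc m) (Suc j) \<odot> (P [^] Suc j \<otimes> Q [^] (Suc m - Suc j)))"
    using P Q by (intro finsum_cong') (auto simp: smult_l_distr)
  also have "\<dots> \<oplus> ?q 0 = (\<Oplus>j\<in>{..Suc m}. gauss z (Suc m) j \<odot> (P [^] j \<otimes> Q [^] (Suc m - j)))"
    using P Q by (subst finsum_Suc2) auto
  finally show ?case .
qed

text \<open>All inner Gaussian binomials vanish. This is why \<Delta> respects the relation on the
  rth power of x.\<close>

lemma (in kalgebra) skew_power_root_of_unity:
  assumes P: "P \<in> carrier A" and Q: "Q \<in> carrier A" and QP: "Q \<otimes> P = z \<odot> (P \<otimes> Q)"
    and z: "primitive_root_of_unity r z"
  shows "(P \<oplus> Q) [^] r = P [^] r \<oplus> Q [^] r"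
proof -
  obtain m where r: "r = Suc m" using z by (metis primitive_root_of_unity_def not0_implies_Suc neq0_conv)
  let ?t = "\<lambda>j. gauss z r j \<odot> (P [^] j \<otimes> Q [^] (r - j))"
  have t: "?t j \<in> carrier A" for j using P Q by simp
  have "(\<Oplus>j\<in>{..m}. ?t j) = (\<Oplus>j\<in>{..m}. if 0 = j then ?t j else \<zero>)"
    using P Q by (intro finsum_cong') (auto simp: gauss_root_of_unity[OF z[unfolded r]] r simp del: gauss.simps(3))
  also have "\<dots> = ?t 0" using t by (intro finsum_singleton) auto
  finally have "(\<Oplus>j\<in>{..m}. ?t j) = Q [^] r" using Q by simp
  moreover have "(P \<oplus> Q) [^] r = ?t r \<oplus> (\<Oplus>j\<in>{..m}. ?t j)"
    unfolding skew_binomial[OF P Q QP, of r] using t r by simp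
  ultimately show ?thesis using P by simp
qed

section \<open>Roots of unity and orthogonality of characters\<close>

lemma mult_order_primitive:
  fixes z :: "'k::field"
  assumes "0 < n" "z ^ n = 1"
  shows "primitive_root_of_unity (mult_order z) z"
proof -
  have "0 < mult_order z \<and> z ^ mult_order z = 1"
    unfolding mult_order_def by (rule LeastI[of _ n]) (use assms in simp)
  moreover have "z ^ j \<noteq> 1" if "0 < j" "j < mult_order z" for j
    using not_less_Least[OF that(2)[unfolded mult_order_def]] that(1) by simp
  ultimately show ?thesis by (simp add: primitive_root_of_unity_def)
qed

lemma primitive_root_nonzero: "primitive_root_of_unity N w \<Longrightarrow> w \<noteq> 0"
  by (auto simp: primitive_root_of_unity_def zero_power)

lemma primitive_root_pow_eq_1_iff:
  assumes "primitive_root_of_unity N (w::'k::field)" shows "w ^ m = 1 \<longleftrightarrow> N dvd m"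
proof -
  have N: "0 < N" "w ^ N = 1" "\<And>j. 0 < j \<Longrightarrow> j < N \<Longrightarrow> w ^ j \<noteq> 1"
    using assms by (auto simp: primitive_root_of_unity_def)
  have "w ^ m = w ^ (N * (m div N) + m mod N)" by simp
  also have "\<dots> = w ^ (m mod N)" by (simp only: power_add power_mult N power_one mult_1)
  finally have "w ^ m = w ^ (m mod N)" .
  then show ?thesis using N(3)[of "m mod N"] mod_less_divisor[OF N(1), of m] by (cases "m mod N = 0") (auto simp: dvd_eq_mod_eq_0)
qed

lemma primitive_root_sum:
  assumes w: "primitive_root_of_unity N (w::'k::field)" and ij: "i < N" "j < N"
  shows "(\<Sum>l<N. w ^ (i * l) * inverse w ^ (j * l)) = (if i = j then of_nat N else 0)"
proof -
  have w0: "w \<noteq> 0" by (rule primitive_root_nonzero[OF w])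
  let ?z = "w ^ i * inverse w ^ j"
  have "(\<Sum>l<N. w ^ (i * l) * inverse w ^ (j * l)) = (\<Sum>l<N. ?z ^ l)"
    by (simp add: power_mult power_mult_distrib)
  also have "\<dots> = (if i = j then of_nat N else 0)"
  proof (cases "i = j")
    case True
    then have "?z = 1" using w0 by (simp add: power_mult_distrib[symmetric])
    then show ?thesis using True by simp
  next
    case False
    have "?z \<noteq> 1"
    proof
      assume "?z = 1"
      then have e: "w ^ i = w ^ j" using w0 by (simp add: field_simps)
      \<comment> \<open>Taking the larger index minus the smaller handles both orders of i and j at
        once.\<close>
      have "w ^ (max i j - min i j) = 1"
        using e w0 by (simp add: power_diff max_def min_def)
      then have "N dvd max i j - min i j" using primitive_root_pow_eq_1_iff[OF w] by blast
      then show False using False ij by (auto simp: max_def min_def split: if_splits dest!: dvd_imp_le)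
    qed
    moreover have "?z ^ N = 1"
    proof -
      have "?z ^ N = (w ^ N) ^ i * (inverse w ^ N) ^ j"
        by (simp add: power_mult_distrib power_mult[symmetric] mult.commute)
      then show ?thesis using w by (simp add: primitive_root_of_unity_def power_inverse)
    qed
    ultimately show ?thesis using False by (simp add: geometric_sum)
  qed
  finally show ?thesis .
qed

text \<open>The polynomial 1 + t + ... + t^(N-1) vanishes at the nontrivial powers of w. If N were
  zero in the field it would vanish at 1 too, giving N distinct roots in degree below N.\<close>

lemma primitive_root_of_nat_nonzero:
  assumes w: "primitive_root_of_unity N (w::'k::field)" shows "of_nat N \<noteq> (0::'k)"
proof
  assume 0: "of_nat N = (0::'k)"
  have N: "0 < N" "w ^ N = 1" using w by (auto simp: primitive_root_of_unity_def)
  define p :: "'k poly" where "p = (\<Sum>l<N. monom 1 l)"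
  have c: "coeff p k = (if k < N then 1 else 0)" for k
    unfolding p_def coeff_sum by (simp add: if_distrib sum.delta cong: if_cong)
  have "p \<noteq> 0" using c[of 0] N by auto
  moreover have "degree p < N"
    using N c by (metis leading_coeff_0_iff calculation)
  moreover have "poly p (w ^ i) = 0" if "i < N" for i
    using primitive_root_sum[OF w that N(1)] 0
    by (simp add: p_def poly_sum poly_monom power_mult split: if_splits)
  then have "(\<lambda>i. w ^ i) ` {..<N} \<subseteq> {x. poly p x = 0}" by auto
  moreover have "inj_on (\<lambda>i. w ^ i) {..<N}"
  proof (rule linorder_inj_onI)
    fix i j assume ij: "i < j" "i \<in> {..<N}" "j \<in> {..<N}"
    show "w ^ i \<noteq> w ^ j"
    proof
      assume "w ^ i = w ^ j"
      then have "w ^ (j - i) = 1" using ij primitive_root_nonzero[OF w] by (simp add: power_diff)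
      then show False using ij w by (auto simp: primitive_root_of_unity_def)
    qed
  qed auto
  ultimately have "N \<le> degree p"
    using card_mono[OF poly_roots_finite[of p]] card_poly_roots_bound[of p] card_image
    by (metis card_lessThan order_trans)
  with \<open>degree p < N\<close> show False by simp
qed

section \<open>The algebras \<open>\<H>\<^sub>\<alpha>\<close>\<close>

text \<open>Linear operators on all functions from \<open>'i\<close> to the field, the target of the
  representation that proves the monomials independent. Functions on a whole type need no carrier or
  extensionality conditions.\<close>

definition end_alg :: "('k::field, ('i \<Rightarrow> 'k) \<Rightarrow> 'i \<Rightarrow> 'k) module" where
  "end_alg = \<lparr>carrier = {T. (\<forall>f g. T (\<lambda>i. f i + g i) = (\<lambda>i. T f i + T g i)) \<and>
       (\<forall>c f. T (\<lambda>i. c * f i) = (\<lambda>i. c * T f i))},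
     mult = (\<circ>), one = id, zero = (\<lambda>f i. 0), add = (\<lambda>S T f i. S f i + T f i),
     smult = (\<lambda>c T f i. c * T f i)\<rparr>"

lemma end_alg_simps [simp]:
  "mult end_alg = (\<circ>)" "one end_alg = id" "zero end_alg = (\<lambda>f i. 0)"
  "add end_alg = (\<lambda>S T f i. S f i + T f i)" "smult end_alg = (\<lambda>c T f i. c * T f i)"
  by (simp_all add: end_alg_def)

lemma mem_end_alg: "T \<in> carrier end_alg \<longleftrightarrow> (\<forall>f g. T (\<lambda>i. f i + g i) = (\<lambda>i. T f i + T g i)) \<and>
       (\<forall>c f. T (\<lambda>i. c * f i) = (\<lambda>i. c * T f i))"
  by (simp add: end_alg_def)

lemma kalgebra_end_alg: "kalgebra (end_alg :: ('k::field, ('i \<Rightarrow> 'k) \<Rightarrow> 'i \<Rightarrow> 'k) module)"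
proof -
  have ab: "abelian_group (end_alg :: ('k::field, ('i \<Rightarrow> 'k) \<Rightarrow> 'i \<Rightarrow> 'k) module)"
  proof (rule abelian_groupI)
    fix T :: "('i \<Rightarrow> 'k) \<Rightarrow> 'i \<Rightarrow> 'k" assume "T \<in> carrier end_alg"
    then show "\<exists>S\<in>carrier end_alg. S \<oplus>\<^bsub>end_alg\<^esub> T = \<zero>\<^bsub>end_alg\<^esub>"
      by (intro bexI[of _ "\<lambda>f i. - T f i"]) (auto simp: mem_end_alg)
  qed (auto simp: mem_end_alg algebra_simps)
  have "ring (end_alg :: ('k::field, ('i \<Rightarrow> 'k) \<Rightarrow> 'i \<Rightarrow> 'k) module)"
    by (rule ringI[OF ab], rule monoidI) (auto simp: mem_end_alg o_assoc comp_def)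
  with ab show ?thesis
    by (intro kalgebra.intro kspace.intro kspace_axioms.intro kalgebra_axioms.intro)
      (auto simp: mem_end_alg algebra_simps fun_eq_iff)
qed

lemma end_alg_nat_pow: "T [^]\<^bsub>end_alg\<^esub> (m::nat) = T ^^ m"
  by (induction m) (simp_all add: nat_pow_def funpow_swap1 fun_eq_iff)

text \<open>If \<open>\<alpha> \<noteq> 0\<close> then \<open>q\<^sup>\<nu>\<close> has order \<open>n\<close>, so that in all cases the relation on powers of \<open>x\<close> is
  \<open>x\<^sup>r = \<alpha>(a\<^sup>\<nu>\<^sup>r - 1)\<close>.\<close>

locale H_params =
  fixes n :: nat and q :: "'k::field" and N \<nu> :: nat and \<alpha> :: 'k
  assumes n_pos: "0 < n" and N_pos: "0 < N" and n_dvd_N: "n dvd N" and q_pow_n: "q ^ n = 1"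
    and order_nonzero: "\<alpha> \<noteq> 0 \<Longrightarrow> mult_order (q ^ \<nu>) = n"
begin

definition "r = mult_order (q ^ \<nu>)"
abbreviation "J \<equiv> Idl\<^bsub>free_alg\<^esub> (H_relators n q N \<nu> \<alpha>)"
abbreviation "A \<equiv> H_alg n q N \<nu> \<alpha>"
abbreviation "a \<equiv> H_a n q N \<nu> \<alpha>"
abbreviation "x \<equiv> H_x n q N \<nu> \<alpha>"
abbreviation smult_A (infixl \<open>*\<^sub>A\<close> 70) where "c *\<^sub>A u \<equiv> c \<odot>\<^bsub>A\<^esub> u"
abbreviation mult_A (infixl \<open>\<bullet>\<close> 70) where "u \<bullet> v \<equiv> u \<otimes>\<^bsub>A\<^esub> v"
abbreviation pow_A (infixr \<open>\<up>\<close> 75) where "u \<up> m \<equiv> u [^]\<^bsub>A\<^esub> (m :: nat)"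

sublocale Fr: kalgebra "free_alg :: ('k, letter list \<Rightarrow>\<^sub>0 'k) module" by (rule kalgebra_free_alg)

lemma ideal_J: "ideal J free_alg" by (rule Fr.genideal_ideal) simp

sublocale A: kalgebra A unfolding H_alg_def by (rule Fr.kalgebra_quot[OF ideal_J])

lemma r_primitive: "primitive_root_of_unity r (q ^ \<nu>)"
  unfolding r_def
  by (rule mult_order_primitive[OF n_pos]) (metis power_commutes power_mult mult.commute power_one q_pow_n)

lemma r_pos: "0 < r" and q_nu_pow_r: "(q ^ \<nu>) ^ r = 1"
  using r_primitive by (auto simp: primitive_root_of_unity_def)

lemma q_pow_N: "q ^ N = 1"
  using n_dvd_N q_pow_n by (auto simp: dvd_def power_mult)

lemma alpha_q_pow_r: "\<alpha> \<noteq> 0 \<Longrightarrow> q ^ r = 1"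
  using order_nonzero q_pow_n by (simp add: r_def)

lemma alg_hom_J: "alg_hom free_alg A ((+>\<^bsub>free_alg\<^esub>) J)"
  unfolding H_alg_def by (rule Fr.alg_hom_coset[OF ideal_J])

lemma a_eq: "a = J +>\<^bsub>free_alg\<^esub> free_a" and x_eq: "x = J +>\<^bsub>free_alg\<^esub> free_x"
  by (simp_all add: H_a_def H_x_def)

lemma a_closed [simp]: "a \<in> carrier A" and x_closed [simp]: "x \<in> carrier A"
  unfolding a_eq x_eq by (rule klin_closed[OF alg_hom_klin[OF alg_hom_J]]; simp)+

lemma J_zero: "f \<in> J \<Longrightarrow> J +>\<^bsub>free_alg\<^esub> f = \<zero>\<^bsub>A\<^esub>"
  using abelian_subgroup.a_rcos_const[OF Fr.subspace_abelian_subgroup[OF Fr.ideal_subspace[OF ideal_J]]]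
  by (simp add: H_alg_def)

section \<open>The universal property of the presentation\<close>

text \<open>The defining relators are formed in an arbitrary algebra so that an algebra map carries
  those of its source to those of its target. With r in place of n the two cases for \<alpha> take
  one shape.\<close>

definition relators :: "('k, 'b, 'm) module_scheme \<Rightarrow> 'b \<Rightarrow> 'b \<Rightarrow> 'b set" where
  "relators B a' x' = {a' [^]\<^bsub>B\<^esub> N \<ominus>\<^bsub>B\<^esub> \<one>\<^bsub>B\<^esub>,
     x' [^]\<^bsub>B\<^esub> r \<ominus>\<^bsub>B\<^esub> \<alpha> \<odot>\<^bsub>B\<^esub> (a' [^]\<^bsub>B\<^esub> (\<nu> * r) \<ominus>\<^bsub>B\<^esub> \<one>\<^bsub>B\<^esub>),
     x' \<otimes>\<^bsub>B\<^esub> a' \<ominus>\<^bsub>B\<^esub> q \<odot>\<^bsub>B\<^esub> (a' \<otimes>\<^bsub>B\<^esub> x')}"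

lemma H_relators_eq: "H_relators n q N \<nu> \<alpha> = relators free_alg free_a free_x"
proof (cases "\<alpha> = 0")
  case True
  have "f \<ominus>\<^bsub>free_alg\<^esub> \<zero>\<^bsub>free_alg\<^esub> = f" for f :: "letter list \<Rightarrow>\<^sub>0 'k"
    by (simp add: Fr.minus_eq)
  with True show ?thesis unfolding H_relators_def relators_def r_def by simp
next
  case False
  with order_nonzero show ?thesis unfolding H_relators_def relators_def r_def by simp
qed

lemma alg_hom_relators:
  assumes A': "kalgebra A'" and B: "kalgebra B" and f: "alg_hom A' B f" and a': "a' \<in> carrier A'" and x': "x' \<in> carrier A'"
  shows "f ` relators A' a' x' = relators B (f a') (f x')"
proof -
  interpret A': kalgebra A' by fact
  interpret B: kalgebra B by fact
  note lin = alg_hom_klin[OF f]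
  note m = klin_minus[OF A'.kspace_axioms B.kspace_axioms lin]
  show ?thesis
    unfolding relators_def using a' x'
    by (simp add: m alg_hom_nat_pow[OF A' B f] alg_hom_one[OF f] alg_hom_mult[OF f] klin_smult[OF lin])
qed

lemma relators_zero_iff:
  assumes B: "kalgebra B" and a': "a' \<in> carrier B" and x': "x' \<in> carrier B"
  shows "relators B a' x' \<subseteq> {\<zero>\<^bsub>B\<^esub>} \<longleftrightarrow> a' [^]\<^bsub>B\<^esub> N = \<one>\<^bsub>B\<^esub> \<and>
    x' [^]\<^bsub>B\<^esub> r = \<alpha> \<odot>\<^bsub>B\<^esub> (a' [^]\<^bsub>B\<^esub> (\<nu> * r) \<ominus>\<^bsub>B\<^esub> \<one>\<^bsub>B\<^esub>) \<and> x' \<otimes>\<^bsub>B\<^esub> a' = q \<odot>\<^bsub>B\<^esub> (a' \<otimes>\<^bsub>B\<^esub> x')"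
proof -
  interpret B: kalgebra B by fact
  have "u \<ominus>\<^bsub>B\<^esub> v = \<zero>\<^bsub>B\<^esub> \<longleftrightarrow> u = v" if "u \<in> carrier B" "v \<in> carrier B" for u v
  proof
    assume "u \<ominus>\<^bsub>B\<^esub> v = \<zero>\<^bsub>B\<^esub>"
    then have "(u \<ominus>\<^bsub>B\<^esub> v) \<oplus>\<^bsub>B\<^esub> v = v" using that by simp
    then show "u = v" using that by (simp add: B.minus_eq B.a_assoc B.l_neg)
  qed (use that in \<open>simp add: B.minus_eq B.r_neg\<close>)
  then show ?thesis using a' x' by (simp add: relators_def)
qed

lemma a_pow_N: "a \<up> N = \<one>\<^bsub>A\<^esub>"
  and x_pow_r: "x \<up> r = \<alpha> *\<^sub>A (a \<up> (\<nu> * r) \<ominus>\<^bsub>A\<^esub> \<one>\<^bsub>A\<^esub>)"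
  and x_a: "x \<bullet> a = q *\<^sub>A (a \<bullet> x)"
proof -
  have "relators A a x = (+>\<^bsub>free_alg\<^esub>) J ` relators free_alg free_a free_x"
    unfolding a_eq x_eq
    by (rule alg_hom_relators[OF Fr.kalgebra_axioms A.kalgebra_axioms alg_hom_J, symmetric]) simp_all
  also have "\<dots> \<subseteq> {\<zero>\<^bsub>A\<^esub>}"
    unfolding H_relators_eq[symmetric] using J_zero Fr.genideal_self[of "H_relators n q N \<nu> \<alpha>"] by auto
  finally show "a \<up> N = \<one>\<^bsub>A\<^esub>" "x \<up> r = \<alpha> *\<^sub>A (a \<up> (\<nu> * r) \<ominus>\<^bsub>A\<^esub> \<one>\<^bsub>A\<^esub>)"
    "x \<bullet> a = q *\<^sub>A (a \<bullet> x)"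
    using relators_zero_iff[OF A.kalgebra_axioms a_closed x_closed] by simp_all
qed

lemma H_alg_induct [consumes 1, case_names subspace one a x]:
  assumes u: "u \<in> carrier A" and S: "subspace S A" and one: "\<one>\<^bsub>A\<^esub> \<in> S"
    and a: "\<And>u. u \<in> S \<Longrightarrow> a \<bullet> u \<in> S" and x: "\<And>u. u \<in> S \<Longrightarrow> x \<bullet> u \<in> S"
  shows "u \<in> S"
proof -
  let ?p = "(+>\<^bsub>free_alg\<^esub>) J"
  note hom = alg_hom_J
  note lin = alg_hom_klin[OF hom]
  have "f \<in> {f. ?p f \<in> S}" for f
  proof (rule free_alg_induct[of f])
    have "?p \<zero>\<^bsub>free_alg\<^esub> \<in> S"
      using S by (simp only: subspace_def klin_zero[OF Fr.kspace_axioms A.kspace_axioms lin])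
    then show "subspace {f. ?p f \<in> S} free_alg"
      using S by (auto simp: subspace_def klin_add[OF lin] klin_smult[OF lin])
  qed (use a x one in \<open>simp_all add: alg_hom_one[OF hom] alg_hom_mult[OF hom] a_eq[symmetric] x_eq[symmetric]\<close>)
  moreover obtain f where "u = ?p f"
    using u unfolding H_alg_def by (rule Fr.quot_alg_cases)
  ultimately show ?thesis by simp
qed

lemma alg_hom_H_eq:
  assumes B: "kalgebra B" and f: "alg_hom A B f" and g: "alg_hom A B g"
    and eq: "f a = g a" "f x = g x" and u: "u \<in> carrier A"
  shows "f u = g u"
proof -
  interpret B: kalgebra B by fact
  note lf = alg_hom_klin[OF f] and lg = alg_hom_klin[OF g]
  have "u \<in> {u \<in> carrier A. f u = g u}"
    using u
  proof (rule H_alg_induct)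
    show "subspace {u \<in> carrier A. f u = g u} A"
      unfolding subspace_def
      by (auto simp: klin_add[OF lf] klin_add[OF lg] klin_smult[OF lf] klin_smult[OF lg]
        klin_zero[OF A.kspace_axioms B.kspace_axioms lf] klin_zero[OF A.kspace_axioms B.kspace_axioms lg])
  qed (simp_all add: alg_hom_one[OF f] alg_hom_one[OF g] alg_hom_mult[OF f] alg_hom_mult[OF g] eq)
  then show ?thesis by simp
qed

text \<open>The map from the free algebra kills the relators; its kernel is an ideal, so it contains
  the ideal they generate and the map descends.\<close>

lemma alg_hom_H_exists:
  assumes B: "kalgebra B" and a': "a' \<in> carrier B" and x': "x' \<in> carrier B"
    and rel: "a' [^]\<^bsub>B\<^esub> N = \<one>\<^bsub>B\<^esub>"
      "x' [^]\<^bsub>B\<^esub> r = \<alpha> \<odot>\<^bsub>B\<^esub> (a' [^]\<^bsub>B\<^esub> (\<nu> * r) \<ominus>\<^bsub>B\<^esub> \<one>\<^bsub>B\<^esub>)"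
      "x' \<otimes>\<^bsub>B\<^esub> a' = q \<odot>\<^bsub>B\<^esub> (a' \<otimes>\<^bsub>B\<^esub> x')"
  obtains f where "alg_hom A B f" "f a = a'" "f x = x'"
proof -
  interpret B: kalgebra B by fact
  obtain h where h: "alg_hom free_alg B h" "h free_a = a'" "h free_x = x'"
    by (rule free_alg_hom_exists[OF B a' x'])
  have "h ` H_relators n q N \<nu> \<alpha> \<subseteq> {\<zero>\<^bsub>B\<^esub>}"
    unfolding H_relators_eq alg_hom_relators[OF Fr.kalgebra_axioms B h(1), of free_a free_x, simplified] h(2,3)
    using relators_zero_iff[OF B a' x'] rel by simp
  then have "H_relators n q N \<nu> \<alpha> \<subseteq> a_kernel free_alg B h"
    by (auto simp: a_kernel_def')
  moreover have "ideal (a_kernel free_alg B h) free_alg"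
  proof -
    interpret ring_hom_ring free_alg B h
      using h(1) by (intro ring_hom_ringI2 Fr.ring_axioms B.ring_axioms) (simp add: alg_hom_def)
    show ?thesis by (rule kernel_is_ideal)
  qed
  ultimately have "J \<subseteq> a_kernel free_alg B h" by (intro Fr.genideal_minimal)
  then have z: "h f = \<zero>\<^bsub>B\<^esub>" if "f \<in> J" for f using that by (auto simp: a_kernel_def')
  obtain g where "alg_hom A B g" "\<And>f. f \<in> carrier free_alg \<Longrightarrow> g (J +>\<^bsub>free_alg\<^esub> f) = h f"
    unfolding H_alg_def using Fr.alg_hom_factor[OF B h(1) ideal_J z] by metis
  then show ?thesis using that h unfolding a_eq x_eq by simp
qed

text \<open>The definite descriptions of comultiplication, counit and antipode are all of this
  shape, so each only requires checking three relations in its target.\<close>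

lemma alg_hom_H_ex1:
  assumes B: "kalgebra B" and a': "a' \<in> carrier B" and x': "x' \<in> carrier B"
    and rel: "a' [^]\<^bsub>B\<^esub> N = \<one>\<^bsub>B\<^esub>"
      "x' [^]\<^bsub>B\<^esub> r = \<alpha> \<odot>\<^bsub>B\<^esub> (a' [^]\<^bsub>B\<^esub> (\<nu> * r) \<ominus>\<^bsub>B\<^esub> \<one>\<^bsub>B\<^esub>)"
      "x' \<otimes>\<^bsub>B\<^esub> a' = q \<odot>\<^bsub>B\<^esub> (a' \<otimes>\<^bsub>B\<^esub> x')"
  shows "\<exists>!f. f \<in> extensional (carrier A) \<and> alg_hom A B f \<and> f a = a' \<and> f x = x'"
proof (rule ex_ex1I)
  interpret B: kalgebra B by fact
  obtain f where f: "alg_hom A B f" "f a = a'" "f x = x'" using alg_hom_H_exists[OF assms] by blast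
  have "alg_hom A B (restrict f (carrier A))"
    using f(1) unfolding alg_hom_def ring_hom_def by auto
  then show "\<exists>f. f \<in> extensional (carrier A) \<and> alg_hom A B f \<and> f a = a' \<and> f x = x'"
    using f by (intro exI[of _ "restrict f (carrier A)"]) simp
next
  fix f g assume "f \<in> extensional (carrier A) \<and> alg_hom A B f \<and> f a = a' \<and> f x = x'"
    "g \<in> extensional (carrier A) \<and> alg_hom A B g \<and> g a = a' \<and> g x = x'"
  then have e: "f \<in> extensional (carrier A)" "g \<in> extensional (carrier A)"
    and h: "alg_hom A B f" "alg_hom A B g" "f a = g a" "f x = g x" by simp_all
  show "f = g" by (rule extensionalityI[OF e alg_hom_H_eq[OF B h]])
qed

subsection \<open>The basis of monomials\<close>

definition mon :: "nat \<times> nat \<Rightarrow> (letter list \<Rightarrow>\<^sub>0 'k) set" where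
  "mon p = a \<up> fst p \<bullet> x \<up> snd p"

abbreviation "Ix \<equiv> {..<N} \<times> {..<r}"

lemma mon_closed [simp]: "mon p \<in> carrier A" by (simp add: mon_def)

lemma a_pow_mod: "a \<up> (i mod N) = a \<up> i"
proof -
  have "a \<up> i = a \<up> (N * (i div N) + i mod N)" by simp
  also have "\<dots> = (a \<up> N) \<up> (i div N) \<bullet> a \<up> (i mod N)"
    by (simp only: A.nat_pow_pow A.nat_pow_mult a_closed)
  finally show ?thesis by (simp add: a_pow_N)
qed

lemma mon_mod: "mon (i mod N, j) = mon (i, j)"
  by (simp add: mon_def a_pow_mod)

lemma x_pow_a_pow: "x \<up> (j::nat) \<bullet> a \<up> (i::nat) = q ^ (j * i) *\<^sub>A mon (i, j)"
  by (simp add: mon_def A.nat_pow_skew_commute[OF a_closed x_closed x_a])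

lemma a_mon: "a \<bullet> mon (i, j) = mon (Suc i, j)"
  using A.nat_pow_Suc2[OF a_closed, of i] by (simp add: mon_def A.m_assoc[symmetric])

lemma x_mon: "x \<bullet> mon (i, j) = q ^ i *\<^sub>A mon (i, Suc j)"
proof -
  have "x \<bullet> mon (i, j) = (x \<up> (1::nat) \<bullet> a \<up> i) \<bullet> x \<up> j"
    by (simp add: mon_def A.m_assoc)
  also have "\<dots> = q ^ i *\<^sub>A (a \<up> i \<bullet> (x \<bullet> x \<up> j))"
    unfolding x_pow_a_pow by (simp add: mon_def A.smult_mult_l A.m_assoc)
  finally show ?thesis using A.nat_pow_Suc2[OF x_closed, of j] by (simp add: mon_def)
qed

lemma mon_r: "mon (i, r) = \<alpha> *\<^sub>A (mon (i + \<nu> * r, 0) \<ominus>\<^bsub>A\<^esub> mon (i, 0))"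
  by (simp add: mon_def x_pow_r A.smult_mult_r A.minus_eq A.r_distr A.r_minus A.nat_pow_mult)

text \<open>The transpose of right multiplication, acting on forms in the coordinates \<open>f (i, j) = f (a\<^sup>i x\<^sup>j)\<close>.
  Off the index set the generators act through the counit, which keeps the relations valid there.\<close>

definition opA :: "(nat \<times> nat \<Rightarrow> 'k) \<Rightarrow> nat \<times> nat \<Rightarrow> 'k" where
  "opA f = (\<lambda>(i, j). if (i, j) \<in> Ix then q ^ j * f (Suc i mod N, j) else f (i, j))"

definition opX :: "(nat \<times> nat \<Rightarrow> 'k) \<Rightarrow> nat \<times> nat \<Rightarrow> 'k" where
  "opX f = (\<lambda>(i, j). if (i, j) \<in> Ix then
     (if Suc j < r then f (i, Suc j) else \<alpha> * (f ((i + \<nu> * r) mod N, 0) - f (i, 0))) else 0)"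

lemma opA_pow: "(opA ^^ m) f (i, j) = (if (i, j) \<in> Ix then q ^ (j * m) * f ((i + m) mod N, j) else f (i, j))"
proof (induction m arbitrary: f)
  case (Suc m)
  have "(opA ^^ Suc m) f (i, j) = (opA ^^ m) (opA f) (i, j)" by (simp add: funpow_swap1)
  also have "\<dots> = (if (i, j) \<in> Ix then q ^ (j * Suc m) * f ((i + Suc m) mod N, j) else f (i, j))"
    using N_pos by (simp add: Suc opA_def mod_Suc_eq power_add)
  finally show ?case .
qed simp

text \<open>With at most r steps the exponent of x passes r at most once, so the relation on the rth
  power is applied at most once. That is enough to verify this relation.\<close>

lemma opX_pow:
  assumes "m \<le> r"
  shows "(opX ^^ m) f (i, j) = (if (i, j) \<in> Ix then
     (if j + m < r then f (i, j + m)
      else \<alpha> * (f ((i + \<nu> * r) mod N, j + m - r) - f (i, j + m - r))) else if m = 0 then f (i, j) else 0)"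
  using assms
proof (induction m arbitrary: f)
  case (Suc m)
  have IH: "(opX ^^ m) g (i, j) = (if (i, j) \<in> Ix then
     (if j + m < r then g (i, j + m)
      else \<alpha> * (g ((i + \<nu> * r) mod N, j + m - r) - g (i, j + m - r))) else if m = 0 then g (i, j) else 0)" for g
    using Suc by simp
  have "(opX ^^ Suc m) f (i, j) = (opX ^^ m) (opX f) (i, j)" by (simp add: funpow_swap1)
  also have "\<dots> = (if (i, j) \<in> Ix then
     (if j + Suc m < r then f (i, j + Suc m)
      else \<alpha> * (f ((i + \<nu> * r) mod N, j + Suc m - r) - f (i, j + Suc m - r))) else 0)"
  proof (cases "(i, j) \<in> Ix")
    case True
    consider "j + Suc m < r" | "j + Suc m = r" | "r \<le> j + m" by linarith
    then show ?thesis
    proof cases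
      case 3
      then have "j + m - r < r" "Suc (j + m - r) < r" "j + Suc m - r = Suc (j + m - r)"
        using True Suc.prems by auto
      then show ?thesis unfolding IH using 3 True N_pos by (simp add: opX_def)
    qed (unfold IH, use True in \<open>auto simp: opX_def\<close>)
  next
    case False
    then show ?thesis unfolding IH by (auto simp: opX_def)
  qed
  finally show ?case by simp
qed auto

lemma rho_exists: "\<exists>\<rho>. alg_hom A end_alg \<rho> \<and> \<rho> a = opA \<and> \<rho> x = opX"
proof -
  interpret E: kalgebra "end_alg :: ('k, (nat \<times> nat \<Rightarrow> 'k) \<Rightarrow> nat \<times> nat \<Rightarrow> 'k) module" by (rule kalgebra_end_alg)
  have A: "opA \<in> carrier end_alg" and X: "opX \<in> carrier end_alg"
    by (auto simp: mem_end_alg opA_def opX_def fun_eq_iff algebra_simps)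
  have minus: "(S \<ominus>\<^bsub>end_alg\<^esub> T) f p = S f p - T f p"
    if "T \<in> carrier end_alg" for S T :: "(nat \<times> nat \<Rightarrow> 'k) \<Rightarrow> nat \<times> nat \<Rightarrow> 'k" and f p
    using E.smult_minus_one[OF that, symmetric] by (simp add: E.minus_eq)
  have Apow: "opA ^^ m \<in> carrier end_alg" for m
    using E.nat_pow_closed[OF A, of m] by (simp add: end_alg_nat_pow)
  have 1: "opA [^]\<^bsub>end_alg\<^esub> N = \<one>\<^bsub>end_alg\<^esub>"
    by (auto simp: end_alg_nat_pow fun_eq_iff opA_pow power_mult q_pow_N mult.commute[of _ N])
  have 2: "opX [^]\<^bsub>end_alg\<^esub> r = \<alpha> \<odot>\<^bsub>end_alg\<^esub> (opA [^]\<^bsub>end_alg\<^esub> (\<nu> * r) \<ominus>\<^bsub>end_alg\<^esub> \<one>\<^bsub>end_alg\<^esub>)"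
  proof -
    \<comment> \<open>The scalar in \<open>opA_pow\<close> disappears, leaving a pure shift of the
      exponent of a, as the relation requires.\<close>
    have "q ^ (j * (\<nu> * r)) = 1" for j
      using q_nu_pow_r by (metis mult.commute power_mult power_one)
    then have "(opX ^^ r) f (i, j) = \<alpha> * ((opA ^^ (\<nu> * r)) f (i, j) - f (i, j))" for f i j
      using r_pos by (simp add: opX_pow opA_pow)
    then show ?thesis using E.one_closed by (auto simp: end_alg_nat_pow fun_eq_iff minus)
  qed
  have 3: "opX \<otimes>\<^bsub>end_alg\<^esub> opA = q \<odot>\<^bsub>end_alg\<^esub> (opA \<otimes>\<^bsub>end_alg\<^esub> opX)"
  proof -
    have "opX (opA f) (i, j) = q * opA (opX f) (i, j)" for f i j
    proof (cases "(i, j) \<in> Ix")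
      case True
      show ?thesis
      proof (cases "Suc j < r")
        case False
        then have "Suc j = r" using True by auto
        \<comment> \<open>At j = r - 1 the exponent of x overflows and the two sides differ by the
          factor q^r on a multiple of \<alpha>. Either \<alpha> = 0, or r = n and this factor is
          1.\<close>
        then have "\<alpha> = 0 \<or> q * q ^ j = 1" using alpha_q_pow_r by (cases "\<alpha> = 0") (auto simp flip: power_Suc)
        moreover have "Suc ((i + \<nu> * r) mod N) mod N = (Suc i mod N + \<nu> * r) mod N"
          by (simp add: mod_Suc_eq mod_add_left_eq)
        ultimately show ?thesis using False True N_pos r_pos by (auto simp: opX_def opA_def)
      qed (use True N_pos in \<open>simp add: opX_def opA_def\<close>)
    qed (auto simp: opX_def opA_def)
    then show ?thesis by (auto simp: fun_eq_iff)
  qed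
  show ?thesis
    using alg_hom_H_exists[OF E.kalgebra_axioms A X 1 2 3] by metis
qed

definition "\<rho> = (SOME \<rho>. alg_hom A end_alg \<rho> \<and> \<rho> a = opA \<and> \<rho> x = opX)"

lemma rho: "alg_hom A end_alg \<rho>" "\<rho> a = opA" "\<rho> x = opX"
  using someI_ex[OF rho_exists] unfolding \<rho>_def by auto

text \<open>Since \<rho> is transposed right multiplication, \<open>\<rho> u f\<close> at the index
  (0, 0) of the unit is the value of the form f at u. Taking f to be the indicator of p gives the
  coefficient of u at p.\<close>

definition coord :: "nat \<times> nat \<Rightarrow> (letter list \<Rightarrow>\<^sub>0 'k) set \<Rightarrow> 'k" where
  "coord p u = \<rho> u (\<lambda>p'. if p = p' then 1 else 0) (0, 0)"

lemma klin_coord: "klin A field_alg (coord p)"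
  by (rule klin_formI) (simp_all add: coord_def klin_add[OF alg_hom_klin[OF rho(1)]] klin_smult[OF alg_hom_klin[OF rho(1)]])

lemma coord_mon:
  assumes j: "j < r"
  shows "coord p (mon (i, j)) = (if p = (i mod N, j) then 1 else 0)"
proof -
  have "\<rho> (mon (i, j)) = (opA ^^ i) \<circ> (opX ^^ j)"
    by (simp add: mon_def alg_hom_mult[OF rho(1)] alg_hom_nat_pow[OF A.kalgebra_axioms kalgebra_end_alg rho(1)] rho end_alg_nat_pow)
  then show ?thesis using j N_pos r_pos by (simp add: coord_def opA_pow opX_pow)
qed

text \<open>Independence is \<open>coord_mon\<close>. For spanning, the elements equal to their own
  expansion form a subspace that contains 1 and is stable under left multiplication by a and
  x.\<close>

lemma kbasis_mon: "kbasis A mon coord Ix"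
proof (intro kbasis.intro A.kspace_axioms kbasis_axioms.intro)
  let ?E = "\<lambda>u. finsum A (\<lambda>p. coord p u *\<^sub>A mon p) Ix"
  define S where "S = {u \<in> carrier A. u = ?E u}"
  have E: "klin A A ?E"
    by (rule klin_finsum_fun[OF A.kspace_axioms A.kspace_axioms])
      (auto intro!: klin_form_scale A.kspace_axioms klin_coord)
  have sub: "subspace S A"
    unfolding subspace_def S_def using klin_add[OF E] klin_smult[OF E] klin_zero[OF A.kspace_axioms A.kspace_axioms E]
    by auto
  have zero: "\<zero>\<^bsub>A\<^esub> \<in> S" and add: "u \<in> S \<Longrightarrow> v \<in> S \<Longrightarrow> u \<oplus>\<^bsub>A\<^esub> v \<in> S" and smult: "u \<in> S \<Longrightarrow> c *\<^sub>A u \<in> S"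
    for u v c using sub unfolding subspace_def by blast+
  have mono: "mon (i, j) \<in> S" if "j < r" for i j
  proof -
    have "?E (mon (i, j)) = finsum A (\<lambda>p. if (i mod N, j) = p then mon p else \<zero>\<^bsub>A\<^esub>) Ix"
      using that by (intro A.finsum_cong') (auto simp: coord_mon)
    also have "\<dots> = mon (i mod N, j)"
      using that N_pos by (intro A.finsum_singleton) auto
    finally show ?thesis by (simp add: mon_mod S_def)
  qed
  \<comment> \<open>Left multiplication by x leaves the index set only at exponent r, where the
    relation brings it back.\<close>
  have mon_r: "mon (i, r) \<in> S" for i
    unfolding mon_r A.minus_eq
    using A.smult_minus_one[of "mon (i, 0)", symmetric] by (auto intro!: smult add mono r_pos)
  have step: "b \<bullet> u \<in> S"
    if b: "b \<in> carrier A" and bm: "\<And>p. p \<in> Ix \<Longrightarrow> b \<bullet> mon p \<in> S" and u: "u \<in> S" for b u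
  proof -
    have l: "klin A A (\<lambda>u. b \<bullet> u)" by (rule klinI) (use b in \<open>simp_all add: A.r_distr A.smult_mult_r\<close>)
    have c: "(\<lambda>p. coord p u *\<^sub>A mon p) \<in> Ix \<rightarrow> carrier A" by simp
    have "u = ?E u" using u unfolding S_def mem_Collect_eq by (rule conjunct2)
    then have "b \<bullet> u = b \<bullet> ?E u" by (rule arg_cong)
    also have "\<dots> = finsum A (\<lambda>p. b \<bullet> (coord p u *\<^sub>A mon p)) Ix"
      by (rule klin_finsum[OF A.kspace_axioms A.kspace_axioms l _ c]) simp
    finally have e: "b \<bullet> u = finsum A (\<lambda>p. b \<bullet> (coord p u *\<^sub>A mon p)) Ix" .
    have t: "b \<bullet> (coord p u *\<^sub>A mon p) \<in> S" if "p \<in> Ix" for p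
      using smult[OF bm[OF that]] b by (simp add: A.smult_mult_r)
    have "finsum A (\<lambda>p. b \<bullet> (coord p u *\<^sub>A mon p)) K \<in> S" if "K \<subseteq> Ix" for K
    proof -
      have "finite K" using that by (rule finite_subset) simp
      then show ?thesis using that
      proof (induction K rule: finite_induct)
        case empty then show ?case by (simp add: zero)
      next
        case (insert p K)
        then have "finsum A (\<lambda>p. b \<bullet> (coord p u *\<^sub>A mon p)) (insert p K) =
           b \<bullet> (coord p u *\<^sub>A mon p) \<oplus>\<^bsub>A\<^esub> finsum A (\<lambda>p. b \<bullet> (coord p u *\<^sub>A mon p)) K"
          using b by (intro A.finsum_insert) auto
        moreover have "p \<in> Ix" "K \<subseteq> Ix" using insert by auto
        ultimately show ?case using add[OF t[of p] insert(3)] by simp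
      qed
    qed
    then show ?thesis unfolding e by blast
  qed
  show "u = ?E u" if "u \<in> carrier A" for u
  proof -
    have "u \<in> S" using that
    proof (rule H_alg_induct[OF _ sub])
      have "\<one>\<^bsub>A\<^esub> = mon (0, 0)" by (simp add: mon_def)
      then show "\<one>\<^bsub>A\<^esub> \<in> S" using mono[OF r_pos] by metis
      show "a \<bullet> u \<in> S" if "u \<in> S" for u
        by (rule step[OF a_closed _ that]) (use mono in \<open>auto simp: a_mon\<close>)
      show "x \<bullet> u \<in> S" if "u \<in> S" for u
      proof (rule step[OF x_closed _ that])
        fix p assume "p \<in> Ix"
        then obtain i j where p: "p = (i, j)" "j < r" by auto
        have "mon (i, Suc j) \<in> S" using mono mon_r p by (cases "Suc j = r") auto
        then show "x \<bullet> mon p \<in> S" unfolding p x_mon by (rule smult)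
      qed
    qed
    then show ?thesis unfolding S_def by blast
  qed
  show "coord p (mon p') = (if p = p' then 1 else 0)" if "p \<in> Ix" "p' \<in> Ix" for p p'
    using that by (cases p') (simp add: coord_mon)
qed (auto simp: klin_coord)

sublocale B: kbasis A mon coord Ix by (rule kbasis_mon)

end

section \<open>The Hopf structure\<close>

lemma finsum_extend: "finsum (module.extend A m) g S = finsum A g S"
  unfolding finsum_def finprod_def by simp

lemma kbasis_extend: "kbasis A e c I \<Longrightarrow> kbasis (module.extend A m) e c I"
  by (simp add: kbasis_def kbasis_axioms_def kspace_extend finsum_extend)

lemma field_alg_minus_self: "c \<ominus>\<^bsub>field_alg\<^esub> d = c - d"
proof -
  interpret K: kalgebra field_alg by (rule kalgebra_field_alg)
  show ?thesis using K.smult_minus_one[of d, symmetric] by (simp add: K.minus_eq)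
qed

context H_params
begin

sublocale TT: tensor_pair_alg A A ..

abbreviation "\<Delta> \<equiv> H_comult n q N \<nu> \<alpha>"
abbreviation "\<epsilon> \<equiv> H_counit n q N \<nu> \<alpha>"
abbreviation "H \<equiv> H_hopf n q N \<nu> \<alpha>"

abbreviation "\<zeta> \<equiv> q ^ \<nu>"
abbreviation "P\<^sub>x \<equiv> TT.pt x (a \<up> \<nu>)"
abbreviation "Q\<^sub>x \<equiv> TT.pt \<one>\<^bsub>A\<^esub> x"

lemmas pt_lin_left = kbilinD(1)[OF TT.kbilin_pure_tensor]
lemmas pt_lin_right = kbilinD(2)[OF TT.kbilin_pure_tensor]

lemma x_a_pow: "x \<bullet> a \<up> (i::nat) = q ^ i *\<^sub>A (a \<up> i \<bullet> x)"
  using x_pow_a_pow[of 1 i] by (simp add: mon_def)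

lemma Q_P: "Q\<^sub>x \<otimes>\<^bsub>TT.T\<^esub> P\<^sub>x = \<zeta> \<odot>\<^bsub>TT.T\<^esub> (P\<^sub>x \<otimes>\<^bsub>TT.T\<^esub> Q\<^sub>x)"
  by (simp add: TT.pure_tensor_mult x_a_pow klin_smult[OF pt_lin_right])

text \<open>The two summands of \<Delta>(x) commute up to \<zeta>, a primitive rth root of unity, so
  the rth power of the sum has no mixed terms.\<close>

lemma comult_ex1: "\<exists>!D. D \<in> extensional (carrier A) \<and> alg_hom A TT.T D \<and>
  D a = TT.pt a a \<and> D x = P\<^sub>x \<oplus>\<^bsub>TT.T\<^esub> Q\<^sub>x"
proof (rule alg_hom_H_ex1)
  let ?g = "a \<up> (\<nu> * r)"
  have aa: "TT.pt a a [^]\<^bsub>TT.T\<^esub> m = TT.pt (a \<up> m) (a \<up> m)" for m :: nat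
    by (rule TT.pure_tensor_nat_pow) simp_all
  show "TT.pt a a [^]\<^bsub>TT.T\<^esub> N = \<one>\<^bsub>TT.T\<^esub>" by (simp add: aa a_pow_N TT.tensor_one)
  have "(P\<^sub>x \<oplus>\<^bsub>TT.T\<^esub> Q\<^sub>x) [^]\<^bsub>TT.T\<^esub> r = P\<^sub>x [^]\<^bsub>TT.T\<^esub> r \<oplus>\<^bsub>TT.T\<^esub> Q\<^sub>x [^]\<^bsub>TT.T\<^esub> r"
    by (rule TT.T.skew_power_root_of_unity[OF _ _ Q_P r_primitive]) simp_all
  also have "\<dots> = TT.pt (\<alpha> *\<^sub>A (?g \<ominus>\<^bsub>A\<^esub> \<one>\<^bsub>A\<^esub>)) ?g \<oplus>\<^bsub>TT.T\<^esub> TT.pt \<one>\<^bsub>A\<^esub> (\<alpha> *\<^sub>A (?g \<ominus>\<^bsub>A\<^esub> \<one>\<^bsub>A\<^esub>))"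
    by (simp add: TT.pure_tensor_nat_pow A.nat_pow_pow x_pow_r)
  \<comment> \<open>With g = a^(\<nu> r) the sum telescopes over the common tensor of 1 and
    g.\<close>
  also have "\<dots> = \<alpha> \<odot>\<^bsub>TT.T\<^esub> ((TT.pt ?g ?g \<ominus>\<^bsub>TT.T\<^esub> TT.pt \<one>\<^bsub>A\<^esub> ?g) \<oplus>\<^bsub>TT.T\<^esub> (TT.pt \<one>\<^bsub>A\<^esub> ?g \<ominus>\<^bsub>TT.T\<^esub> TT.pt \<one>\<^bsub>A\<^esub> \<one>\<^bsub>A\<^esub>))"
    by (simp add: klin_smult[OF pt_lin_left] klin_smult[OF pt_lin_right] TT.T.smult_r_distr
        klin_minus[OF A.kspace_axioms TT.T.kspace_axioms pt_lin_left]
        klin_minus[OF A.kspace_axioms TT.T.kspace_axioms pt_lin_right])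
  also have "(TT.pt ?g ?g \<ominus>\<^bsub>TT.T\<^esub> TT.pt \<one>\<^bsub>A\<^esub> ?g) \<oplus>\<^bsub>TT.T\<^esub> (TT.pt \<one>\<^bsub>A\<^esub> ?g \<ominus>\<^bsub>TT.T\<^esub> TT.pt \<one>\<^bsub>A\<^esub> \<one>\<^bsub>A\<^esub>)
      = TT.pt ?g ?g \<ominus>\<^bsub>TT.T\<^esub> TT.pt \<one>\<^bsub>A\<^esub> \<one>\<^bsub>A\<^esub>"
    by (simp add: TT.T.minus_eq TT.T.a_assoc TT.T.r_neg1)
  finally show "(P\<^sub>x \<oplus>\<^bsub>TT.T\<^esub> Q\<^sub>x) [^]\<^bsub>TT.T\<^esub> r
      = \<alpha> \<odot>\<^bsub>TT.T\<^esub> (TT.pt a a [^]\<^bsub>TT.T\<^esub> (\<nu> * r) \<ominus>\<^bsub>TT.T\<^esub> \<one>\<^bsub>TT.T\<^esub>)"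
    by (simp add: aa TT.tensor_one)
  have c: "a \<up> \<nu> \<bullet> a = a \<bullet> a \<up> \<nu>"
    using A.nat_pow_Suc2[OF a_closed, of \<nu>] by simp
  show "(P\<^sub>x \<oplus>\<^bsub>TT.T\<^esub> Q\<^sub>x) \<otimes>\<^bsub>TT.T\<^esub> TT.pt a a = q \<odot>\<^bsub>TT.T\<^esub> (TT.pt a a \<otimes>\<^bsub>TT.T\<^esub> (P\<^sub>x \<oplus>\<^bsub>TT.T\<^esub> Q\<^sub>x))"
    by (simp add: TT.T.l_distr TT.T.r_distr TT.pure_tensor_mult x_a c TT.T.smult_r_distr
        klin_smult[OF pt_lin_left] klin_smult[OF pt_lin_right])
qed (simp_all add: TT.T.kalgebra_axioms)

lemma comult: "alg_hom A TT.T \<Delta>" "\<Delta> a = TT.pt a a" "\<Delta> x = P\<^sub>x \<oplus>\<^bsub>TT.T\<^esub> Q\<^sub>x"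
  using theI'[OF comult_ex1] unfolding H_comult_def Let_def by blast+

lemma counit: "alg_hom A field_alg \<epsilon>" "\<epsilon> a = 1" "\<epsilon> x = 0"
proof -
  have "\<exists>!e. e \<in> extensional (carrier A) \<and> alg_hom A field_alg e \<and> e a = 1 \<and> e x = 0"
    by (rule alg_hom_H_ex1) (simp_all add: kalgebra_field_alg field_alg_minus_self r_pos)
  from theI'[OF this] show "alg_hom A field_alg \<epsilon>" "\<epsilon> a = 1" "\<epsilon> x = 0"
    unfolding H_counit_def Let_def by blast+
qed

lemma klin_comult: "klin A TT.T \<Delta>" by (rule alg_hom_klin[OF comult(1)])

lemma comult_a_pow: "\<Delta> (a \<up> (m::nat)) = TT.pt (a \<up> m) (a \<up> m)"
  by (simp add: alg_hom_nat_pow[OF A.kalgebra_axioms TT.T.kalgebra_axioms comult(1)] comult TT.pure_tensor_nat_pow)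

text \<open>The q-binomial theorem for \<Delta>(x)^m, multiplied by the group-like a^l; the t
  factors a^\<nu> from the first summand collect in the second leg.\<close>

lemma comult_mon: "\<Delta> (mon (l, m)) =
  finsum TT.T (\<lambda>t. gauss \<zeta> m t \<odot>\<^bsub>TT.T\<^esub> TT.pt (mon (l, t)) (mon (l + \<nu> * t, m - t))) {..m}"
proof -
  have "\<Delta> (mon (l, m)) = TT.pt (a \<up> l) (a \<up> l) \<otimes>\<^bsub>TT.T\<^esub> (P\<^sub>x \<oplus>\<^bsub>TT.T\<^esub> Q\<^sub>x) [^]\<^bsub>TT.T\<^esub> m"
    by (simp add: mon_def alg_hom_mult[OF comult(1)] comult_a_pow comult(3)
        alg_hom_nat_pow[OF A.kalgebra_axioms TT.T.kalgebra_axioms comult(1)])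
  also have "\<dots> = finsum TT.T (\<lambda>t. TT.pt (a \<up> l) (a \<up> l) \<otimes>\<^bsub>TT.T\<^esub>
      (gauss \<zeta> m t \<odot>\<^bsub>TT.T\<^esub> (P\<^sub>x [^]\<^bsub>TT.T\<^esub> t \<otimes>\<^bsub>TT.T\<^esub> Q\<^sub>x [^]\<^bsub>TT.T\<^esub> (m - t)))) {..m}"
    unfolding TT.T.skew_binomial[OF TT.pure_tensor_closed[OF x_closed A.nat_pow_closed[OF a_closed]]
        TT.pure_tensor_closed[OF A.one_closed x_closed] Q_P]
    by (rule TT.T.finsum_rdistr) simp_all
  also have "\<dots> = finsum TT.T (\<lambda>t. gauss \<zeta> m t \<odot>\<^bsub>TT.T\<^esub> TT.pt (mon (l, t)) (mon (l + \<nu> * t, m - t))) {..m}"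
    by (rule TT.T.finsum_cong')
      (simp_all add: TT.T.smult_mult_r TT.pure_tensor_nat_pow TT.pure_tensor_mult A.nat_pow_pow A.nat_pow_mult
        A.m_assoc[symmetric] mon_def)
  finally show ?thesis .
qed

lemma counit_mon: "\<epsilon> (mon (l, m)) = (if m = 0 then 1 else 0)"
  by (simp add: mon_def alg_hom_mult[OF counit(1)] counit
    alg_hom_nat_pow[OF A.kalgebra_axioms kalgebra_field_alg counit(1)])

lemma H_simps [simp]:
  "carrier H = carrier A" "mult H = mult A" "one H = one A" "zero H = zero A" "add H = add A"
  "smult H = smult A" "comult H = \<Delta>" "counit H = \<epsilon>" "antipode H = H_antipode n q N \<nu> \<alpha>"
  unfolding H_hopf_def by simp_all

lemma klin_H [simp]: "klin H B f = klin A B f"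
  unfolding klin_def by simp

sublocale HB: hopf_basis H mon coord Ix
  unfolding hopf_basis_def H_hopf_def by (intro conjI kbasis_extend kalgebra_extend kbasis_mon A.kalgebra_axioms)

lemma mem_linear_forms: "f \<in> linear_forms H \<longleftrightarrow> f \<in> extensional (carrier A) \<and> klin A field_alg f"
  by (simp add: linear_forms_iff)

lemma mon_eqD:
  assumes "j < r" "mon (i, j) = mon (i', j)" shows "i mod N = i' mod N"
  using arg_cong[OF assms(2), of "coord (i mod N, j)"] by (simp add: coord_mon assms(1) split: if_splits)

lemma mon_nonzero:
  assumes "j < r" shows "mon (i, j) \<noteq> \<zero>\<^bsub>A\<^esub>"
proof -
  have "coord (i mod N, j) \<zero>\<^bsub>A\<^esub> = 0"
    using klin_zero[OF A.kspace_axioms kspace_field_alg klin_coord] by simp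
  then show ?thesis using coord_mon[OF assms, of "(i mod N, j)" i] by auto
qed

lemma a_pow_eq_one: "a \<up> (m::nat) = \<one>\<^bsub>A\<^esub> \<Longrightarrow> N dvd m"
  using mon_eqD[OF r_pos, of m 0] by (simp add: mon_def dvd_eq_mod_eq_0)

lemma x_eq_zero_iff:
  assumes "\<alpha> = 0" shows "x = \<zero>\<^bsub>A\<^esub> \<longleftrightarrow> r = 1"
proof
  assume "r = 1"
  then have "x = \<alpha> *\<^sub>A (a \<up> (\<nu> * r) \<ominus>\<^bsub>A\<^esub> \<one>\<^bsub>A\<^esub>)" using x_pow_r by simp
  \<comment> \<open>Only the scalar is rewritten: \<alpha> is also a parameter of the algebra itself
    and stays there.\<close>
  also have "\<dots> = 0 *\<^sub>A (a \<up> (\<nu> * r) \<ominus>\<^bsub>A\<^esub> \<one>\<^bsub>A\<^esub>)" by (rule arg_cong[OF assms])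
  finally show "x = \<zero>\<^bsub>A\<^esub>" using A.smult_zero_left by simp
next
  assume "x = \<zero>\<^bsub>A\<^esub>"
  then show "r = 1" using mon_nonzero[of 1 0] r_pos by (cases "r = 1") (auto simp: mon_def)
qed

section \<open>Self-duality forces a root of unity\<close>

context
  fixes \<phi>
  assumes iso: "hopf_iso H (dual_hopf H) \<phi>"
begin

lemma phi_closed: "u \<in> carrier A \<Longrightarrow> \<phi> u \<in> linear_forms H"
  using iso unfolding hopf_iso_def bij_betw_def by auto

lemma phi_alg_hom: "alg_hom H (dual_hopf H) \<phi>"
  using iso by (simp add: hopf_iso_def)

lemma phi_klin: "klin A HB.D \<phi>"
  using alg_hom_klin[OF phi_alg_hom] by (simp add: HB.klin_dual_hopf)

lemma phi_inj: "u \<in> carrier A \<Longrightarrow> v \<in> carrier A \<Longrightarrow> (\<And>h. h \<in> carrier A \<Longrightarrow> \<phi> u h = \<phi> v h) \<Longrightarrow> u = v"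
  using iso linear_forms_eqI[OF phi_closed phi_closed, of u v]
  by (auto simp: hopf_iso_def bij_betw_def inj_on_def)

lemma phi_form: "u \<in> carrier A \<Longrightarrow> klin A field_alg (\<phi> u)"
  using phi_closed by (simp add: mem_linear_forms)

lemma phi_form': "h \<in> carrier A \<Longrightarrow> klin A field_alg (\<lambda>u. \<phi> u h)"
  using klin_comp[OF phi_klin klin_dual_eval[of h H]] by simp

lemma phi_one: "h \<in> carrier A \<Longrightarrow> \<phi> \<one>\<^bsub>A\<^esub> h = \<epsilon> h"
  using alg_hom_one[OF phi_alg_hom] by simp

lemma phi_counit: "u \<in> carrier A \<Longrightarrow> \<phi> u \<one>\<^bsub>A\<^esub> = \<epsilon> u"
  using iso by (simp add: hopf_iso_def)

lemma phi_mult: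
  "u \<in> carrier A \<Longrightarrow> u' \<in> carrier A \<Longrightarrow> h \<in> carrier A \<Longrightarrow>
    \<phi> (u \<bullet> u') h = tensor_eval (\<lambda>p p'. \<phi> u p * \<phi> u' p') (\<Delta> h)"
  using alg_hom_mult[OF phi_alg_hom, of u u'] by simp

text \<open>The comultiplication of the dual is the transpose of the product, so compatibility of
  \<phi> with comultiplications becomes this identity. Together with \<open>phi_mult\<close> it
  makes (u, h) mapped to \<open>\<phi> u h\<close> multiplicative in each argument through \<Delta>
  of the other.\<close>

lemma phi_comult:
  assumes h: "h \<in> carrier A" and u: "u \<in> carrier A" and u': "u' \<in> carrier A"
  shows "\<phi> h (u \<bullet> u') = tensor_eval (\<lambda>p p'. \<phi> p u * \<phi> p' u') (\<Delta> h)"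
proof -
  note Dh = klin_closed[OF klin_comult h]
  have tp: "tensor_pair A A" "tensor_pair HB.D HB.D" by (rule TT.tensor_pair_axioms HB.DD.tensor_pair_axioms)+
  let ?t = "tensor_map HB.D HB.D \<phi> \<phi> (\<Delta> h)"
  have "?t \<in> carrier (tensor_alg HB.D HB.D)"
    by (rule klin_closed[OF klin_tensor_map[OF tp phi_klin phi_klin] Dh])
  moreover have "comult (dual_hopf H) (\<phi> h) = ?t"
    using iso h by (simp add: hopf_iso_def HB.tensor_map_dual_hopf)
  ultimately have "tensor_eval (\<lambda>g g'. g u * g' u') ?t = \<phi> h (u \<bullet> u')"
    using HB.comult_dual_eq_iff[OF phi_closed[OF h]] u u' by simp
  then show ?thesis
    using tensor_eval_map[OF tp phi_klin phi_klin HB.kbilin_eval2 Dh] u u' by simp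
qed

lemma kbilin_phi: "u \<in> carrier A \<Longrightarrow> u' \<in> carrier A \<Longrightarrow> kbilin A A field_alg (\<lambda>p p'. \<phi> p u * \<phi> p' u')"
  by (intro kbilin_form_mult phi_form')

lemma phi_mult_a_pow:
  "u \<in> carrier A \<Longrightarrow> u' \<in> carrier A \<Longrightarrow> \<phi> (u \<bullet> u') (a \<up> (m::nat)) = \<phi> u (a \<up> m) * \<phi> u' (a \<up> m)"
  by (simp add: phi_mult comult_a_pow TT.tensor_eval_pure kbilin_form_mult phi_form)

lemma phi_a_pow_mult:
  "u \<in> carrier A \<Longrightarrow> u' \<in> carrier A \<Longrightarrow> \<phi> (a \<up> (m::nat)) (u \<bullet> u') = \<phi> (a \<up> m) u * \<phi> (a \<up> m) u'"
  by (simp add: phi_comult comult_a_pow TT.tensor_eval_pure kbilin_phi)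

lemma phi_x_mult:
  assumes "u \<in> carrier A" "u' \<in> carrier A"
  shows "\<phi> x (u \<bullet> u') = \<phi> x u * \<phi> (a \<up> \<nu>) u' + \<epsilon> u * \<phi> x u'"
  using assms by (simp add: phi_comult comult(3) klin_form_add[OF TT.klin_tensor_eval] kbilin_phi TT.tensor_eval_pure phi_one)

lemma phi_a_pow_alg_hom: "alg_hom A field_alg (\<phi> (a \<up> (m::nat)))"
proof (rule alg_homI)
  have "\<epsilon> (a \<up> m) = 1" using counit_mon[of m 0] by (simp add: mon_def)
  then show "\<phi> (a \<up> m) \<one>\<^bsub>A\<^esub> = \<one>\<^bsub>field_alg\<^esub>" by (simp add: phi_counit)
qed (simp_all add: phi_form phi_a_pow_mult)

lemma phi_a_pow_a: "\<phi> (a \<up> (m::nat)) a = \<phi> a a ^ m"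
proof (induction m)
  case 0
  then show ?case by (simp add: phi_one counit)
next
  case (Suc m)
  then show ?case using phi_mult_a_pow[of "a \<up> m" a 1] by simp
qed

lemma phi_a_pow_a_nonzero: "\<phi> (a \<up> (m::nat)) a \<noteq> 0"
proof
  assume "\<phi> (a \<up> m) a = 0"
  then have "\<phi> (a \<up> m) (a \<up> N) = 0"
    using N_pos by (simp add: alg_hom_nat_pow[OF A.kalgebra_axioms kalgebra_field_alg phi_a_pow_alg_hom])
  then show False using alg_hom_one[OF phi_a_pow_alg_hom] by (simp add: a_pow_N)
qed

text \<open>A character c satisfies (1 - q) c(a) c(x) = 0 by the commutation relation, with c(a)
  nonzero since a^N = 1. This settles q \<noteq> 1; when \<alpha> = 0 nilpotency of x
  suffices.\<close>

lemma phi_a_pow_x: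
  assumes q1: "\<alpha> \<noteq> 0 \<Longrightarrow> q \<noteq> 1"
  shows "\<phi> (a \<up> (m::nat)) x = 0"
proof -
  let ?c = "\<phi> (a \<up> m)"
  note hom = phi_a_pow_alg_hom[of m]
  have "?c x ^ r = ?c (\<alpha> *\<^sub>A (a \<up> (\<nu> * r) \<ominus>\<^bsub>A\<^esub> \<one>\<^bsub>A\<^esub>))"
    using alg_hom_nat_pow[OF A.kalgebra_axioms kalgebra_field_alg hom x_closed, of r] by (simp add: x_pow_r)
  also have "\<dots> = \<alpha> * ?c (a \<up> (\<nu> * r) \<ominus>\<^bsub>A\<^esub> \<one>\<^bsub>A\<^esub>)"
    by (simp add: klin_form_smult[OF alg_hom_klin[OF hom]])
  finally have "?c x ^ r = 0" if "\<alpha> = 0" using that by simp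
  moreover have "?c x * ?c a = q * (?c a * ?c x)"
    using arg_cong[OF x_a, of ?c] by (simp add: alg_hom_mult[OF hom] klin_form_smult[OF alg_hom_klin[OF hom]])
  then have "(1 - q) * (?c a * ?c x) = 0" by (simp add: algebra_simps)
  ultimately show ?thesis using q1 phi_a_pow_a_nonzero[of m] by fastforce
qed

text \<open>If the mth power of \<open>\<phi> a a\<close> were 1, the characters \<phi>(a^m) and
  \<phi>(1) would agree on both generators, hence everywhere; injectivity of \<phi> then gives a^m =
  1, impossible for 0 < m < N.\<close>

lemma phi_a_primitive:
  assumes q1: "\<alpha> \<noteq> 0 \<Longrightarrow> q \<noteq> 1"
  shows "primitive_root_of_unity N (\<phi> a a)"
  unfolding primitive_root_of_unity_def
proof (intro conjI allI impI)
  show "\<phi> a a ^ N = 1" unfolding phi_a_pow_a[symmetric] a_pow_N by (simp add: phi_one counit)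
  fix m assume m: "0 < m \<and> m < N"
  show "\<phi> a a ^ m \<noteq> 1"
  proof
    assume 1: "\<phi> a a ^ m = 1"
    have px: "\<phi> (a \<up> k) x = 0" for k :: nat by (rule phi_a_pow_x) (rule q1)
    have "\<phi> (a \<up> m) h = \<phi> (a \<up> (0::nat)) h" if "h \<in> carrier A" for h
      by (rule alg_hom_H_eq[OF kalgebra_field_alg phi_a_pow_alg_hom phi_a_pow_alg_hom _ _ that])
        (simp_all only: phi_a_pow_a px 1 power_0)
    then have "a \<up> m = a \<up> (0::nat)" by (intro phi_inj) simp_all
    then have "N dvd m" by (intro a_pow_eq_one) simp
    then show False using m by (auto dest: dvd_imp_le)
  qed
qed (rule N_pos)

lemma self_dual_imp_alpha_zero:
  assumes q1: "\<alpha> \<noteq> 0 \<Longrightarrow> q \<noteq> 1" and N: "\<alpha> \<noteq> 0 \<Longrightarrow> \<not> N dvd \<nu> * n"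
  shows "\<alpha> = 0"
proof (rule ccontr)
  assume \<alpha>: "\<alpha> \<noteq> 0"
  define c where "c = \<phi> (a \<up> (1::nat))"
  have hom: "alg_hom A field_alg c" unfolding c_def by (rule phi_a_pow_alg_hom)
  have c: "c x = 0" "c a = \<phi> a a"
    unfolding c_def using phi_a_pow_x[OF q1, of 1] phi_a_pow_a[of 1] by simp_all
  note lin = alg_hom_klin[OF hom]
  have "c x ^ r = \<alpha> * (c a ^ (\<nu> * r) - 1)"
    using arg_cong[OF x_pow_r, of c]
    by (simp add: alg_hom_nat_pow[OF A.kalgebra_axioms kalgebra_field_alg hom] alg_hom_one[OF hom]
        klin_form_smult[OF lin] klin_minus[OF A.kspace_axioms kspace_field_alg lin] field_alg_minus_self)
  then have "\<phi> a a ^ (\<nu> * r) = 1" using \<alpha> c r_pos by (simp add: zero_power)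
  then have "N dvd \<nu> * r" by (simp add: primitive_root_pow_eq_1_iff[OF phi_a_primitive[OF q1]])
  then show False using N[OF \<alpha>] order_nonzero[OF \<alpha>] by (simp add: r_def)
qed

lemma self_dual_imp_root:
  assumes \<alpha>: "\<alpha> = 0" and r1: "r \<noteq> 1"
  shows "primitive_root_of_unity N (\<phi> a a)" "q = \<phi> a a ^ \<nu>"
proof -
  have q1: "\<alpha> \<noteq> 0 \<Longrightarrow> q \<noteq> 1" using \<alpha> by blast
  show "primitive_root_of_unity N (\<phi> a a)" by (rule phi_a_primitive[OF q1])
  show "q = \<phi> a a ^ \<nu>"
  proof (rule ccontr)
    assume ne: "q \<noteq> \<phi> a a ^ \<nu>"
    have "q \<noteq> 1"
    proof
      assume "q = 1"
      then have "r = 1" using r_primitive by (cases "r > 1") (auto simp: primitive_root_of_unity_def)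
      with r1 show False ..
    qed
    note lin = phi_form[OF x_closed]
    \<comment> \<open>\<open>phi_x_mult\<close> expands both sides: on x a the first summand
      survives, on a x the second, since \<epsilon>(x) = 0 and \<phi>(a^\<nu>)(x) = 0.\<close>
    have "\<phi> x (x \<bullet> a) = q * \<phi> x (a \<bullet> x)" by (simp add: x_a klin_form_smult[OF lin])
    then have "\<phi> x x * \<phi> a a ^ \<nu> = q * \<phi> x x"
      by (simp add: phi_x_mult phi_a_pow_x[OF q1] counit phi_a_pow_a)
    then have xx: "\<phi> x x = 0" using ne by (simp add: mult.commute)
    have xa: "\<phi> x (a \<up> i) = 0" for i :: nat
    proof -
      \<comment> \<open>The same relation in the other argument: evaluation at the group-like a^i is
        multiplicative, and q \<noteq> 1.\<close>
      have "\<phi> (x \<bullet> a) (a \<up> i) = q * \<phi> (a \<bullet> x) (a \<up> i)"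
        by (simp add: x_a klin_form_smult[OF phi_form'])
      then have "(1 - q) * (\<phi> x (a \<up> i) * \<phi> a (a \<up> i)) = 0"
        by (simp add: phi_mult_a_pow algebra_simps)
      moreover have "\<phi> a (a \<up> i) \<noteq> 0"
        using alg_hom_nat_pow[OF A.kalgebra_axioms kalgebra_field_alg phi_a_pow_alg_hom[of 1] a_closed, of i]
          phi_a_pow_a_nonzero[of 1] by simp
      ultimately show ?thesis using \<open>q \<noteq> 1\<close> by simp
    qed
    have "\<phi> x h = \<phi> \<zero>\<^bsub>A\<^esub> h" if h: "h \<in> carrier A" for h
    proof (rule B.klin_eq_on_basis[OF kspace_field_alg phi_form phi_form _ h])
      fix p assume "p \<in> Ix"
      obtain i j where p: "p = (i, j)" by (cases p)
      have 0: "\<phi> \<zero>\<^bsub>A\<^esub> (mon p) = 0"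
        using klin_zero[OF A.kspace_axioms kspace_field_alg phi_form'[OF mon_closed]] by simp
      show "\<phi> x (mon p) = \<phi> \<zero>\<^bsub>A\<^esub> (mon p)"
      proof (cases j)
        case 0
        then show ?thesis using xa[of i] \<open>\<phi> \<zero>\<^bsub>A\<^esub> (mon p) = 0\<close> by (simp add: p mon_def)
      next
        case (Suc k)
        \<comment> \<open>Splitting off the last x leaves two terms, with factors \<phi>(a^\<nu>)(x)
          and \<open>\<phi> x x\<close>, both zero.\<close>
        have "mon p = mon (i, k) \<bullet> x" by (simp add: p Suc mon_def A.m_assoc)
        then show ?thesis using 0 by (simp add: phi_x_mult xx phi_a_pow_x[OF q1])
      qed
    qed simp_all
    then have "x = \<zero>\<^bsub>A\<^esub>" by (intro phi_inj) simp_all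
    then show False using x_eq_zero_iff[OF \<alpha>] r1 by blast
  qed
qed

end

end

section \<open>The self-pairing\<close>

lemma (in tensor_pair) tensor_eval_cong:
  assumes b: "kbilin U V field_alg b" and b': "kbilin U V field_alg b'" and t: "t \<in> carrier T"
    and eq: "\<And>u v. u \<in> carrier U \<Longrightarrow> v \<in> carrier V \<Longrightarrow> b u v = b' u v"
  shows "tensor_eval b t = tensor_eval b' t"
  by (rule klin_tensor_eq[OF kspace_field_alg klin_tensor_eval[OF b] klin_tensor_eval[OF b'] _ t])
    (simp add: tensor_eval_pure[OF b] tensor_eval_pure[OF b'] eq)

lemma opp_alg_simps [simp]:
  "carrier (opp_alg A) = carrier A" "mult (opp_alg A) = (\<lambda>u v. v \<otimes>\<^bsub>A\<^esub> u)" "one (opp_alg A) = one A"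
  "zero (opp_alg A) = zero A" "add (opp_alg A) = add A" "smult (opp_alg A) = smult A"
  by (simp_all add: opp_alg_def)

lemma opp_nat_pow:
  fixes A :: "('k::field, 'a, 'm) module_scheme"
  assumes "monoid A" "u \<in> carrier A" shows "u [^]\<^bsub>opp_alg A\<^esub> (m::nat) = u [^]\<^bsub>A\<^esub> m"
proof -
  interpret A: monoid A by fact
  show ?thesis
  proof (induction m)
    case (Suc m)
    have "u [^]\<^bsub>opp_alg A\<^esub> Suc m = u \<otimes>\<^bsub>A\<^esub> u [^]\<^bsub>opp_alg A\<^esub> m" by (simp add: nat_pow_def)
    then show ?case unfolding Suc A.nat_pow_Suc2[OF assms(2)] .
  qed (simp add: nat_pow_def)
qed

text \<open>One setting serves both cases of the theorem. When r = 1 only the exponent 0 of x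
  occurs, so only q^0 enters and q need not be tied to \<omega>; this is what \<open>q_pow\<close>
  records.\<close>

locale H_self_pairing = H_params n q N \<nu> 0 for n :: nat and q :: "'k::field" and N \<nu> :: nat +
  fixes \<omega> :: 'k
  assumes \<omega>: "primitive_root_of_unity N \<omega>" and q_eq: "mult_order (q ^ \<nu>) = 1 \<or> q = \<omega> ^ \<nu>"
begin

abbreviation scale_A0 (infixl \<open>*\<^sub>A\<close> 70) where "c *\<^sub>A u \<equiv> c \<odot>\<^bsub>A\<^esub> u"
abbreviation mult_A0 (infixl \<open>\<bullet>\<close> 70) where "u \<bullet> v \<equiv> u \<otimes>\<^bsub>A\<^esub> v"
abbreviation pow_A0 (infixr \<open>\<up>\<close> 75) where "u \<up> m \<equiv> u [^]\<^bsub>A\<^esub> (m :: nat)"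

lemma q_pow: "j < r \<Longrightarrow> q ^ (j * i) = \<omega> ^ (\<nu> * j * i)"
  using q_eq by (auto simp: r_def power_mult[symmetric] mult.assoc)

lemma mon_eq_zero: "r \<le> j \<Longrightarrow> mon (i, j) = \<zero>\<^bsub>A\<^esub>"
proof -
  assume "r \<le> j"
  then have "x \<up> j = x \<up> r \<bullet> x \<up> (j - r)" by (simp add: A.nat_pow_mult)
  then show ?thesis by (simp add: mon_def x_pow_r)
qed

lemma mon_mult: "mon (i, j) \<bullet> mon (i', j') = q ^ (j * i') *\<^sub>A mon (i + i', j + j')"
proof -
  have "mon (i, j) \<bullet> mon (i', j')
      = a \<up> i \<bullet> (x \<up> j \<bullet> a \<up> i') \<bullet> x \<up> j'"
    by (simp add: mon_def A.m_assoc)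
  also have "\<dots> = q ^ (j * i') *\<^sub>A ((a \<up> i \<bullet> a \<up> i') \<bullet> (x \<up> j \<bullet> x \<up> j'))"
    unfolding x_pow_a_pow by (simp add: mon_def A.smult_mult_l A.smult_mult_r A.m_assoc)
  finally show ?thesis by (simp add: A.nat_pow_mult mon_def)
qed

text \<open>The weight c(j) on x-degree j must satisfy c(j + j') =
  \<open>gauss \<zeta> (j + j') j\<close> c(j) c(j') if products are to match \<Delta>; normalised
  at j = 0 and j = 1 this is the q-factorial.\<close>

definition "gram p p' = (if snd p = snd p' then \<omega> ^ (fst p * fst p') * qfact \<zeta> (snd p) else 0)"

definition "pairing u v = (\<Sum>p\<in>Ix. \<Sum>p'\<in>Ix. coord p u * coord p' v * gram p p')"

lemma omega_mod: "\<omega> ^ ((i mod N) * l) = \<omega> ^ (i * l)"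
proof -
  have "\<omega> ^ i = \<omega> ^ (N * (i div N) + i mod N)" by simp
  also have "\<dots> = \<omega> ^ (i mod N)"
    using \<omega> by (simp only: power_add power_mult primitive_root_of_unity_def power_one mult_1)
  finally show ?thesis by (simp add: power_mult)
qed

lemma gram_sym: "gram p p' = gram p' p"
  by (simp add: gram_def mult.commute)

text \<open>Because of the symmetry, compatibility with the comultiplication and the counit follows
  from compatibility with the product and the unit.\<close>

lemma pairing_sym: "pairing u v = pairing v u"
  unfolding pairing_def by (subst sum.swap) (simp add: gram_sym mult.commute)

lemma klin_pairing_right: "klin A field_alg (pairing u)"
  unfolding pairing_def
  by (rule klin_formI) (simp_all add: klin_form_add[OF klin_coord] klin_form_smult[OF klin_coord]
      algebra_simps sum.distrib sum_distrib_left)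

lemma klin_pairing_left: "klin A field_alg (\<lambda>u. pairing u v)"
proof -
  have "(\<lambda>u. pairing u v) = pairing v" by (rule ext) (rule pairing_sym)
  then show ?thesis using klin_pairing_right[of v] by simp
qed

text \<open>\<omega>^N = 1 makes the formula valid for all exponents of a, so products and
  coproducts of monomials need no reduction modulo N.\<close>

lemma pairing_mon:
  assumes "j < r" "m < r"
  shows "pairing (mon (i, j)) (mon (l, m)) = gram (i, j) (l, m)"
proof -
  have "pairing (mon (i, j)) (mon (l, m))
      = (\<Sum>p\<in>Ix. \<Sum>p'\<in>Ix. if p' = (l mod N, m) then if p = (i mod N, j) then gram p p' else 0 else 0)"
    unfolding pairing_def using assms by (intro sum.cong) (auto simp: coord_mon)
  also have "\<dots> = gram (i mod N, j) (l mod N, m)"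
    using assms N_pos by (simp add: sum.delta)
  also have "\<dots> = gram (i, j) (l, m)"
    using omega_mod[of i "l mod N"] omega_mod[of l i] by (simp add: gram_def mult.commute)
  finally show ?thesis .
qed

lemma pairing_zero [simp]: "pairing \<zero>\<^bsub>A\<^esub> v = 0" "pairing u \<zero>\<^bsub>A\<^esub> = 0"
  using klin_zero[OF A.kspace_axioms kspace_field_alg klin_pairing_left]
    klin_zero[OF A.kspace_axioms kspace_field_alg klin_pairing_right] by simp_all

lemma pairing_smult:
  "u \<in> carrier A \<Longrightarrow> pairing (c *\<^sub>A u) v = c * pairing u v"
  "v \<in> carrier A \<Longrightarrow> pairing u (c *\<^sub>A v) = c * pairing u v"
  by (rule klin_form_smult[OF klin_pairing_left] klin_form_smult[OF klin_pairing_right]; assumption)+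

lemma kbilin_pairing: "kbilin A A field_alg (\<lambda>p p'. pairing u p * pairing u' p')"
  by (intro kbilin_form_mult klin_pairing_right)

text \<open>Both sides are concentrated in m = j + j'. There the scalar from reordering the product
  matches the twist by a^\<nu> in the coproduct, and the factorials match by
  \<open>qfact_add\<close>.\<close>

lemma pairing_mult_mon:
  assumes j: "j < r" "j' < r" "m < r"
  shows "pairing (mon (i, j) \<bullet> mon (i', j')) (mon (l, m))
    = tensor_eval (\<lambda>p p'. pairing (mon (i, j)) p * pairing (mon (i', j')) p') (\<Delta> (mon (l, m)))"
proof -
  note b = kbilin_pairing[of "mon (i, j)" "mon (i', j')"]
  have "tensor_eval (\<lambda>p p'. pairing (mon (i, j)) p * pairing (mon (i', j')) p') (\<Delta> (mon (l, m)))
      = (\<Sum>t\<le>m. tensor_eval (\<lambda>p p'. pairing (mon (i, j)) p * pairing (mon (i', j')) p')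
          (gauss \<zeta> m t \<odot>\<^bsub>TT.T\<^esub> TT.pt (mon (l, t)) (mon (l + \<nu> * t, m - t))))"
    unfolding comult_mon
    using klin_finsum[OF TT.T.kspace_axioms kspace_field_alg TT.klin_tensor_eval[OF b], of "{..m}"] by simp
  \<comment> \<open>Different x-degrees pair to zero: the first factor keeps only t = j, the second
    requires m - t = j'.\<close>
  also have "\<dots> = (\<Sum>t\<le>m. if t = j then (if m - j = j' then gauss \<zeta> m j * (gram (i, j) (l, j) * gram (i', j') (l + \<nu> * j, j')) else 0) else 0)"
    using j by (intro sum.cong) (auto simp: klin_form_smult[OF TT.klin_tensor_eval[OF b]] TT.tensor_eval_pure[OF b] pairing_mon gram_def)
  also have "\<dots> = (if m = j + j' then gauss \<zeta> m j * (gram (i, j) (l, j) * gram (i', j') (l + \<nu> * j, j')) else 0)"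
    by (auto simp: sum.delta)
  also have "\<dots> = pairing (mon (i, j) \<bullet> mon (i', j')) (mon (l, m))"
  proof (cases "j + j' < r")
    case True
    \<comment> \<open>The factor \<open>\<omega> ^ (\<nu> * j * i')\<close> arises on the left from
      a^(\<nu> j) in the second leg of \<Delta>, on the right from moving x^j past a^i', where it is
      q^(j i').\<close>
    have "gauss \<zeta> (j + j') j * (\<omega> ^ (i * l) * qfact \<zeta> j * (\<omega> ^ (i' * (l + \<nu> * j)) * qfact \<zeta> j'))
        = \<omega> ^ (\<nu> * j * i') * (\<omega> ^ ((i + i') * l) * qfact \<zeta> (j + j'))"
      by (simp add: qfact_add power_add algebra_simps)
    then show ?thesis
      using True j by (simp add: mon_mult pairing_smult pairing_mon gram_def q_pow)
  next
    \<comment> \<open>Here x^(j + j') = 0, and m < r excludes m = j + j', so both sides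
      vanish.\<close>
    case False
    then show ?thesis using j by (simp add: mon_mult mon_eq_zero)
  qed
  finally show ?thesis ..
qed

text \<open>The identity is linear in each of u, u' and v, so the monomial case suffices.\<close>

lemma pairing_mult:
  assumes u: "u \<in> carrier A" and u': "u' \<in> carrier A" and v: "v \<in> carrier A"
  shows "pairing (u \<bullet> u') v = tensor_eval (\<lambda>p p'. pairing u p * pairing u' p') (\<Delta> v)"
proof -
  have D: "\<Delta> v \<in> carrier TT.T" if "v \<in> carrier A" for v by (rule klin_closed[OF klin_comult that])
  note ev = klin_comp[OF klin_comult TT.klin_tensor_eval[OF kbilin_pairing]]
  have el: "klin A field_alg (\<lambda>u. tensor_eval (\<lambda>p p'. pairing u p * pairing u' p') t)"
    and er: "klin A field_alg (\<lambda>u. tensor_eval (\<lambda>p p'. pairing u' p * pairing u p') t)"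
    if t: "t \<in> carrier TT.T" for u' t
  proof -
    \<comment> \<open>Linearity in the parameter u is given on pure tensors; the two sides are
      linear in the tensor, so it holds at every t.\<close>
    have lin: "klin A field_alg (\<lambda>u. tensor_eval (b u) t)"
      if b: "\<And>u. kbilin A A field_alg (b u)"
        and pt: "\<And>p p'. p \<in> carrier A \<Longrightarrow> p' \<in> carrier A \<Longrightarrow> klin A field_alg (\<lambda>u. b u p p')" for b
    proof (rule klin_formI)
      note kt = TT.klin_tensor_eval[OF b]
      fix u v assume u: "u \<in> carrier A" "v \<in> carrier A"
      show "tensor_eval (b (u \<oplus>\<^bsub>A\<^esub> v)) t = tensor_eval (b u) t + tensor_eval (b v) t"
      proof (rule TT.klin_tensor_eq[OF kspace_field_alg kt _ _ t])
        show "klin TT.T field_alg (\<lambda>t. tensor_eval (b u) t + tensor_eval (b v) t)"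
          by (rule klin_formI) (simp_all add: klin_form_add[OF kt] klin_form_smult[OF kt] algebra_simps)
      qed (simp add: TT.tensor_eval_pure[OF b] klin_form_add[OF pt] u)
    next
      note kt = TT.klin_tensor_eval[OF b]
      fix c u assume u: "u \<in> carrier A"
      show "tensor_eval (b (c *\<^sub>A u)) t = c * tensor_eval (b u) t"
      proof (rule TT.klin_tensor_eq[OF kspace_field_alg kt _ _ t])
        show "klin TT.T field_alg (\<lambda>t. c * tensor_eval (b u) t)"
          by (rule klin_formI) (simp_all add: klin_form_add[OF kt] klin_form_smult[OF kt] algebra_simps)
      qed (simp add: TT.tensor_eval_pure[OF b] klin_form_smult[OF pt] u)
    qed
    have m: "klin A field_alg (\<lambda>u. f u * c)" "klin A field_alg (\<lambda>u. c * f u)" if "klin A field_alg f" for f c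
      by (rule klin_formI; simp add: klin_form_add[OF that] klin_form_smult[OF that] algebra_simps)+
    show "klin A field_alg (\<lambda>u. tensor_eval (\<lambda>p p'. pairing u p * pairing u' p') t)"
      "klin A field_alg (\<lambda>u. tensor_eval (\<lambda>p p'. pairing u' p * pairing u p') t)"
      by (rule lin; intro kbilin_pairing m klin_pairing_left)+
  qed
  have ml: "klin A field_alg (\<lambda>u. pairing (u \<bullet> u') v)" if "u' \<in> carrier A" for u' v
    by (rule klin_formI) (use that in \<open>simp_all add: A.l_distr A.smult_mult_l pairing_smult klin_form_add[OF klin_pairing_left]\<close>)
  have mr: "klin A field_alg (\<lambda>u'. pairing (u \<bullet> u') v)" if "u \<in> carrier A" for u v
    by (rule klin_formI) (use that in \<open>simp_all add: A.r_distr A.smult_mult_r pairing_smult klin_form_add[OF klin_pairing_left]\<close>)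
  note eqB = B.klin_eq_on_basis[OF kspace_field_alg]
  show ?thesis
  proof (rule eqB[OF ml[OF u'] el[OF D[OF v]] _ u])
    fix p assume p: "p \<in> Ix"
    show "pairing (mon p \<bullet> u') v = tensor_eval (\<lambda>s s'. pairing (mon p) s * pairing u' s') (\<Delta> v)"
    proof (rule eqB[OF mr[OF mon_closed] er[OF D[OF v]] _ u'])
      fix p' assume p': "p' \<in> Ix"
      show "pairing (mon p \<bullet> mon p') v = tensor_eval (\<lambda>s s'. pairing (mon p) s * pairing (mon p') s') (\<Delta> v)"
        by (rule eqB[OF klin_pairing_right ev _ v]) (use p p' pairing_mult_mon in auto)
    qed
  qed
qed

lemma pairing_one: "v \<in> carrier A \<Longrightarrow> pairing \<one>\<^bsub>A\<^esub> v = \<epsilon> v"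
proof (erule B.klin_eq_on_basis[OF kspace_field_alg klin_pairing_right alg_hom_klin[OF counit(1)], rotated])
  fix p assume "p \<in> Ix"
  then obtain l m where p: "p = (l, m)" "m < r" by auto
  have "\<one>\<^bsub>A\<^esub> = mon (0, 0)" by (simp add: mon_def)
  then show "pairing \<one>\<^bsub>A\<^esub> (mon p) = \<epsilon> (mon p)" using p r_pos by (simp add: pairing_mon counit_mon gram_def)
qed

text \<open>Fourier inversion over the powers of \<open>a\<close>.\<close>

lemma pairing_fourier:
  assumes u: "u \<in> carrier A" and ij: "i < N" "j < r"
  shows "(\<Sum>l<N. pairing u (mon (l, j)) * inverse \<omega> ^ (i * l)) = coord (i, j) u * (of_nat N * qfact \<zeta> j)"
proof (rule B.klin_eq_on_basis[OF kspace_field_alg _ _ _ u])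
  show "klin A field_alg (\<lambda>u. \<Sum>l<N. pairing u (mon (l, j)) * inverse \<omega> ^ (i * l))"
    by (rule klin_formI) (simp_all add: klin_form_add[OF klin_pairing_left] pairing_smult algebra_simps sum.distrib sum_distrib_left)
  show "klin A field_alg (\<lambda>u. coord (i, j) u * (of_nat N * qfact \<zeta> j))"
    by (rule klin_formI) (simp_all add: klin_form_add[OF klin_coord] klin_form_smult[OF klin_coord] algebra_simps)
  fix p assume "p \<in> Ix"
  then obtain i' j' where p: "p = (i', j')" "i' < N" "j' < r" by auto
  have "(\<Sum>l<N. pairing (mon p) (mon (l, j)) * inverse \<omega> ^ (i * l))
      = (if j' = j then (\<Sum>l<N. \<omega> ^ (i' * l) * inverse \<omega> ^ (i * l)) * qfact \<zeta> j else 0)"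
    using p ij by (simp add: pairing_mon gram_def sum_distrib_left sum_distrib_right mult_ac)
  then show "(\<Sum>l<N. pairing (mon p) (mon (l, j)) * inverse \<omega> ^ (i * l)) = coord (i, j) (mon p) * (of_nat N * qfact \<zeta> j)"
    using p ij by (auto simp: primitive_root_sum[OF \<omega>] coord_mon)
qed

text \<open>These are the factors by which Fourier inversion divides: the order of \<zeta> is r, and
  the existence of \<omega> makes N invertible.\<close>

lemma scale_nonzero: "j < r \<Longrightarrow> of_nat N * qfact \<zeta> j \<noteq> 0"
  using qfact_nonzero[OF r_primitive] primitive_root_of_nat_nonzero[OF \<omega>] by simp

definition "\<phi> u = restrict (pairing u) (carrier A)"

lemma phi_closed: "\<phi> u \<in> linear_forms H"
  using restrict_linear_forms[OF HB.kspace_axioms, of "pairing u"] klin_pairing_right by (simp add: \<phi>_def)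

lemma bij_betw_phi: "bij_betw \<phi> (carrier A) (linear_forms H)"
  unfolding bij_betw_def
proof
  show "inj_on \<phi> (carrier A)"
  proof (rule inj_onI)
    fix u v assume u: "u \<in> carrier A" and v: "v \<in> carrier A" and eq: "\<phi> u = \<phi> v"
    have "pairing u h = pairing v h" if "h \<in> carrier A" for h
      using fun_cong[OF eq, of h] that by (simp add: \<phi>_def)
    then have "coord p u = coord p v" if "p \<in> Ix" for p
      using that pairing_fourier[OF u, of "fst p" "snd p"] pairing_fourier[OF v, of "fst p" "snd p"] scale_nonzero[of "snd p"]
      by auto
    then show "u = v" using B.expand[OF u] B.expand[OF v] by (metis (no_types, lifting) A.finsum_cong' Pi_I A.smult_closed mon_closed)
  qed
  show "\<phi> ` carrier A = linear_forms H"
  proof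
    show "\<phi> ` carrier A \<subseteq> linear_forms H" using phi_closed by auto
    show "linear_forms H \<subseteq> \<phi> ` carrier A"
    proof
      fix f assume f: "f \<in> linear_forms H"
      then have fl: "klin A field_alg f" by (simp add: mem_linear_forms)
      \<comment> \<open>The preimage of f: its values on monomials, Fourier-inverted in the exponent
        of a and divided by the weight of the x-degree.\<close>
      define c where "c = (\<lambda>(i, j). (\<Sum>l<N. f (mon (l, j)) * inverse \<omega> ^ (i * l)) / (of_nat N * qfact \<zeta> j))"
      define u where "u = finsum A (\<lambda>p. c p *\<^sub>A mon p) Ix"
      have u: "u \<in> carrier A" unfolding u_def by (rule A.finsum_closed) simp
      have "pairing u h = f h" if h: "h \<in> carrier A" for h
      proof (rule B.klin_eq_on_basis[OF kspace_field_alg klin_pairing_right fl _ h])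
        fix p assume "p \<in> Ix"
        then obtain l m where p: "p = (l, m)" "l < N" "m < r" by auto
        have "pairing u (mon p) = (\<Sum>p'\<in>Ix. pairing (c p' *\<^sub>A mon p') (mon p))"
          unfolding u_def
          using klin_finsum[OF A.kspace_axioms kspace_field_alg klin_pairing_left[of "mon p"], of Ix "\<lambda>p. c p *\<^sub>A mon p"] by simp
        also have "\<dots> = (\<Sum>i<N. \<Sum>j<r. c (i, j) * gram (i, j) (l, m))"
          using p by (simp add: sum.cartesian_product pairing_smult pairing_mon case_prod_beta)
            (auto intro!: sum.cong simp: pairing_smult pairing_mon)
        also have "\<dots> = (\<Sum>i<N. c (i, m) * (\<omega> ^ (i * l) * qfact \<zeta> m))"
          using p by (simp add: gram_def if_distrib sum.delta cong: if_cong)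
        also have "\<dots> = (\<Sum>i<N. (\<Sum>l'<N. f (mon (l', m)) * inverse \<omega> ^ (i * l')) * \<omega> ^ (i * l)) / of_nat N"
        proof -
          have "y / (of_nat N * qfact \<zeta> m) * (w * qfact \<zeta> m) = y * w / of_nat N" for y w :: 'k
            using scale_nonzero[OF p(3)] by (simp add: field_simps)
          then show ?thesis by (simp only: c_def prod.case sum_divide_distrib[symmetric])
        qed
        also have "(\<Sum>i<N. (\<Sum>l'<N. f (mon (l', m)) * inverse \<omega> ^ (i * l')) * \<omega> ^ (i * l))
            = (\<Sum>l'<N. f (mon (l', m)) * (\<Sum>i<N. \<omega> ^ (l * i) * inverse \<omega> ^ (l' * i)))"
          unfolding sum_distrib_right sum_distrib_left
          by (subst sum.swap) (simp add: algebra_simps)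
        also have "\<dots> = f (mon p) * of_nat N"
          using p by (simp add: primitive_root_sum[OF \<omega>] if_distrib sum.delta cong: if_cong)
        finally show "pairing u (mon p) = f (mon p)"
          using primitive_root_of_nat_nonzero[OF \<omega>] by simp
      qed
      then have "\<phi> u = f"
        using f phi_closed by (intro linear_forms_eqI[of _ H]) (simp_all add: \<phi>_def)
      then show "f \<in> \<phi> ` carrier A" using u by blast
    qed
  qed
qed

subsection \<open>The antipode\<close>

abbreviation "S \<equiv> H_antipode n q N \<nu> 0"

lemma inv_a: "inv\<^bsub>A\<^esub> a = a \<up> (N - 1)"
proof (rule A.inv_char)
  show "a \<bullet> a \<up> (N - 1) = \<one>\<^bsub>A\<^esub>"
    using A.nat_pow_Suc2[OF a_closed, of "N - 1"] N_pos a_pow_N by simp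
  show "a \<up> (N - 1) \<bullet> a = \<one>\<^bsub>A\<^esub>"
    using A.nat_pow_Suc[of a "N - 1"] N_pos a_pow_N by simp
qed simp_all

text \<open>The prescribed value -q^(-\<nu>) a^(-\<nu>) x of the antipode, with a^(-1) = a^(N-1) so
  that exponents stay natural numbers.\<close>

definition "sx = (- inverse \<zeta>) *\<^sub>A mon ((N - 1) * \<nu>, 1)"

text \<open>Only the shape of these powers matters, a scalar times one monomial; the scalar is never
  computed.\<close>

lemma mon_k_pow: "\<exists>c. \<forall>k. mon (k, 1) \<up> j = c k *\<^sub>A mon (k * j, j)"
proof (induction j)
  case 0
  show ?case by (intro exI[of _ "\<lambda>_. 1"]) (simp add: mon_def)
next
  case (Suc j)
  then obtain c where c: "mon (k, 1) \<up> j = c k *\<^sub>A mon (k * j, j)" for k by blast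
  have "mon (k, 1) \<up> Suc j = (c k * q ^ (j * k)) *\<^sub>A mon (k * Suc j, Suc j)" for k
  proof -
    have "mon (k, 1) \<up> Suc j = c k *\<^sub>A mon (k * j, j) \<bullet> mon (k, 1)"
      by (simp only: A.nat_pow_Suc c)
    then show ?thesis by (simp add: A.smult_mult_l mon_mult A.smult_assoc add.commute)
  qed
  then show ?case by (intro exI[of _ "\<lambda>k. c k * q ^ (j * k)"]) simp
qed

lemma sx_pow: "\<exists>c. sx \<up> j = c *\<^sub>A mon ((N - 1) * \<nu> * j, j)"
proof -
  obtain c where "mon ((N - 1) * \<nu>, 1) \<up> j = c ((N - 1) * \<nu>) *\<^sub>A mon ((N - 1) * \<nu> * j, j)"
    using mon_k_pow by metis
  then show ?thesis unfolding sx_def by (simp add: A.nat_pow_smult A.smult_assoc[symmetric]) blast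
qed

lemma sx_closed [simp]: "sx \<in> carrier A" by (simp add: sx_def)

lemma kalgebra_opp: "kalgebra (opp_alg A)" by (rule kalgebra_opp[OF A.kalgebra_axioms])

lemma antipode_ex1: "\<exists>!s. s \<in> extensional (carrier A) \<and> alg_hom A (opp_alg A) s \<and>
  s a = inv\<^bsub>A\<^esub> a \<and> s x = (- inverse \<zeta>) *\<^sub>A ((inv\<^bsub>A\<^esub> a) \<up> \<nu> \<bullet> x)"
proof (rule alg_hom_H_ex1[OF kalgebra_opp])
  have sx: "(- inverse \<zeta>) *\<^sub>A ((inv\<^bsub>A\<^esub> a) \<up> \<nu> \<bullet> x) = sx"
    by (simp add: sx_def mon_def inv_a A.nat_pow_pow)
  interpret O: kalgebra "opp_alg A" by (rule kalgebra_opp)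
  note pow = opp_nat_pow[OF A.monoid_axioms]
  show "inv\<^bsub>A\<^esub> a \<in> carrier (opp_alg A)" "(- inverse \<zeta>) *\<^sub>A ((inv\<^bsub>A\<^esub> a) \<up> \<nu> \<bullet> x) \<in> carrier (opp_alg A)"
    by (simp_all add: inv_a)
  have "(a \<up> (N - 1)) \<up> N = \<one>\<^bsub>A\<^esub>"
    by (simp add: A.nat_pow_pow mult.commute[of _ N]) (simp add: A.nat_pow_pow[symmetric] a_pow_N)
  then show "inv\<^bsub>A\<^esub> a [^]\<^bsub>opp_alg A\<^esub> N = \<one>\<^bsub>opp_alg A\<^esub>" by (simp add: pow inv_a)
  obtain c where "sx \<up> r = c *\<^sub>A mon ((N - 1) * \<nu> * r, r)" using sx_pow by blast
  \<comment> \<open>The rth power is a multiple of a monomial containing x^r = 0.\<close>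
  then have "sx \<up> r = \<zero>\<^bsub>A\<^esub>" by (simp add: mon_eq_zero)
  moreover have "inv\<^bsub>A\<^esub> a [^]\<^bsub>opp_alg A\<^esub> (\<nu> * r) \<ominus>\<^bsub>opp_alg A\<^esub> \<one>\<^bsub>opp_alg A\<^esub> \<in> carrier (opp_alg A)"
    by (intro O.minus_closed O.nat_pow_closed O.one_closed) (simp add: inv_a)
  from O.smult_zero_left[OF this] have "0 \<odot>\<^bsub>opp_alg A\<^esub> (inv\<^bsub>A\<^esub> a [^]\<^bsub>opp_alg A\<^esub> (\<nu> * r) \<ominus>\<^bsub>opp_alg A\<^esub> \<one>\<^bsub>opp_alg A\<^esub>) = \<zero>\<^bsub>A\<^esub>"
    by simp
  ultimately show "((- inverse \<zeta>) *\<^sub>A ((inv\<^bsub>A\<^esub> a) \<up> \<nu> \<bullet> x)) [^]\<^bsub>opp_alg A\<^esub> r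
      = 0 \<odot>\<^bsub>opp_alg A\<^esub> (inv\<^bsub>A\<^esub> a [^]\<^bsub>opp_alg A\<^esub> (\<nu> * r) \<ominus>\<^bsub>opp_alg A\<^esub> \<one>\<^bsub>opp_alg A\<^esub>)"
    by (simp add: sx pow)
  have a_mon: "inv\<^bsub>A\<^esub> a = mon (N - 1, 0)" by (simp add: inv_a mon_def)
  \<comment> \<open>In the opposite algebra the commutation relation compares a^(N-1) s(x) with q
    s(x) a^(N-1); reordering the latter contributes q^(N-1).\<close>
  have "q * q ^ (N - Suc 0) = 1" using N_pos q_pow_N by (simp flip: power_Suc)
  then have e: "q * (inverse \<zeta> * q ^ (N - Suc 0)) = inverse \<zeta>" by (simp only: mult.left_commute[of q] mult_1_right)
  show "((- inverse \<zeta>) *\<^sub>A ((inv\<^bsub>A\<^esub> a) \<up> \<nu> \<bullet> x)) \<otimes>\<^bsub>opp_alg A\<^esub> inv\<^bsub>A\<^esub> a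
      = q \<odot>\<^bsub>opp_alg A\<^esub> (inv\<^bsub>A\<^esub> a \<otimes>\<^bsub>opp_alg A\<^esub> ((- inverse \<zeta>) *\<^sub>A ((inv\<^bsub>A\<^esub> a) \<up> \<nu> \<bullet> x)))"
    unfolding sx unfolding a_mon
    by (simp add: sx_def A.smult_mult_l A.smult_mult_r mon_mult A.smult_assoc[symmetric] add.commute mult.assoc e)
qed

lemma antipode: "alg_hom A (opp_alg A) S" "S a = mon (N - 1, 0)" "S x = sx"
  using theI'[OF antipode_ex1] unfolding H_antipode_def Let_def
  by (simp_all add: inv_a sx_def mon_def A.nat_pow_pow)

text \<open>The constant c is chosen before i: it depends on the x-degree alone, so the same
  constant appears on both sides of \<open>pairing_antipode\<close>.\<close>

lemma antipode_mon: "\<exists>c. \<forall>i. S (mon (i, j)) = (c * q ^ (j * ((N - 1) * i))) *\<^sub>A mon ((N - 1) * \<nu> * j + (N - 1) * i, j)"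
proof -
  obtain c where c: "sx \<up> j = c *\<^sub>A mon ((N - 1) * \<nu> * j, j)" using sx_pow by blast
  note pow = alg_hom_nat_pow[OF A.kalgebra_axioms kalgebra_opp antipode(1)]
  have "S (mon (i, j)) = sx \<up> j \<bullet> mon (N - 1, 0) \<up> i" for i
    by (simp add: mon_def[of "(i, j)"] alg_hom_mult[OF antipode(1)] pow antipode(2,3) opp_nat_pow[OF A.monoid_axioms])
  moreover have "mon (N - 1, 0) \<up> i = mon ((N - 1) * i, 0)" for i :: nat
    by (simp add: mon_def A.nat_pow_pow)
  ultimately show ?thesis
    by (intro exI[of _ c]) (simp add: c A.smult_mult_l mon_mult A.smult_assoc)
qed

text \<open>On monomials of equal x-degree j both sides are the same constant times \<omega> to the
  power (N - 1)(\<nu> j i + \<nu> j l + i l), which is symmetric in i and l; unequal degrees give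
  zero.\<close>

lemma pairing_antipode:
  assumes u: "u \<in> carrier A" and v: "v \<in> carrier A"
  shows "pairing (S u) v = pairing u (S v)"
proof -
  have Sl: "klin A A S" using alg_hom_klin[OF antipode(1)] by (simp add: klin_def)
  note eqB = B.klin_eq_on_basis[OF kspace_field_alg]
  show ?thesis
  proof (rule eqB[OF klin_comp[OF Sl klin_pairing_left] klin_pairing_left _ u])
    fix p assume "p \<in> Ix"
    then obtain i j where p: "p = (i, j)" "j < r" by auto
    show "pairing (S (mon p)) v = pairing (mon p) (S v)"
    proof (rule eqB[OF klin_pairing_right klin_comp[OF Sl klin_pairing_right] _ v])
      fix p' assume "p' \<in> Ix"
      then obtain l m where p': "p' = (l, m)" "m < r" by auto
      obtain c where c: "S (mon (i, j)) = (c * q ^ (j * ((N - 1) * i))) *\<^sub>A mon ((N - 1) * \<nu> * j + (N - 1) * i, j)" for i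
        using antipode_mon[of j] by blast
      obtain d where d: "S (mon (i, m)) = (d * q ^ (m * ((N - 1) * i))) *\<^sub>A mon ((N - 1) * \<nu> * m + (N - 1) * i, m)" for i
        using antipode_mon[of m] by blast
      show "pairing (S (mon p)) (mon p') = pairing (mon p) (S (mon p'))"
      proof (cases "j = m")
        case True
        then have p'': "p' = (l, j)" using p' by simp
        \<comment> \<open>With N - 1 opaque the exponents compare as polynomials, once the powers of
          q have been turned into powers of \<omega>.\<close>
        define M where "M = N - 1"
        note c' = c[folded M_def, unfolded q_pow[OF p(2)]]
        have "pairing (S (mon p)) (mon p') = c * qfact \<zeta> j * \<omega> ^ (M * (\<nu> * j * i + \<nu> * j * l + i * l))"
          using p by (simp add: p'' c' pairing_smult pairing_mon gram_def q_pow power_add algebra_simps)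
        moreover have "pairing (mon p) (S (mon p')) = c * qfact \<zeta> j * \<omega> ^ (M * (\<nu> * j * i + \<nu> * j * l + i * l))"
          using p by (simp add: p'' c' pairing_smult pairing_mon gram_def q_pow power_add algebra_simps)
        ultimately show ?thesis by simp
      next
        case False
        then show ?thesis using p p' by (simp add: c d pairing_smult pairing_mon gram_def)
      qed
    qed
  qed
qed

lemma hopf_iso_phi: "hopf_iso H (dual_hopf H) \<phi>"
proof -
  note [simp] = HB.dual_hopf_simps
  have app: "\<phi> u h = pairing u h" if "h \<in> carrier A" for u h using that by (simp add: \<phi>_def)
  have D: "\<Delta> h \<in> carrier TT.T" if "h \<in> carrier A" for h by (rule klin_closed[OF klin_comult that])
  have kr: "klin A field_alg (\<phi> u)" for u using phi_closed by (simp add: mem_linear_forms)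
  have lin: "klin A HB.D \<phi>"
  proof (rule klinI)
    show "\<phi> (u \<oplus>\<^bsub>A\<^esub> v) = \<phi> u \<oplus>\<^bsub>HB.D\<^esub> \<phi> v" if "u \<in> carrier A" "v \<in> carrier A" for u v
      using that by (simp add: \<phi>_def klin_form_add[OF klin_pairing_left] cong: restrict_cong)
    show "\<phi> (c *\<^sub>A u) = c \<odot>\<^bsub>HB.D\<^esub> \<phi> u" if "u \<in> carrier A" for c u
      using that by (simp add: \<phi>_def pairing_smult cong: restrict_cong)
  qed (simp add: phi_closed)
  have kl: "klin A field_alg (\<lambda>u. \<phi> u h)" if "h \<in> carrier A" for h
    using klin_pairing_left[of h] by (simp add: app[OF that])
  have mult: "tensor_eval (\<lambda>p p'. \<phi> u p * \<phi> u' p') (\<Delta> h) = pairing (u \<bullet> u') h"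
    if "u \<in> carrier A" "u' \<in> carrier A" "h \<in> carrier A" for u u' h
    unfolding pairing_mult[OF that]
    by (rule TT.tensor_eval_cong[OF kbilin_form_mult[OF kr kr] kbilin_pairing D[OF that(3)]]) (simp add: app)
  \<comment> \<open>By symmetry the evaluation in the other arguments is again given by
    \<open>pairing_mult\<close>.\<close>
  have comult: "tensor_eval (\<lambda>p p'. \<phi> p u * \<phi> p' u') (\<Delta> h) = pairing (u \<bullet> u') h"
    if "u \<in> carrier A" "u' \<in> carrier A" "h \<in> carrier A" for u u' h
    unfolding pairing_mult[OF that]
    by (rule TT.tensor_eval_cong[OF kbilin_form_mult[OF kl kl] kbilin_pairing D[OF that(3)]])
      (simp_all add: app that pairing_sym)
  have tp: "tensor_pair A A" "tensor_pair HB.D HB.D" by (rule TT.tensor_pair_axioms HB.DD.tensor_pair_axioms)+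
  show ?thesis
    unfolding hopf_iso_def
  proof (intro conjI ballI)
    show "alg_hom H (dual_hopf H) \<phi>"
    proof (rule alg_homI)
      show "klin H (dual_hopf H) \<phi>" using lin by (simp add: HB.klin_dual_hopf)
      show "\<phi> \<one>\<^bsub>H\<^esub> = \<one>\<^bsub>dual_hopf H\<^esub>" by (simp add: \<phi>_def pairing_one cong: restrict_cong)
      show "\<phi> (u \<otimes>\<^bsub>H\<^esub> v) = \<phi> u \<otimes>\<^bsub>dual_hopf H\<^esub> \<phi> v" if "u \<in> carrier H" "v \<in> carrier H" for u v
        using that by (simp add: \<phi>_def[of "u \<bullet> v"] mult cong: restrict_cong)
    qed
    show "bij_betw \<phi> (carrier H) (carrier (dual_hopf H))" using bij_betw_phi by simp
    fix h assume "h \<in> carrier H"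
    then have h: "h \<in> carrier A" by simp
    let ?t = "tensor_map HB.D HB.D \<phi> \<phi> (\<Delta> h)"
    have t: "?t \<in> carrier (tensor_alg HB.D HB.D)" by (rule klin_closed[OF klin_tensor_map[OF tp lin lin] D[OF h]])
    have "tensor_eval (\<lambda>g g'. g u * g' v) ?t = \<phi> h (u \<bullet> v)" if "u \<in> carrier A" "v \<in> carrier A" for u v
    proof -
      have "tensor_eval (\<lambda>g g'. g u * g' v) ?t = tensor_eval (\<lambda>p p'. \<phi> p u * \<phi> p' v) (\<Delta> h)"
        by (rule tensor_eval_map[OF tp lin lin HB.kbilin_eval2 D[OF h]]) (use that in simp_all)
      also have "\<dots> = pairing (u \<bullet> v) h" by (rule comult[OF that h])
      finally show ?thesis using that by (simp add: app pairing_sym[of h])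
    qed
    then show "comult (dual_hopf H) (\<phi> h) = tensor_map (dual_hopf H) (dual_hopf H) \<phi> \<phi> (comult H h)"
      using HB.comult_dual_eq_iff[OF phi_closed t] by (simp add: HB.tensor_map_dual_hopf)
    show "counit (dual_hopf H) (\<phi> h) = counit H h"
      using h by (simp add: app pairing_sym[of h] pairing_one)
    have "S u \<in> carrier A" if "u \<in> carrier A" for u
      using klin_closed[OF alg_hom_klin[OF antipode(1)] that] by simp
    then show "\<phi> (antipode H h) = antipode (dual_hopf H) (\<phi> h)"
      using h by (simp add: \<phi>_def pairing_antipode cong: restrict_cong)
  qed
qed

end

text \<open>For n coprime to \<nu>, n divides \<nu> m only if it divides m; this supplies the locale
  hypothesis \<open>order_nonzero\<close>.\<close>

lemma mult_order_coprime:
  assumes q: "primitive_root_of_unity n (q::'k::field)" and "coprime n \<nu>"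
  shows "mult_order (q ^ \<nu>) = n"
  unfolding mult_order_def
proof (rule Least_equality)
  show "0 < n \<and> (q ^ \<nu>) ^ n = 1"
    using q primitive_root_pow_eq_1_iff[OF q, of "\<nu> * n"] by (auto simp: primitive_root_of_unity_def power_mult)
  fix m assume "0 < m \<and> (q ^ \<nu>) ^ m = 1"
  then have "n dvd \<nu> * m" "0 < m" using primitive_root_pow_eq_1_iff[OF q, of "\<nu> * m"] by (auto simp: power_mult)
  then show "n \<le> m" using assms(2) by (simp add: coprime_dvd_mult_right_iff dvd_imp_le)
qed

text \<open>The last hypothesis concerns the group algebra: when \<alpha> = 0 and r = 1 an
  isomorphism with the dual already produces a primitive Nth root of unity
  (\<open>phi_a_primitive\<close>), so the field must contain one for the converse to hold.\<close>

theorem theorem2p4: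
  fixes q \<alpha> :: "'k::field" and n N \<nu> :: nat
  assumes "0 < n" and "n dvd N" and "1 \<le> \<nu>" and "\<nu> < N"
    and "primitive_root_of_unity n q"
    and "\<alpha> \<noteq> 0 \<Longrightarrow> coprime n \<nu> \<and> 1 < n \<and> \<not> N dvd \<nu> * n"
    and "mult_order (q ^ \<nu>) = 1 \<Longrightarrow> \<exists>\<omega> :: 'k. primitive_root_of_unity N \<omega>"
  shows "self_dual (H_hopf n q N \<nu> \<alpha>) \<longleftrightarrow>
    \<alpha> = 0 \<and> (H0_is_cyclic_group_alg n q N \<nu> \<or> H0_is_H_omega q N \<nu>)"
proof -
  \<comment> \<open>The right-hand side refers to the algebra with parameter 0 whatever \<alpha> is,
    so both parameters are interpreted.\<close>
  have par: "H_params n q N \<nu> \<beta>" if "\<beta> = 0 \<or> \<beta> = \<alpha>" for \<beta>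
    using assms mult_order_coprime[OF assms(5)] that
    by unfold_locales (auto simp: primitive_root_of_unity_def)
  interpret H_params n q N \<nu> \<alpha> by (rule par) simp
  interpret H0: H_params n q N \<nu> 0 by (rule par) simp
  have cyc: "H0_is_cyclic_group_alg n q N \<nu> \<longleftrightarrow> mult_order (q ^ \<nu>) = 1"
    unfolding H0_is_cyclic_group_alg_def using H0.x_eq_zero_iff by (simp add: H0.r_def)
  show ?thesis
  proof
    assume "self_dual (H_hopf n q N \<nu> \<alpha>)"
    then obtain \<phi> where iso: "hopf_iso H (dual_hopf H) \<phi>" by (auto simp: self_dual_def hopf_isomorphic_def)
    have "q ^ 1 \<noteq> 1" if "1 < n" using assms(5) that unfolding primitive_root_of_unity_def by blast
    then have \<alpha>: "\<alpha> = 0"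
      using self_dual_imp_alpha_zero[OF iso] assms(6) by auto
    show "\<alpha> = 0 \<and> (H0_is_cyclic_group_alg n q N \<nu> \<or> H0_is_H_omega q N \<nu>)"
    proof (cases "r = 1")
      case True
      then show ?thesis using \<alpha> cyc by (simp add: r_def)
    next
      case False
      note w = self_dual_imp_root[OF iso \<alpha> False]
      have "\<not> N dvd \<nu>\<^sup>2"
      proof
        assume "N dvd \<nu>\<^sup>2"
        \<comment> \<open>q^\<nu> is the \<nu>^2-th power of the root, and it is 1 only if r =
          1.\<close>
        then have "\<phi> a a ^ (\<nu> * \<nu>) = 1" using primitive_root_pow_eq_1_iff[OF w(1)] by (simp add: power2_eq_square)
        then have "q ^ \<nu> = 1" using w(2) by (simp add: power_mult)
        then show False using r_primitive False r_pos unfolding primitive_root_of_unity_def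
          by (metis less_one linorder_neqE_nat power_one_right)
      qed
      then show ?thesis using \<alpha> w unfolding H0_is_H_omega_def by blast
    qed
  next
    assume R: "\<alpha> = 0 \<and> (H0_is_cyclic_group_alg n q N \<nu> \<or> H0_is_H_omega q N \<nu>)"
    \<comment> \<open>In the group algebra case any primitive root serves; otherwise it is the one
      with q = \<omega>^\<nu>.\<close>
    then obtain \<omega> :: 'k where "primitive_root_of_unity N \<omega>" "mult_order (q ^ \<nu>) = 1 \<or> q = \<omega> ^ \<nu>"
      using assms(7) unfolding cyc H0_is_H_omega_def by blast
    then interpret H_self_pairing n q N \<nu> \<omega> by unfold_locales
    show "self_dual (H_hopf n q N \<nu> \<alpha>)"
      using hopf_iso_phi R by (auto simp: self_dual_def hopf_isomorphic_def)
  qed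
qed

end
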